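(* Let $u\in L^2(Q)$ be the optimal control of the problem of minimizing $\mathcal{J}(y(v),v)=\frac12\|y(v)-y_d\|^2+\frac\lambda2\|v\|^2$ over $v\in L^2(Q)$, where $y(v)$ is the time-periodic parabolic state belonging to $v$, and let $|||u-v|||^2:=\frac12\|y(u)-y(v)\|^2+\frac\lambda2\|u-v\|^2$. For every $v\in L^2(Q)$, $\eta,\zeta\in H^{1,1}_{0,per}(Q)$, $\boldsymbol{\tau},\boldsymbol{\rho}\in H(\mathrm{div},Q)$ and $\alpha,\beta>0$, the functional $$\begin{aligned}\mathcal{M}^\oplus(\alpha,\beta;\eta,\zeta,\boldsymbol{\tau},\boldsymbol{\rho},v)=\ &\tfrac\alpha2\|\eta-y_d\|^2+\gamma\Big(\|\mathcal{R}_2(\eta,\boldsymbol{\tau})\|^2+\tfrac{C_F^2}{\beta}\|\mathcal{R}_1(\eta,\boldsymbol{\tau},v)\|^2\Big)+\tfrac\lambda2\|v\|^2-\tfrac1{2\lambda}\|\zeta\|^2\\&+\int_Q\big(\nu\nabla\eta\cdot\nabla\zeta+\sigma\partial_t\eta\,\zeta+\lambda^{-1}\zeta^2\big)\,d\boldsymbol{x}\,dt+\frac{C_F^2}{\underline{\mu_1}^2\lambda}\big(C_F\|\mathcal{R}_3(\zeta,\boldsymbol{\rho},\eta)\|+\|\mathcal{R}_4(\zeta,\boldsymbol{\rho})\|\big)^2\\&+\frac1{\underline{\mu_1}}\big(C_F\|\mathcal{R}_1(\eta,\boldsymbol{\tau},-\lambda^{-1}\zeta)\|+\|\mathcal{R}_2(\eta,\boldsymbol{\tau})\|\big)\big(C_F\|\mathcal{R}_3(\zeta,\boldsymbol{\rho},\eta)\|+\|\mathcal{R}_4(\zeta,\boldsymbol{\rho})\|\big)\end{aligned}$$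 is a majorant of the discretization error: $$|||u-v|||^2\le\mathcal{M}^\oplus(\alpha,\beta;\eta,\zeta,\boldsymbol{\tau},\boldsymbol{\rho},v)=\mathcal{J}^\oplus(\alpha,\beta;\eta,\boldsymbol{\tau},v)-\mathcal{J}^\ominus(\eta,\zeta,\boldsymbol{\tau},\boldsymbol{\rho}).$$
   Context: Setting. $\Omega\subset\mathbb{R}^d$, $d\in\{1,2,3\}$, is a bounded Lipschitz domain with boundary $\Gamma$; $T>0$, $\omega=2\pi/T$, $Q=\Omega\times(0,T)$, $\Sigma=\Gamma\times(0,T)$. The coefficients $\sigma,\nu$ are functions on $\Omega$ with $0<\underline{\sigma}\le\sigma(\boldsymbol{x})\le\overline{\sigma}$ and $0<\underline{\nu}\le\nu(\boldsymbol{x})\le\overline{\nu}$ for constants; $\lambda>0$; $y_d\in L^2(Q)$. $\|\cdot\|$ is the norm in $L^2(Q)$ (or $[L^2(Q)]^d$), $\langle\cdot,\cdot\rangle_\Omega$, $\|\cdot\|_\Omega$ are those of $L^2(\Omega)$ (componentwise for vectors); $\nabla$, $\nabla\cdot$ act in space. $C_F>0$ is Friedrichs' constant: $\|w\|_\Omega\le C_F\|\nabla w\|_\Omega$ for all $w\in H^1_0(\Omega)$. Fourier series. Every $w\in L^2(Q)$ is written $w=w_0^c+\sum_{k\ge1}(w_k^c\cos(k\omega t)+w_k^s\sin(k\omega t))$ (usual Fourier coefficients in time, in $L^2(\Omega)$); $\boldsymbol{w}_k=(w_k^c,w_k^s)^T$, $\boldsymbol{w}_k^\perp=(-w_k^s,w_k^c)^T$,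 $w^\perp=\sum_{k\ge1}(\boldsymbol{w}_k^\perp)^T\cdot(\cos(k\omega t),\sin(k\omega t))^T$. Define $\|\partial_t^{1/2}w\|^2=\frac T2\sum_{k\ge1}k\omega\|\boldsymbol{w}_k\|_\Omega^2$ and $\int_Q\sigma\,\partial_t^{1/2}w\,\partial_t^{1/2}z\,d\boldsymbol{x}\,dt=\frac T2\sum_{k\ge1}k\omega\langle\sigma\boldsymbol{w}_k,\boldsymbol{z}_k\rangle_\Omega$. With this convention $\int_Q\sigma\,\partial_t^{1/2}w\,\partial_t^{1/2}z^\perp=\int_Q\sigma\,\partial_tw\,z$ whenever $w$ is $T$-periodic in time with $\partial_tw\in L^2(Q)$. Spaces. $H^{1,\frac12}_{0,per}(Q)=\{w\in L^2(Q):\nabla w\in[L^2(Q)]^d,\ \|\partial_t^{1/2}w\|<\infty,\ w=0\text{ on }\Sigma\}$. $H^{1,1}_{0,per}(Q)=\{w\in L^2(Q):\nabla w\in[L^2(Q)]^d,\ \partial_tw\in L^2(Q),\ w=0\text{ on }\Sigma,\ w(0)=w(T)\text{ in }\overline\Omega\}$. $H(\mathrm{div},Q)=\{\boldsymbol{\tau}\in[L^2(Q)]^d:\ \nabla\cdot\boldsymbol{\tau}(\cdot,t)\in L^2(\Omega)\text{ for a.e. }t\in(0,T)\}$, with in addition $\nabla\cdot\boldsymbol{\tau}\in L^2(Q)$. State. For $v\in L^2(Q)$, $y(v)\in H^{1,\frac12}_{0,per}(Q)$ is the weak solution of $\sigma\partial_ty-\nabla\cdot(\nu\nabla y)=v$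 in $Q$, $y=0$ on $\Sigma$, $y(0)=y(T)$ in $\overline\Omega$, i.e. $\int_Q(\nu\nabla y\cdot\nabla q+\sigma\partial_t^{1/2}y\,\partial_t^{1/2}q^\perp)\,d\boldsymbol{x}\,dt=\int_Qv\,q\,d\boldsymbol{x}\,dt$ for all $q\in H^{1,\frac12}_{0,per}(Q)$. Residuals and constants. $\mathcal{R}_1(\eta,\boldsymbol{\tau},v)=\sigma\partial_t\eta-\nabla\cdot\boldsymbol{\tau}-v$, $\mathcal{R}_2(\eta,\boldsymbol{\tau})=\boldsymbol{\tau}-\nu\nabla\eta$, $\mathcal{R}_3(\zeta,\boldsymbol{\rho},\eta)=\eta-y_d+\nabla\cdot\boldsymbol{\rho}+\sigma\partial_t\zeta$, $\mathcal{R}_4(\zeta,\boldsymbol{\rho})=\boldsymbol{\rho}-\nu\nabla\zeta$; $\underline{\mu_1}=\frac1{\sqrt2}\min\{\underline\nu,\underline\sigma\}$; $\gamma=\frac{(1+\alpha)(1+\beta)C_F^2}{2\alpha\underline{\mu_1}^2}$. Majorant and minorant of the cost functional. $\mathcal{J}^\oplus(\alpha,\beta;\eta,\boldsymbol{\tau},v)=\frac{1+\alpha}2\|\eta-y_d\|^2+\gamma\big(\|\mathcal{R}_2(\eta,\boldsymbol{\tau})\|^2+\frac{C_F^2}\beta\|\mathcal{R}_1(\eta,\boldsymbol{\tau},v)\|^2\big)+\frac\lambda2\|v\|^2$, and $\mathcal{J}^\ominus(\eta,\zeta,\boldsymbol{\tau},\boldsymbol{\rho})=\frac12\|\eta-y_d\|^2+\frac1{2\lambda}\|\zeta\|^2-\int_Q(\nu\nabla\eta\cdot\nabla\zeta+\sigma\partial_t\eta\,\zeta+\lambda^{-1}\zeta^2)\,d\boldsymbol{x}\,dt-\frac{C_F^2}{\underline{\mu_1}^2\lambda}(C_F\|\mathcal{R}_3(\zeta,\boldsymbol{\rho},\eta)\|+\|\mathcal{R}_4(\zeta,\boldsymbol{\rho})\|)^2-\frac1{\underline{\mu_1}}(C_F\|\mathcal{R}_1(\eta,\boldsymbol{\tau},-\lambda^{-1}\zeta)\|+\|\mathcal{R}_2(\eta,\boldsymbol{\tau})\|)(C_F\|\mathcal{R}_3(\zeta,\boldsymbol{\rho},\eta)\|+\|\mathcal{R}_4(\zeta,\boldsymbol{\rho})\|)$.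 *)

theory Defs
  imports "HOL-Analysis.Analysis"
begin

section \<open>Domains, square-integrable functions, weak derivatives\<close>

(* Near every boundary point the domain is, in suitable orthonormal coordinates with last axis n,
   the region below the graph of a Lipschitz function on the hyperplane orthogonal to n.
   In dimension one that hyperplane is {0}. *)
definition lipschitz_domain :: "'a::euclidean_space set \<Rightarrow> bool" where
  "lipschitz_domain \<Omega> \<longleftrightarrow>
     open \<Omega> \<and> connected \<Omega> \<and> \<Omega> \<noteq> {} \<and>
     (\<forall>z\<in>frontier \<Omega>. \<exists>r>0. \<exists>n g L. norm n = 1 \<and> L-lipschitz_on {x. x \<bullet> n = 0} g \<and>
        \<Omega> \<inter> ball z r = {x \<in> ball z r. x \<bullet> n < g (x - (x \<bullet> n) *\<^sub>R n)})"

(* Functions, not classes: elements are only ever used up to null sets. *)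
definition L2 :: "'b::euclidean_space set \<Rightarrow> ('b \<Rightarrow> 'c::euclidean_space) set" where
  "L2 S = {f. f \<in> borel_measurable (lebesgue_on S) \<and>
              integrable (lebesgue_on S) (\<lambda>x. (norm (f x))\<^sup>2)}"

definition L2_norm :: "'b::euclidean_space set \<Rightarrow> ('b \<Rightarrow> 'c::euclidean_space) \<Rightarrow> real" where
  "L2_norm S f = sqrt (LINT x|lebesgue_on S. (norm (f x))\<^sup>2)"

(* phi is C^1 with gradient D and compact support in S. Testing with compactly supported C^1
   functions yields the same weak derivatives and the same space H^1_0 as testing with
   compactly supported smooth functions (mollification). *)
definition test_function ::
  "'b::euclidean_space set \<Rightarrow> ('b \<Rightarrow> real) \<Rightarrow> ('b \<Rightarrow> 'b) \<Rightarrow> bool" where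
  "test_function S \<phi> D \<longleftrightarrow>
     (\<forall>x. GDERIV \<phi> x :> D x) \<and> continuous_on UNIV D \<and>
     compact (closure {x. \<phi> x \<noteq> 0}) \<and> closure {x. \<phi> x \<noteq> 0} \<subseteq> S"

definition has_weak_grad ::
  "'b::euclidean_space set \<Rightarrow> ('b \<Rightarrow> real) \<Rightarrow> ('b \<Rightarrow> 'b) \<Rightarrow> bool" where
  "has_weak_grad S f g \<longleftrightarrow> f \<in> L2 S \<and> g \<in> L2 S \<and>
     (\<forall>\<phi> D. test_function S \<phi> D \<longrightarrow>
        (LINT x|lebesgue_on S. f x *\<^sub>R D x) = - (LINT x|lebesgue_on S. \<phi> x *\<^sub>R g x))"

definition has_weak_div ::
  "'b::euclidean_space set \<Rightarrow> ('b \<Rightarrow> 'b) \<Rightarrow> ('b \<Rightarrow> real) \<Rightarrow> bool" where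
  "has_weak_div S \<tau> h \<longleftrightarrow> \<tau> \<in> L2 S \<and> h \<in> L2 S \<and>
     (\<forall>\<phi> D. test_function S \<phi> D \<longrightarrow>
        (LINT x|lebesgue_on S. \<tau> x \<bullet> D x) = - (LINT x|lebesgue_on S. h x * \<phi> x))"

(* The closure of the test functions in H^1. *)
definition H10 :: "'b::euclidean_space set \<Rightarrow> ('b \<Rightarrow> real) set" where
  "H10 S = {f. \<exists>g. has_weak_grad S f g \<and>
     (\<exists>\<phi> D. (\<forall>n::nat. test_function S (\<phi> n) (D n)) \<and>
        (\<lambda>n. L2_norm S (\<lambda>x. \<phi> n x - f x)) \<longlonglongrightarrow> 0 \<and>
        (\<lambda>n. L2_norm S (\<lambda>x. D n x - g x)) \<longlonglongrightarrow> 0)}"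

definition friedrichs_constant :: "'b::euclidean_space set \<Rightarrow> real \<Rightarrow> bool" where
  "friedrichs_constant S C \<longleftrightarrow> C > 0 \<and>
     (\<forall>w g. w \<in> H10 S \<and> has_weak_grad S w g \<longrightarrow> L2_norm S w \<le> C * L2_norm S g)"

section \<open>The space-time cylinder\<close>

definition cyl :: "'a::euclidean_space set \<Rightarrow> real \<Rightarrow> ('a \<times> real) set" where
  "cyl \<Omega> T = \<Omega> \<times> {0<..<T}"

(* Space derivatives act on w(.,t) for almost every t, the time derivative on w(x,.) for almost
   every x; the resulting functions are required to be square integrable on the cylinder. *)
definition has_space_grad ::
  "'a::euclidean_space set \<Rightarrow> real \<Rightarrow> ('a \<times> real \<Rightarrow> real) \<Rightarrow> ('a \<times> real \<Rightarrow> 'a) \<Rightarrow> bool" where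
  "has_space_grad \<Omega> T w g \<longleftrightarrow> w \<in> L2 (cyl \<Omega> T) \<and> g \<in> L2 (cyl \<Omega> T) \<and>
     (AE t in lebesgue_on {0<..<T}. has_weak_grad \<Omega> (\<lambda>x. w (x, t)) (\<lambda>x. g (x, t)))"

definition has_space_div ::
  "'a::euclidean_space set \<Rightarrow> real \<Rightarrow> ('a \<times> real \<Rightarrow> 'a) \<Rightarrow> ('a \<times> real \<Rightarrow> real) \<Rightarrow> bool" where
  "has_space_div \<Omega> T \<tau> h \<longleftrightarrow> \<tau> \<in> L2 (cyl \<Omega> T) \<and> h \<in> L2 (cyl \<Omega> T) \<and>
     (AE t in lebesgue_on {0<..<T}. has_weak_div \<Omega> (\<lambda>x. \<tau> (x, t)) (\<lambda>x. h (x, t)))"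

definition has_time_deriv ::
  "'a::euclidean_space set \<Rightarrow> real \<Rightarrow> ('a \<times> real \<Rightarrow> real) \<Rightarrow> ('a \<times> real \<Rightarrow> real) \<Rightarrow> bool" where
  "has_time_deriv \<Omega> T w d \<longleftrightarrow> w \<in> L2 (cyl \<Omega> T) \<and> d \<in> L2 (cyl \<Omega> T) \<and>
     (AE x in lebesgue_on \<Omega>. has_weak_grad {0<..<T} (\<lambda>t. w (x, t)) (\<lambda>t. d (x, t)))"

(* These derivatives are unique up to null sets; the choice below is only meaningful for
   functions that possess one. *)
definition grad_x where
  "grad_x \<Omega> T w = (SOME g. has_space_grad \<Omega> T w g)"

definition div_x where
  "div_x \<Omega> T \<tau> = (SOME h. has_space_div \<Omega> T \<tau> h)"

definition dt where
  "dt \<Omega> T w = (SOME d. has_time_deriv \<Omega> T w d)"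

definition zero_on_lateral_boundary ::
  "'a::euclidean_space set \<Rightarrow> real \<Rightarrow> ('a \<times> real \<Rightarrow> real) \<Rightarrow> bool" where
  "zero_on_lateral_boundary \<Omega> T w \<longleftrightarrow>
     (AE t in lebesgue_on {0<..<T}. (\<lambda>x. w (x, t)) \<in> H10 \<Omega>)"

(* w(0) = w(T): the values at the end points are those of the representative of w(x,.) that is
   continuous on the closed interval. *)
definition time_periodic ::
  "'a::euclidean_space set \<Rightarrow> real \<Rightarrow> ('a \<times> real \<Rightarrow> real) \<Rightarrow> bool" where
  "time_periodic \<Omega> T w \<longleftrightarrow>
     (AE x in lebesgue_on \<Omega>. \<exists>f. continuous_on {0..T} f \<and>
        (AE t in lebesgue_on {0<..<T}. w (x, t) = f t) \<and> f 0 = f T)"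

section \<open>Fourier coefficients in time and the half derivative\<close>

definition freq :: "real \<Rightarrow> real" where
  "freq T = 2 * pi / T"

(* The pair (w_k^c, w_k^s). The normalisation 2/T is the one for k >= 1; the coefficient with
   k = 0 is never used, since below it is multiplied by k. *)
definition fourier_coeff ::
  "real \<Rightarrow> ('a::euclidean_space \<times> real \<Rightarrow> real) \<Rightarrow> nat \<Rightarrow> 'a \<Rightarrow> real \<times> real" where
  "fourier_coeff T w k x =
     (2 / T * (LINT t|lebesgue_on {0<..<T}. w (x, t) * cos (real k * freq T * t)),
      2 / T * (LINT t|lebesgue_on {0<..<T}. w (x, t) * sin (real k * freq T * t)))"

(* The coefficients of w^perp; w^perp enters only through them. *)
definition fourier_coeff_perp ::
  "real \<Rightarrow> ('a::euclidean_space \<times> real \<Rightarrow> real) \<Rightarrow> nat \<Rightarrow> 'a \<Rightarrow> real \<times> real" where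
  "fourier_coeff_perp T w k x =
     (- snd (fourier_coeff T w k x), fst (fourier_coeff T w k x))"

(* The integral of sigma times the half derivatives of the functions with coefficients W and Z. *)
definition half_form ::
  "'a::euclidean_space set \<Rightarrow> real \<Rightarrow> ('a \<Rightarrow> real) \<Rightarrow>
   (nat \<Rightarrow> 'a \<Rightarrow> real \<times> real) \<Rightarrow> (nat \<Rightarrow> 'a \<Rightarrow> real \<times> real) \<Rightarrow> real" where
  "half_form \<Omega> T \<sigma> W Z =
     T / 2 * (\<Sum>k. real k * freq T * (LINT x|lebesgue_on \<Omega>. (\<sigma> x *\<^sub>R W k x) \<bullet> Z k x))"

definition half_deriv_finite ::
  "'a::euclidean_space set \<Rightarrow> real \<Rightarrow> ('a \<times> real \<Rightarrow> real) \<Rightarrow> bool" where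
  "half_deriv_finite \<Omega> T w \<longleftrightarrow>
     summable (\<lambda>k. real k * freq T * (L2_norm \<Omega> (fourier_coeff T w k))\<^sup>2)"

section \<open>Function spaces on the cylinder\<close>

definition H_1_half :: "'a::euclidean_space set \<Rightarrow> real \<Rightarrow> ('a \<times> real \<Rightarrow> real) set" where
  "H_1_half \<Omega> T = {w. w \<in> L2 (cyl \<Omega> T) \<and> (\<exists>g. has_space_grad \<Omega> T w g) \<and>
     half_deriv_finite \<Omega> T w \<and> zero_on_lateral_boundary \<Omega> T w}"

definition H_1_1 :: "'a::euclidean_space set \<Rightarrow> real \<Rightarrow> ('a \<times> real \<Rightarrow> real) set" where
  "H_1_1 \<Omega> T = {w. w \<in> L2 (cyl \<Omega> T) \<and> (\<exists>g. has_space_grad \<Omega> T w g) \<and>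
     (\<exists>d. has_time_deriv \<Omega> T w d) \<and> zero_on_lateral_boundary \<Omega> T w \<and> time_periodic \<Omega> T w}"

definition H_div :: "'a::euclidean_space set \<Rightarrow> real \<Rightarrow> ('a \<times> real \<Rightarrow> 'a) set" where
  "H_div \<Omega> T = {\<tau>. \<tau> \<in> L2 (cyl \<Omega> T) \<and> (\<exists>h. has_space_div \<Omega> T \<tau> h)}"

abbreviation normQ ::
  "'a::euclidean_space set \<Rightarrow> real \<Rightarrow> ('a \<times> real \<Rightarrow> 'c::euclidean_space) \<Rightarrow> real" where
  "normQ \<Omega> T f \<equiv> L2_norm (cyl \<Omega> T) f"

section \<open>State equation and optimal control\<close>

definition is_state where
  "is_state \<Omega> T \<sigma> \<nu> v y \<longleftrightarrow> y \<in> H_1_half \<Omega> T \<and>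
     (\<forall>q\<in>H_1_half \<Omega> T.
        (LINT z|lebesgue_on (cyl \<Omega> T). \<nu> (fst z) * (grad_x \<Omega> T y z \<bullet> grad_x \<Omega> T q z))
        + half_form \<Omega> T \<sigma> (fourier_coeff T y) (fourier_coeff_perp T q)
        = (LINT z|lebesgue_on (cyl \<Omega> T). v z * q z))"

definition cost where
  "cost \<Omega> T lam y\<^sub>d y v =
     1/2 * (normQ \<Omega> T (\<lambda>z. y z - y\<^sub>d z))\<^sup>2 + lam/2 * (normQ \<Omega> T v)\<^sup>2"

definition optimal_control where
  "optimal_control \<Omega> T \<sigma> \<nu> lam y\<^sub>d u \<longleftrightarrow> u \<in> L2 (cyl \<Omega> T) \<and>
     (\<exists>y. is_state \<Omega> T \<sigma> \<nu> u y \<and>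
        (\<forall>v\<in>L2 (cyl \<Omega> T). \<forall>y'. is_state \<Omega> T \<sigma> \<nu> v y' \<longrightarrow>
           cost \<Omega> T lam y\<^sub>d y u \<le> cost \<Omega> T lam y\<^sub>d y' v))"

(* |||u - v|||^2, where y and y' are the states belonging to u and v. *)
definition error_sq where
  "error_sq \<Omega> T lam y y' u v =
     1/2 * (normQ \<Omega> T (\<lambda>z. y z - y' z))\<^sup>2
     + lam/2 * (normQ \<Omega> T (\<lambda>z. u z - v z))\<^sup>2"

section \<open>Residuals, majorants and minorant\<close>

definition R1 where
  "R1 \<Omega> T \<sigma> \<eta> \<tau> v z = \<sigma> (fst z) * dt \<Omega> T \<eta> z - div_x \<Omega> T \<tau> z - v z"

definition R2 where
  "R2 \<Omega> T \<nu> \<eta> \<tau> z = \<tau> z - \<nu> (fst z) *\<^sub>R grad_x \<Omega> T \<eta> z"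

definition R3 where
  "R3 \<Omega> T \<sigma> y\<^sub>d \<zeta> \<rho> \<eta> z = \<eta> z - y\<^sub>d z + div_x \<Omega> T \<rho> z + \<sigma> (fst z) * dt \<Omega> T \<zeta> z"

definition R4 where
  "R4 \<Omega> T \<nu> \<zeta> \<rho> z = \<rho> z - \<nu> (fst z) *\<^sub>R grad_x \<Omega> T \<zeta> z"

definition mu1 :: "real \<Rightarrow> real \<Rightarrow> real" where
  "mu1 \<nu>\<^sub>l \<sigma>\<^sub>l = 1 / sqrt 2 * min \<nu>\<^sub>l \<sigma>\<^sub>l"

definition gamma_const :: "real \<Rightarrow> real \<Rightarrow> real \<Rightarrow> real \<Rightarrow> real" where
  "gamma_const \<alpha> \<beta> C\<^sub>F \<mu> = (1 + \<alpha>) * (1 + \<beta>) * C\<^sub>F\<^sup>2 / (2 * \<alpha> * \<mu>\<^sup>2)"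

definition J_plus where
  "J_plus \<Omega> T \<sigma> \<nu> lam y\<^sub>d C\<^sub>F \<mu> \<alpha> \<beta> \<eta> \<tau> v =
     ((1 + \<alpha>) / 2 * (normQ \<Omega> T (\<lambda>z. \<eta> z - y\<^sub>d z))\<^sup>2
      + gamma_const \<alpha> \<beta> C\<^sub>F \<mu> *
          ((normQ \<Omega> T (R2 \<Omega> T \<nu> \<eta> \<tau>))\<^sup>2 + C\<^sub>F\<^sup>2 / \<beta> * (normQ \<Omega> T (R1 \<Omega> T \<sigma> \<eta> \<tau> v))\<^sup>2)
      + lam / 2 * (normQ \<Omega> T v)\<^sup>2)"

definition mixed_integral where
  "mixed_integral \<Omega> T \<sigma> \<nu> lam \<eta> \<zeta> =
     (LINT z|lebesgue_on (cyl \<Omega> T).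
        \<nu> (fst z) * (grad_x \<Omega> T \<eta> z \<bullet> grad_x \<Omega> T \<zeta> z)
        + \<sigma> (fst z) * dt \<Omega> T \<eta> z * \<zeta> z + 1 / lam * (\<zeta> z)\<^sup>2)"

definition J_minus where
  "J_minus \<Omega> T \<sigma> \<nu> lam y\<^sub>d C\<^sub>F \<mu> \<eta> \<zeta> \<tau> \<rho> =
     (let a = C\<^sub>F * normQ \<Omega> T (R1 \<Omega> T \<sigma> \<eta> \<tau> (\<lambda>z. - (1 / lam) * \<zeta> z)) + normQ \<Omega> T (R2 \<Omega> T \<nu> \<eta> \<tau>);
          b = C\<^sub>F * normQ \<Omega> T (R3 \<Omega> T \<sigma> y\<^sub>d \<zeta> \<rho> \<eta>) + normQ \<Omega> T (R4 \<Omega> T \<nu> \<zeta> \<rho>) in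
      1/2 * (normQ \<Omega> T (\<lambda>z. \<eta> z - y\<^sub>d z))\<^sup>2 + 1 / (2 * lam) * (normQ \<Omega> T \<zeta>)\<^sup>2
      - mixed_integral \<Omega> T \<sigma> \<nu> lam \<eta> \<zeta>
      - C\<^sub>F\<^sup>2 / (\<mu>\<^sup>2 * lam) * b\<^sup>2 - 1 / \<mu> * a * b)"

definition M_plus where
  "M_plus \<Omega> T \<sigma> \<nu> lam y\<^sub>d C\<^sub>F \<mu> \<alpha> \<beta> \<eta> \<zeta> \<tau> \<rho> v =
     (let a = C\<^sub>F * normQ \<Omega> T (R1 \<Omega> T \<sigma> \<eta> \<tau> (\<lambda>z. - (1 / lam) * \<zeta> z)) + normQ \<Omega> T (R2 \<Omega> T \<nu> \<eta> \<tau>);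
          b = C\<^sub>F * normQ \<Omega> T (R3 \<Omega> T \<sigma> y\<^sub>d \<zeta> \<rho> \<eta>) + normQ \<Omega> T (R4 \<Omega> T \<nu> \<zeta> \<rho>) in
      \<alpha> / 2 * (normQ \<Omega> T (\<lambda>z. \<eta> z - y\<^sub>d z))\<^sup>2
      + gamma_const \<alpha> \<beta> C\<^sub>F \<mu> *
          ((normQ \<Omega> T (R2 \<Omega> T \<nu> \<eta> \<tau>))\<^sup>2 + C\<^sub>F\<^sup>2 / \<beta> * (normQ \<Omega> T (R1 \<Omega> T \<sigma> \<eta> \<tau> v))\<^sup>2)
      + lam / 2 * (normQ \<Omega> T v)\<^sup>2 - 1 / (2 * lam) * (normQ \<Omega> T \<zeta>)\<^sup>2
      + mixed_integral \<Omega> T \<sigma> \<nu> lam \<eta> \<zeta>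
      + C\<^sub>F\<^sup>2 / (\<mu>\<^sup>2 * lam) * b\<^sup>2 + 1 / \<mu> * a * b)"

end

theory Submission
  imports Defs
begin

text \<open>
  The majorant is the difference of an upper bound \<open>J\<^sup>\<oplus>\<close> for the cost of \<open>v\<close> and a lower bound
  \<open>J\<^sup>\<ominus>\<close> for the cost of \<open>u\<close>, so the estimate is the chain
  \<open>|||u - v|||\<^sup>2 \<le> J(y\<^sub>v, v) - J(y\<^sub>u, u) \<le> J\<^sup>\<oplus> - J\<^sup>\<ominus>\<close>, whose three links are
  \<open>error_le_cost_difference\<close>, \<open>cost_le_J_plus\<close> and \<open>J_minus_le_cost\<close>.

  First link. States depend linearly on controls, so the cost is a quadratic polynomial along the
  segment from \<open>(y\<^sub>u, u)\<close> to \<open>(y\<^sub>v, v)\<close>. Its linear coefficient is nonnegative because \<open>u\<close> is optimal,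
  and its quadratic coefficient is \<open>|||u - v|||\<^sup>2\<close>.

  Second link. The error \<open>e = y\<^sub>v - \<eta>\<close> is an admissible test function for its own equation. The half
  form vanishes on the diagonal, so coercivity of the diffusion part bounds \<open>\<nu>\<^sub>l \<parallel>\<nabla>e\<parallel>\<close> by the
  residuals, \<open>C\<^sub>F \<parallel>R\<^sub>1\<parallel> + \<parallel>R\<^sub>2\<parallel>\<close> (\<open>state_error_bound\<close>); as \<open>\<mu>\<^sub>1 \<le> \<nu>\<^sub>l\<close>, the same holds with \<open>\<mu>\<^sub>1\<close>.
  The Friedrichs inequality and two weighted binomial inequalities do the rest.

  Third link. This bound holds at every control: expanding both squares of the cost around
  \<open>(\<eta>, - \<zeta> / \<lambda>)\<close> produces the first three terms of \<open>J\<^sup>\<ominus>\<close>, the adjoint residual tested with \<open>y\<^sub>u - \<eta>\<close>,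
  and two squares that are left over. The gradient of \<open>y\<^sub>u - \<eta>\<close> is bounded by the residuals at the
  control \<open>- \<zeta> / \<lambda>\<close>, which gives the product term of \<open>J\<^sup>\<ominus>\<close>, plus a multiple of \<open>\<parallel>u + \<zeta> / \<lambda>\<parallel>\<close>. The
  square of the latter norm is one of the two that are left over and absorbs it; Young's inequality
  leaves the quadratic term of \<open>J\<^sup>\<ominus>\<close>.

  What has to be supplied is the analysis that turns these formal computations into proofs.
  Gradients on the cylinder are chosen from a class modulo null sets, so their linearity rests on the
  uniqueness of weak derivatives, hence on the density of test functions in \<open>L\<^sup>2\<close>
  (\<open>test_functions_dense\<close>). The half form is a series of Fourier coefficients; that it equals
  \<open>\<integral> \<sigma> \<partial>\<^sub>t\<eta> q\<close> for periodic \<open>\<eta>\<close> with a time derivative (\<open>half_form_time_deriv\<close>) is Parseval's identity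
  in time, hence completeness of the trigonometric system (\<open>trig_complete\<close>), together with
  integration by parts over a full period (\<open>periodic_integration_by_parts\<close>).
\<close>

section \<open>Square-integrable functions\<close>

lemma L2_measurable: "f \<in> L2 S \<Longrightarrow> f \<in> borel_measurable (lebesgue_on S)"
  by (simp add: L2_def)

lemma L2_integrable_sq: "f \<in> L2 S \<Longrightarrow> integrable (lebesgue_on S) (\<lambda>x. (norm (f x))\<^sup>2)"
  by (simp add: L2_def)

lemma L2_integrable_inner:
  assumes f: "f \<in> L2 S" and g: "g \<in> L2 S"
  shows "integrable (lebesgue_on S) (\<lambda>x. f x \<bullet> g x)"
proof (rule Bochner_Integration.integrable_bound)
  show "integrable (lebesgue_on S) (\<lambda>x. (norm (f x))\<^sup>2 + (norm (g x))\<^sup>2)"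
    using L2_integrable_sq[OF f] L2_integrable_sq[OF g] by simp
  show "(\<lambda>x. f x \<bullet> g x) \<in> borel_measurable (lebesgue_on S)"
    using L2_measurable[OF f] L2_measurable[OF g] by simp
  have "\<bar>a \<bullet> b\<bar> \<le> (norm a)\<^sup>2 + (norm b)\<^sup>2" for a b :: 'b
  proof -
    have "2 * (norm a * norm b) \<le> (norm a)\<^sup>2 + (norm b)\<^sup>2"
      using sum_squares_bound[of "norm a" "norm b"] by simp
    moreover have "\<bar>a \<bullet> b\<bar> \<le> norm a * norm b" by (rule Cauchy_Schwarz_ineq2)
    ultimately show ?thesis using mult_nonneg_nonneg[of "norm a" "norm b"] by simp
  qed
  then show "AE x in lebesgue_on S. norm (f x \<bullet> g x) \<le> norm ((norm (f x))\<^sup>2 + (norm (g x))\<^sup>2)"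
    by (simp add: sum_power2_ge_zero)
qed

lemma L2_integrable_mult:
  fixes f g :: "'b::euclidean_space \<Rightarrow> real"
  shows "f \<in> L2 S \<Longrightarrow> g \<in> L2 S \<Longrightarrow> integrable (lebesgue_on S) (\<lambda>x. f x * g x)"
  using L2_integrable_inner[of f S g] by simp

lemma L2_add:
  assumes f: "f \<in> L2 S" and g: "g \<in> L2 S"
  shows "(\<lambda>x. f x + g x) \<in> L2 S"
proof -
  have "integrable (lebesgue_on S) (\<lambda>x. (norm (f x))\<^sup>2 + (norm (g x))\<^sup>2 + 2 * (f x \<bullet> g x))"
    using L2_integrable_sq[OF f] L2_integrable_sq[OF g] L2_integrable_inner[OF f g] by simp
  moreover have "(norm (f x + g x))\<^sup>2 = (norm (f x))\<^sup>2 + (norm (g x))\<^sup>2 + 2 * (f x \<bullet> g x)" for x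
    by (simp add: power2_norm_eq_inner inner_add_left inner_add_right inner_commute)
  ultimately have "integrable (lebesgue_on S) (\<lambda>x. (norm (f x + g x))\<^sup>2)" by simp
  then show ?thesis
    using borel_measurable_add[OF L2_measurable[OF f] L2_measurable[OF g]] by (simp add: L2_def)
qed

lemma L2_bounded_scaleR:
  assumes f: "f \<in> L2 S" and m: "m \<in> borel_measurable (lebesgue_on S)"
    and S: "S \<in> sets lebesgue" and b: "\<And>x. x \<in> S \<Longrightarrow> \<bar>m x\<bar> \<le> c"
  shows "(\<lambda>x. m x *\<^sub>R f x) \<in> L2 S"
proof -
  have "integrable (lebesgue_on S) (\<lambda>x. (norm (m x *\<^sub>R f x))\<^sup>2)"
  proof (rule Bochner_Integration.integrable_bound)
    show "integrable (lebesgue_on S) (\<lambda>x. c\<^sup>2 * (norm (f x))\<^sup>2)"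
      using L2_integrable_sq[OF f] by simp
    show "(\<lambda>x. (norm (m x *\<^sub>R f x))\<^sup>2) \<in> borel_measurable (lebesgue_on S)"
      using L2_measurable[OF f] m by simp
    have "(m x)\<^sup>2 \<le> c\<^sup>2" if "x \<in> S" for x
      using power_mono[OF b[OF that], of 2] by simp
    then show "AE x in lebesgue_on S. norm ((norm (m x *\<^sub>R f x))\<^sup>2) \<le> norm (c\<^sup>2 * (norm (f x))\<^sup>2)"
      by (auto intro!: AE_I2 simp: power_mult_distrib mult_right_mono)
  qed
  then show ?thesis using L2_measurable[OF f] m by (simp add: L2_def)
qed

lemma L2_scaleR: "f \<in> L2 S \<Longrightarrow> (\<lambda>x. c *\<^sub>R f x) \<in> L2 S"
  by (auto simp: L2_def power_mult_distrib)

lemma L2_mult_left: "(f :: _ \<Rightarrow> real) \<in> L2 S \<Longrightarrow> (\<lambda>x. c * f x) \<in> L2 S"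
  using L2_scaleR[of f S c] by simp

lemma L2_uminus: "f \<in> L2 S \<Longrightarrow> (\<lambda>x. - f x) \<in> L2 S"
  by (auto simp: L2_def)

lemma L2_diff: "f \<in> L2 S \<Longrightarrow> g \<in> L2 S \<Longrightarrow> (\<lambda>x. f x - g x) \<in> L2 S"
  using L2_add[of f S "\<lambda>x. - g x"] by (simp add: L2_uminus)

lemma L2_sum: "finite A \<Longrightarrow> (\<And>i. i \<in> A \<Longrightarrow> f i \<in> L2 S) \<Longrightarrow> (\<lambda>x. \<Sum>i\<in>A. f i x) \<in> L2 S"
proof (induction A rule: finite_induct)
  case empty
  show ?case by (simp add: L2_def)
next
  case (insert a A)
  then show ?case using L2_add[of "f a" S "\<lambda>x. \<Sum>i\<in>A. f i x"] by simp
qed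

lemma L2_bounded:
  assumes "f \<in> borel_measurable (lebesgue_on S)" "S \<in> lmeasurable" "\<And>x. x \<in> S \<Longrightarrow> norm (f x) \<le> c"
  shows "f \<in> L2 S"
proof -
  have fin: "finite_measure (lebesgue_on S)"
    using assms(2) by (rule finite_measure_lebesgue_on)
  have "integrable (lebesgue_on S) (\<lambda>x. (norm (f x))\<^sup>2)"
    by (rule finite_measure.integrable_const_bound[OF fin, of _ "c\<^sup>2"])
       (use assms in \<open>auto intro!: AE_I2 power_mono simp: space_restrict_space\<close>)
  then show ?thesis using assms by (simp add: L2_def)
qed

lemma L2_integrable:
  assumes f: "f \<in> L2 S" and S: "S \<in> lmeasurable"
  shows "integrable (lebesgue_on S) f"
proof (rule Bochner_Integration.integrable_bound)
  show "integrable (lebesgue_on S) (\<lambda>x. 1 + (norm (f x))\<^sup>2)"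
    by (rule Bochner_Integration.integrable_add[OF 
          finite_measure.integrable_const[OF finite_measure_lebesgue_on[OF S]] L2_integrable_sq[OF f]])
  have "a \<le> 1 + a\<^sup>2" for a :: real
    using sum_squares_bound[of a 1] by (smt (verit) power2_eq_square zero_le_square one_power2)
  then show "AE x in lebesgue_on S. norm (f x) \<le> norm (1 + (norm (f x))\<^sup>2)"
    by (simp add: sum_power2_ge_zero)
qed (rule L2_measurable[OF f])

lemma L2_norm_sq: "(L2_norm S f)\<^sup>2 = (LINT x|lebesgue_on S. (norm (f x))\<^sup>2)"
  by (simp add: L2_norm_def)

lemma L2_norm_nonneg: "0 \<le> L2_norm S f"
  by (simp add: L2_norm_def)

lemma L2_norm_cong_AE:
  assumes "AE x in lebesgue_on S. f x = g x" "f \<in> L2 S" "g \<in> L2 S"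
  shows "L2_norm S f = L2_norm S g"
  unfolding L2_norm_def using assms
  by (intro arg_cong[where f=sqrt] integral_cong_AE) (auto dest: L2_measurable)

text \<open>The discriminant of the nonnegative polynomial \<open>s \<mapsto> \<parallel>f + s g\<parallel>\<^sup>2\<close> is not positive.\<close>

lemma L2_Cauchy_Schwarz:
  assumes f: "f \<in> L2 S" and g: "g \<in> L2 S"
  shows "\<bar>LINT x|lebesgue_on S. f x \<bullet> g x\<bar> \<le> L2_norm S f * L2_norm S g"
proof -
  let ?a = "LINT x|lebesgue_on S. (norm (f x))\<^sup>2" and ?b = "LINT x|lebesgue_on S. f x \<bullet> g x"
  let ?c = "LINT x|lebesgue_on S. (norm (g x))\<^sup>2"
  note int = L2_integrable_sq[OF f] L2_integrable_sq[OF g] L2_integrable_inner[OF f g]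
  have pos: "0 \<le> ?a + 2 * s * ?b + s\<^sup>2 * ?c" for s
  proof -
    have "0 \<le> (LINT x|lebesgue_on S. (norm (f x + s *\<^sub>R g x))\<^sup>2)"
      by (rule Bochner_Integration.integral_nonneg) simp
    also have "\<dots> = (LINT x|lebesgue_on S. (norm (f x))\<^sup>2 + 2 * s * (f x \<bullet> g x) + s\<^sup>2 * (norm (g x))\<^sup>2)"
      by (intro Bochner_Integration.integral_cong refl)
         (simp add: power2_norm_eq_inner inner_add_left inner_add_right inner_commute
            power2_eq_square[of s])
    also have "\<dots> = ?a + 2 * s * ?b + s\<^sup>2 * ?c"
      using int by simp
    finally show ?thesis .
  qed
  have "?b\<^sup>2 \<le> ?a * ?c"
  proof (cases "?c = 0")
    case True
    have "?b = 0"
    proof (rule ccontr)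
      assume "?b \<noteq> 0"
      then show False using pos[of "- (?a + 1) / (2 * ?b)"] True by (simp add: field_simps)
    qed
    then show ?thesis using True by simp
  next
    case False
    have "0 \<le> ?c" by (rule Bochner_Integration.integral_nonneg) simp
    with False have c: "?c > 0" by (simp only: order.strict_iff_order) simp
    show ?thesis using pos[of "- ?b / ?c"] c by (simp add: field_simps power2_eq_square)
  qed
  then have "sqrt (?b\<^sup>2) \<le> sqrt (?a * ?c)" by (rule real_sqrt_le_mono)
  then show ?thesis by (simp add: L2_norm_def real_sqrt_mult)
qed

lemma L2_Cauchy_Schwarz_mult:
  fixes f g :: "'b::euclidean_space \<Rightarrow> real"
  shows "f \<in> L2 S \<Longrightarrow> g \<in> L2 S \<Longrightarrow>
    \<bar>LINT x|lebesgue_on S. f x * g x\<bar> \<le> L2_norm S f * L2_norm S g"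
  using L2_Cauchy_Schwarz[of f S g] by simp

lemma L2_norm_add_sq:
  assumes f: "f \<in> L2 S" and g: "g \<in> L2 S"
  shows "(L2_norm S (\<lambda>x. f x + g x))\<^sup>2
    = (L2_norm S f)\<^sup>2 + 2 * (LINT x|lebesgue_on S. f x \<bullet> g x) + (L2_norm S g)\<^sup>2"
proof -
  have "(LINT x|lebesgue_on S. (norm (f x + g x))\<^sup>2)
      = (LINT x|lebesgue_on S. (norm (f x))\<^sup>2 + 2 * (f x \<bullet> g x) + (norm (g x))\<^sup>2)"
    by (intro Bochner_Integration.integral_cong refl)
       (simp add: power2_norm_eq_inner inner_add_left inner_add_right inner_commute)
  then show ?thesis
    using L2_integrable_sq[OF f] L2_integrable_sq[OF g] L2_integrable_inner[OF f g]
    by (simp add: L2_norm_sq)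
qed

lemma L2_norm_scaleR: "L2_norm S (\<lambda>x. c *\<^sub>R f x) = \<bar>c\<bar> * L2_norm S f"
  by (simp add: L2_norm_def power_mult_distrib real_sqrt_mult)

lemma L2_norm_mult_left: "L2_norm S (\<lambda>x. c * f x :: real) = \<bar>c\<bar> * L2_norm S f"
  using L2_norm_scaleR[of S c f] by simp

lemma L2_norm_uminus: "L2_norm S (\<lambda>x. - f x) = L2_norm S f"
  by (simp add: L2_norm_def)

lemma L2_norm_triangle:
  assumes f: "f \<in> L2 S" and g: "g \<in> L2 S"
  shows "L2_norm S (\<lambda>x. f x + g x) \<le> L2_norm S f + L2_norm S g"
proof (rule power2_le_imp_le)
  show "(L2_norm S (\<lambda>x. f x + g x))\<^sup>2 \<le> (L2_norm S f + L2_norm S g)\<^sup>2"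
    using L2_Cauchy_Schwarz[OF f g] by (simp add: L2_norm_add_sq[OF f g] power2_sum)
qed (simp add: L2_norm_nonneg)

lemma L2_norm_triangle_diff:
  assumes f: "f \<in> L2 S" and g: "g \<in> L2 S"
  shows "L2_norm S (\<lambda>x. f x - g x) \<le> L2_norm S f + L2_norm S g"
  using L2_norm_triangle[OF f L2_uminus[OF g]] by (simp add: L2_norm_uminus)

lemma L2_norm_eq_0_AE:
  assumes f: "f \<in> L2 S" and "L2_norm S f = 0"
  shows "AE x in lebesgue_on S. f x = 0"
proof -
  have "(LINT x|lebesgue_on S. (norm (f x))\<^sup>2) = 0" using assms(2) by (simp add: L2_norm_def)
  then have "AE x in lebesgue_on S. (norm (f x))\<^sup>2 = 0"
    using integral_nonneg_eq_0_iff_AE[OF L2_integrable_sq[OF f]] by simp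
  then show ?thesis by simp
qed

section \<open>Fubini's theorem for Lebesgue measurable functions\<close>

text \<open>Lebesgue measure on a product is the completion of the product measure, so sections of a
  Lebesgue measurable function are measurable only almost everywhere.  Replacing the function by
  a Borel one off a null set reduces everything to the product of the Borel measures.\<close>

lemma AE_lebesgue_pair:
  fixes P :: "'a::euclidean_space \<times> 'b::euclidean_space \<Rightarrow> bool"
  assumes "AE z in lebesgue. P z"
  shows "AE x in lebesgue. AE y in lebesgue. P (x, y)"
    and "AE y in lebesgue. AE x in lebesgue. P (x, y)"
proof -
  have "AE z in lborel. P z" using assms by (simp add: AE_completion_iff)
  then have P: "AE z in lborel \<Otimes>\<^sub>M lborel. P z" unfolding lborel_prod .
  show "AE x in lebesgue. AE y in lebesgue. P (x, y)"
    using lborel_pair.AE_pair[OF P] by (simp add: AE_completion_iff)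
  have "AE z in distr (lborel \<Otimes>\<^sub>M lborel) (lborel \<Otimes>\<^sub>M lborel) (\<lambda>(x, y). (y, x)). P z"
    using P lborel_pair.distr_pair_swap by metis
  then have "AE z in lborel \<Otimes>\<^sub>M lborel. P (case z of (y, x) \<Rightarrow> (x, y))"
    by (rule AE_distrD[rotated]) (rule measurable_pair_swap')
  from lborel_pair.AE_pair[OF this]
  show "AE y in lebesgue. AE x in lebesgue. P (x, y)" by (simp add: AE_completion_iff)
qed

lemma Fubini_lebesgue_UNIV:
  fixes f :: "'a::euclidean_space \<times> 'b::euclidean_space \<Rightarrow> real"
  assumes f: "integrable lebesgue f"
  shows "AE x in lebesgue. integrable lebesgue (\<lambda>y. f (x, y))"
    and "integrable lebesgue (\<lambda>x. LINT y|lebesgue. f (x, y))"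
    and "(LINT x|lebesgue. LINT y|lebesgue. f (x, y)) = integral\<^sup>L lebesgue f"
proof -
  obtain g where g: "g \<in> borel_measurable lborel" and fg: "AE z in lborel. f z = g z"
    using completion_ex_borel_measurable_real[of f lborel] f by auto
  have fg': "AE z in lebesgue. f z = g z" using fg by (rule AE_completion)
  have gl: "integrable lebesgue g" 
    using integrable_cong_AE[of f lebesgue g] f fg' measurable_completion[OF g] by auto
  then have "integrable lborel g" using g by (simp add: integrable_completion)
  then have gi: "integrable (lborel \<Otimes>\<^sub>M lborel) g" by (simp add: lborel_prod)
  have sec: "AE x in lebesgue. integrable lebesgue (\<lambda>y. f (x, y)) \<and>
     (LINT y|lebesgue. f (x, y)) = (LINT y|lborel. g (x, y))"
  proof -
    have a1: "AE x in lebesgue. integrable lborel (\<lambda>y. g (x, y))"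
      using lborel_pair.AE_integrable_fst'[OF gi] by (rule AE_completion)
    from a1 AE_lebesgue_pair(1)[OF fg'] show ?thesis
    proof eventually_elim
      case (elim x)
      have gx: "(\<lambda>y. g (x, y)) \<in> borel_measurable lborel"
        using elim(1) by (rule borel_measurable_integrable)
      have gx': "(\<lambda>y. g (x, y)) \<in> borel_measurable lebesgue"
        using gx by (rule measurable_completion)
      have fx: "(\<lambda>y. f (x, y)) \<in> borel_measurable lebesgue"
        by (rule borel_measurable_AE[OF gx']) (use elim(2) in auto)
      have "integrable lebesgue (\<lambda>y. g (x, y))"
        using elim(1) gx by (simp add: integrable_completion)
      moreover have "(LINT y|lebesgue. f (x, y)) = (LINT y|lebesgue. g (x, y))"
        by (rule integral_cong_AE[OF fx gx' elim(2)])
      ultimately show ?case 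
        using integrable_cong_AE[OF fx gx' elim(2)] integral_completion[OF gx] by simp
    qed
  qed
  then show "AE x in lebesgue. integrable lebesgue (\<lambda>y. f (x, y))" by auto
  have gf: "integrable lborel (\<lambda>x. LINT y|lborel. g (x, y))"
    by (rule lborel_pair.integrable_fst'[OF gi])
  have gfm: "(\<lambda>x. LINT y|lborel. g (x, y)) \<in> borel_measurable lborel"
    using gf by (rule borel_measurable_integrable)
  have gfm': "(\<lambda>x. LINT y|lborel. g (x, y)) \<in> borel_measurable lebesgue"
    using gfm by (rule measurable_completion)
  have fm: "(\<lambda>x. LINT y|lebesgue. f (x, y)) \<in> borel_measurable lebesgue"
    by (rule borel_measurable_AE[OF gfm']) (use sec in auto)
  have eq: "AE x in lebesgue. (LINT y|lebesgue. f (x, y)) = (LINT y|lborel. g (x, y))"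
    using sec by auto
  show "integrable lebesgue (\<lambda>x. LINT y|lebesgue. f (x, y))"
    using integrable_cong_AE[OF fm gfm' eq] gf gfm by (simp add: integrable_completion)
  have "(LINT x|lebesgue. LINT y|lebesgue. f (x, y)) = (LINT x|lebesgue. LINT y|lborel. g (x, y))"
    by (rule integral_cong_AE[OF fm gfm' eq])
  also have "\<dots> = (LINT x|lborel. LINT y|lborel. g (x, y))"
    by (rule integral_completion[OF gfm])
  also have "\<dots> = integral\<^sup>L (lborel \<Otimes>\<^sub>M lborel) g"
    by (rule lborel_pair.integral_fst'[OF gi])
  also have "\<dots> = integral\<^sup>L lborel g" by (simp add: lborel_prod)
  also have "\<dots> = integral\<^sup>L lebesgue g" using integral_completion[OF g] by simp
  also have "\<dots> = integral\<^sup>L lebesgue f"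
    using f gl fg' by (intro integral_cong_AE) auto
  finally show "(LINT x|lebesgue. LINT y|lebesgue. f (x, y)) = integral\<^sup>L lebesgue f" .
qed

text \<open>Exchanging the factors turns each statement about sections into the one for the other variable.\<close>

lemma lebesgue_swap:
  fixes f :: "'a::euclidean_space \<times> 'b::euclidean_space \<Rightarrow> real"
  assumes f: "integrable lebesgue f"
  shows "integrable lebesgue (\<lambda>z. f (snd z, fst z))"
    and "(LINT z|lebesgue. f (snd z, fst z)) = integral\<^sup>L lebesgue f"
proof -
  obtain g where g: "g \<in> borel_measurable lborel" and fg: "AE z in lborel. f z = g z"
    using completion_ex_borel_measurable_real[of f lborel] f by auto
  have fg': "AE z in lebesgue. f z = g z" using fg by (rule AE_completion)
  have gl: "integrable lebesgue g" 
    using integrable_cong_AE[of f lebesgue g] f fg' measurable_completion[OF g] by auto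
  then have gb: "integrable lborel g" using g by (simp add: integrable_completion)
  then have gi: "integrable (lborel \<Otimes>\<^sub>M lborel) g" by (simp add: lborel_prod)
  have swap_eq: "(\<lambda>(x, y). g (y, x)) = (\<lambda>z. g (snd z, fst z))" by auto
  have si: "integrable lborel (\<lambda>z. g (snd z, fst z))"
    using lborel_pair.integrable_product_swap[OF gi] by (simp add: lborel_prod swap_eq)
  then have sm: "(\<lambda>z. g (snd z, fst z)) \<in> borel_measurable lborel" by auto
  then have sm': "(\<lambda>z. g (snd z, fst z)) \<in> borel_measurable lebesgue" by (rule measurable_completion)
  have sl: "(LINT z|lborel. g (snd z, fst z)) = integral\<^sup>L lborel g"
    using lborel_pair.integral_product_swap[of g] gi by (simp add: lborel_prod swap_eq)
  have "AE z in lborel \<Otimes>\<^sub>M lborel. f z = g z" using fg unfolding lborel_prod .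
  then have "AE z in distr (lborel \<Otimes>\<^sub>M lborel) (lborel \<Otimes>\<^sub>M lborel) (\<lambda>(x, y). (y, x)). f z = g z"
    using lborel_pair.distr_pair_swap by metis
  then have "AE z in lborel \<Otimes>\<^sub>M lborel. f (case z of (y, x) \<Rightarrow> (x, y)) = g (case z of (y, x) \<Rightarrow> (x, y))"
    by (rule AE_distrD[rotated]) (rule measurable_pair_swap')
  then have eq: "AE z in lebesgue. f (snd z, fst z) = g (snd z, fst z)"
    unfolding lborel_prod by (simp add: AE_completion_iff split_beta)
  have fm: "(\<lambda>z. f (snd z, fst z)) \<in> borel_measurable lebesgue"
    by (rule borel_measurable_AE[OF sm']) (use eq in auto)
  show "integrable lebesgue (\<lambda>z. f (snd z, fst z))"
    using integrable_cong_AE[OF fm sm' eq] si sm by (simp add: integrable_completion)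
  show "(LINT z|lebesgue. f (snd z, fst z)) = integral\<^sup>L lebesgue f"
    using integral_cong_AE[OF fm sm' eq] integral_completion[OF sm] sl integral_completion[OF g]
      integral_cong_AE[of f lebesgue g] f gl fg' by auto
qed

lemma open_lebesgue_measurable: "open S \<Longrightarrow> S \<in> sets lebesgue"
  by (simp add: borel_open)

lemma Fubini_lebesgue_on:
  fixes f :: "'a::euclidean_space \<times> 'b::euclidean_space \<Rightarrow> real"
  assumes A: "open A" and B: "open B" and f: "integrable (lebesgue_on (A \<times> B)) f"
  shows "AE x in lebesgue_on A. integrable (lebesgue_on B) (\<lambda>y. f (x, y))"
    and "integrable (lebesgue_on A) (\<lambda>x. LINT y|lebesgue_on B. f (x, y))"
    and "(LINT x|lebesgue_on A. LINT y|lebesgue_on B. f (x, y)) = integral\<^sup>L (lebesgue_on (A \<times> B)) f"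
    and "AE y in lebesgue_on B. integrable (lebesgue_on A) (\<lambda>x. f (x, y))"
    and "integrable (lebesgue_on B) (\<lambda>y. LINT x|lebesgue_on A. f (x, y))"
    and "(LINT y|lebesgue_on B. LINT x|lebesgue_on A. f (x, y)) = integral\<^sup>L (lebesgue_on (A \<times> B)) f"
proof -
  note m = open_lebesgue_measurable[OF A] open_lebesgue_measurable[OF B]
    open_lebesgue_measurable[OF open_Times[OF A B]]
  let ?f = "\<lambda>z. indicator (A \<times> B) z *\<^sub>R f z"
  have fi: "integrable lebesgue ?f" using f m by (simp add: integrable_restrict_space)
  have fl: "integral\<^sup>L (lebesgue_on (A \<times> B)) f = integral\<^sup>L lebesgue ?f"
    using m by (simp add: integral_restrict_space)
  have ind: "?f (x, y) = indicator A x *\<^sub>R (indicator B y *\<^sub>R f (x, y))" for x y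
    by (simp add: indicator_times)
  have ind': "?f (x, y) = indicator B y *\<^sub>R (indicator A x *\<^sub>R f (x, y))" for x y
    by (simp add: indicator_times)
  have r1: "(LINT y|lebesgue_on B. f (x, y)) = (LINT y|lebesgue. indicator B y *\<^sub>R f (x, y))" for x
    using m by (simp add: integral_restrict_space)
  have r2: "(LINT x|lebesgue_on A. f (x, y)) = (LINT x|lebesgue. indicator A x *\<^sub>R f (x, y))" for y
    using m by (simp add: integral_restrict_space)
  note F = Fubini_lebesgue_UNIV[OF fi]
  show "AE x in lebesgue_on A. integrable (lebesgue_on B) (\<lambda>y. f (x, y))"
    using F(1) m by (auto simp: AE_restrict_space_iff integrable_restrict_space indicator_times)
  show "integrable (lebesgue_on A) (\<lambda>x. LINT y|lebesgue_on B. f (x, y))"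
    using F(2) m unfolding ind r1 by (simp add: integrable_restrict_space)
  show "(LINT x|lebesgue_on A. LINT y|lebesgue_on B. f (x, y)) = integral\<^sup>L (lebesgue_on (A \<times> B)) f"
    using F(3) m unfolding ind r1 fl by (simp add: integral_restrict_space)
  note G = Fubini_lebesgue_UNIV[OF lebesgue_swap(1)[OF fi]]
  show "AE y in lebesgue_on B. integrable (lebesgue_on A) (\<lambda>x. f (x, y))"
    using G(1) m by (auto simp: AE_restrict_space_iff integrable_restrict_space indicator_times)
  show "integrable (lebesgue_on B) (\<lambda>y. LINT x|lebesgue_on A. f (x, y))"
    using G(2) m unfolding fst_conv snd_conv ind' r2 by (simp add: integrable_restrict_space)
  show "(LINT y|lebesgue_on B. LINT x|lebesgue_on A. f (x, y)) = integral\<^sup>L (lebesgue_on (A \<times> B)) f"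
    using G(3) lebesgue_swap(2)[OF fi] m unfolding fst_conv snd_conv ind' r2 fl 
    by (simp add: integral_restrict_space)
qed

section \<open>Density of test functions\<close>

definition L2_closure :: "'b::euclidean_space set \<Rightarrow> ('b \<Rightarrow> real) set \<Rightarrow> ('b \<Rightarrow> real) set" where
  "L2_closure S X = {f \<in> L2 S. \<forall>e>0. \<exists>g\<in>X. L2_norm S (\<lambda>x. f x - g x) < e}"

lemma L2_closure_L2: "f \<in> L2_closure S X \<Longrightarrow> f \<in> L2 S"
  by (simp add: L2_closure_def)

lemma L2_closure_approx:
  "f \<in> L2_closure S X \<Longrightarrow> e > 0 \<Longrightarrow> \<exists>g\<in>X. L2_norm S (\<lambda>x. f x - g x) < e"
  by (simp add: L2_closure_def)

lemma L2_closure_superset: "X \<subseteq> L2 S \<Longrightarrow> X \<subseteq> L2_closure S X"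
  by (force simp: L2_closure_def L2_norm_def)

lemma L2_norm_diff_triangle:
  assumes "f \<in> L2 S" "g \<in> L2 S" "h \<in> L2 S"
  shows "L2_norm S (\<lambda>x. f x - h x) \<le> L2_norm S (\<lambda>x. f x - g x) + L2_norm S (\<lambda>x. g x - h x)"
  using L2_norm_triangle[OF L2_diff[OF assms(1,2)] L2_diff[OF assms(2,3)]] by simp

lemma L2_closure_idem:
  assumes X: "X \<subseteq> L2 S" and f: "f \<in> L2 S"
    and a: "\<And>e. e > 0 \<Longrightarrow> \<exists>g\<in>L2_closure S X. L2_norm S (\<lambda>x. f x - g x) < e"
  shows "f \<in> L2_closure S X"
proof -
  have "\<exists>h\<in>X. L2_norm S (\<lambda>x. f x - h x) < e" if e: "e > 0" for e :: real
  proof -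
    obtain g where g: "g \<in> L2_closure S X" "L2_norm S (\<lambda>x. f x - g x) < e / 2"
      using a[OF half_gt_zero[OF e]] by blast
    obtain h where h: "h \<in> X" "L2_norm S (\<lambda>x. g x - h x) < e / 2"
      using L2_closure_approx[OF g(1) half_gt_zero[OF e]] by blast
    have "L2_norm S (\<lambda>x. f x - h x) < e"
      using L2_norm_diff_triangle[OF f L2_closure_L2[OF g(1)], of h] g(2) h X by auto
    then show ?thesis using h by blast
  qed
  then show ?thesis using f by (simp add: L2_closure_def)
qed

lemma L2_closure_mono_closure:
  assumes "Y \<subseteq> L2_closure S X" "X \<subseteq> L2 S"
  shows "L2_closure S Y \<subseteq> L2_closure S X"
proof
  fix f assume "f \<in> L2_closure S Y"
  then show "f \<in> L2_closure S X"
    using assms L2_closure_approx[of f S Y] by (intro L2_closure_idem) (blast intro: L2_closure_L2)+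
qed

lemma L2_closure_add:
  assumes X: "X \<subseteq> L2 S" and add: "\<And>f g. f \<in> X \<Longrightarrow> g \<in> X \<Longrightarrow> (\<lambda>x. f x + g x) \<in> X"
    and f: "f \<in> L2_closure S X" and g: "g \<in> L2_closure S X"
  shows "(\<lambda>x. f x + g x) \<in> L2_closure S X"
proof -
  have "\<exists>h\<in>X. L2_norm S (\<lambda>x. f x + g x - h x) < e" if e: "e > 0" for e :: real
  proof -
    obtain f' where f': "f' \<in> X" "L2_norm S (\<lambda>x. f x - f' x) < e / 2"
      using L2_closure_approx[OF f half_gt_zero[OF e]] by blast
    obtain g' where g': "g' \<in> X" "L2_norm S (\<lambda>x. g x - g' x) < e / 2"
      using L2_closure_approx[OF g half_gt_zero[OF e]] by blast
    have "f' \<in> L2 S" "g' \<in> L2 S" using f' g' X by auto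
    then have "L2_norm S (\<lambda>x. (f x - f' x) + (g x - g' x)) < e"
      using L2_norm_triangle[of "\<lambda>x. f x - f' x" S "\<lambda>x. g x - g' x"] f' g'
        L2_closure_L2[OF f] L2_closure_L2[OF g] by (auto simp: L2_diff)
    moreover have "(\<lambda>x. (f x - f' x) + (g x - g' x)) = (\<lambda>x. f x + g x - (f' x + g' x))" by auto
    ultimately show ?thesis using add[OF f'(1) g'(1)] by auto
  qed
  then show ?thesis
    using L2_add[OF L2_closure_L2[OF f] L2_closure_L2[OF g]] by (simp add: L2_closure_def)
qed

lemma L2_closure_scale:
  assumes X: "X \<subseteq> L2 S" and sc: "\<And>f c. f \<in> X \<Longrightarrow> (\<lambda>x. c * f x) \<in> X"
    and f: "f \<in> L2_closure S X"
  shows "(\<lambda>x. c * f x) \<in> L2_closure S X"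
proof -
  have "\<exists>h\<in>X. L2_norm S (\<lambda>x. c * f x - h x) < e" if "e > 0" for e :: real
  proof -
    have "e / (\<bar>c\<bar> + 1) > 0" using \<open>e > 0\<close> by simp
    then obtain f' where f': "f' \<in> X" "L2_norm S (\<lambda>x. f x - f' x) < e / (\<bar>c\<bar> + 1)"
      using L2_closure_approx[OF f] by blast
    have "L2_norm S (\<lambda>x. c * (f x - f' x)) = \<bar>c\<bar> * L2_norm S (\<lambda>x. f x - f' x)"
      by (rule L2_norm_mult_left)
    also have "\<dots> \<le> (\<bar>c\<bar> + 1) * L2_norm S (\<lambda>x. f x - f' x)"
      by (intro mult_right_mono) (auto simp: L2_norm_nonneg)
    also have "\<dots> < e" using f'(2) by (simp add: field_simps)
    finally show ?thesis using sc[OF f'(1)] by (auto simp: right_diff_distrib)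
  qed
  then show ?thesis using L2_mult_left[OF L2_closure_L2[OF f]] by (simp add: L2_closure_def)
qed

lemma L2_norm_dominated_convergence:
  fixes s :: "nat \<Rightarrow> 'b::euclidean_space \<Rightarrow> real"
  assumes f: "f \<in> L2 S" and s: "\<And>n. s n \<in> L2 S" and w: "w \<in> L2 S" 
    and S: "S \<in> sets lebesgue"
    and lim: "\<And>x. x \<in> S \<Longrightarrow> (\<lambda>n. s n x) \<longlonglongrightarrow> f x"
    and dom: "\<And>n x. x \<in> S \<Longrightarrow> \<bar>s n x\<bar> \<le> w x"
  shows "(\<lambda>n. L2_norm S (\<lambda>x. f x - s n x)) \<longlonglongrightarrow> 0"
proof -
  have "(\<lambda>n. LINT x|lebesgue_on S. (f x - s n x)\<^sup>2) \<longlonglongrightarrow> (LINT x|lebesgue_on S. 0)"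
  proof (rule integral_dominated_convergence[where w="\<lambda>x. (2 * w x)\<^sup>2"])
    show "integrable (lebesgue_on S) (\<lambda>x. (2 * w x)\<^sup>2)"
      using L2_integrable_sq[OF L2_mult_left[OF w, of 2]] by simp
    show "(\<lambda>x. (f x - s n x)\<^sup>2) \<in> borel_measurable (lebesgue_on S)" for n
      using L2_measurable[OF L2_diff[OF f s]] by simp
    show "AE x in lebesgue_on S. (\<lambda>n. (f x - s n x)\<^sup>2) \<longlonglongrightarrow> 0"
    proof (rule AE_I2)
      fix x assume "x \<in> space (lebesgue_on S)"
      then have "(\<lambda>n. (f x - s n x)\<^sup>2) \<longlonglongrightarrow> (f x - f x)\<^sup>2"
        by (intro tendsto_intros lim) simp
      then show "(\<lambda>n. (f x - s n x)\<^sup>2) \<longlonglongrightarrow> 0" by simp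
    qed
    show "AE x in lebesgue_on S. norm ((f x - s n x)\<^sup>2) \<le> (2 * w x)\<^sup>2" for n
    proof (rule AE_I2)
      fix x assume "x \<in> space (lebesgue_on S)"
      then have x: "x \<in> S" by simp
      have "\<bar>f x\<bar> \<le> w x"
        by (rule LIMSEQ_le_const2[OF tendsto_rabs[OF lim[OF x]]]) (use dom[OF x] in auto)
      then have "\<bar>f x - s n x\<bar> \<le> 2 * w x" using dom[OF x, of n] by simp
      then have "\<bar>f x - s n x\<bar>\<^sup>2 \<le> (2 * w x)\<^sup>2" by (rule power_mono) simp
      then show "norm ((f x - s n x)\<^sup>2) \<le> (2 * w x)\<^sup>2" by simp
    qed
  qed simp
  then have "(\<lambda>n. sqrt (LINT x|lebesgue_on S. (f x - s n x)\<^sup>2)) \<longlonglongrightarrow> sqrt 0"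
    by (intro tendsto_real_sqrt) simp
  then show ?thesis by (simp add: L2_norm_def)
qed

text \<open>This is the form in which density spreads from one class of functions to the next larger one.\<close>

lemma L2_closure_dominated:
  fixes s :: "nat \<Rightarrow> 'b::euclidean_space \<Rightarrow> real"
  assumes X: "X \<subseteq> L2 S" and f: "f \<in> L2 S" and s: "\<And>n. s n \<in> L2_closure S X" and w: "w \<in> L2 S" 
    and S: "S \<in> sets lebesgue"
    and lim: "\<And>x. x \<in> S \<Longrightarrow> (\<lambda>n. s n x) \<longlonglongrightarrow> f x"
    and dom: "\<And>n x. x \<in> S \<Longrightarrow> \<bar>s n x\<bar> \<le> w x"
  shows "f \<in> L2_closure S X"
proof (rule L2_closure_idem[OF X f])
  fix e :: real assume "e > 0"
  have "(\<lambda>n. L2_norm S (\<lambda>x. f x - s n x)) \<longlonglongrightarrow> 0"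
    by (rule L2_norm_dominated_convergence[OF f L2_closure_L2[OF s] w S lim dom])
  from order_tendstoD(2)[OF this \<open>e > 0\<close>]
  obtain n where "L2_norm S (\<lambda>x. f x - s n x) < e" by (auto simp: eventually_sequentially)
  then show "\<exists>g\<in>L2_closure S X. L2_norm S (\<lambda>x. f x - g x) < e" using s by blast
qed

definition test_functions :: "'b::euclidean_space set \<Rightarrow> ('b \<Rightarrow> real) set" where
  "test_functions S = {\<phi>. \<exists>D. test_function S \<phi> D}"

lemma test_function_continuous:
  assumes "test_function S \<phi> D" shows "continuous_on A \<phi>"
proof (rule continuous_at_imp_continuous_on, rule ballI)
  fix x show "isCont \<phi> x"
    using assms unfolding test_function_def gderiv_def by (blast intro: has_derivative_continuous)
qed

lemma test_function_grad_zero: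
  assumes t: "test_function S \<phi> D" and x: "x \<notin> closure {x. \<phi> x \<noteq> 0}"
  shows "D x = 0"
proof -
  have d: "(\<phi> has_derivative (\<lambda>h. h \<bullet> D x)) (at x)"
    using t unfolding test_function_def gderiv_def by blast
  have "((\<lambda>x. 0) has_derivative (\<lambda>h. h \<bullet> D x)) (at x)"
  proof (rule has_derivative_transform_within_open[OF d])
    show "open (- closure {x. \<phi> x \<noteq> 0})" by (rule open_Compl[OF closed_closure])
    show "x \<in> - closure {x. \<phi> x \<noteq> 0}" using x by simp
    show "\<phi> y = 0" if "y \<in> - closure {x. \<phi> x \<noteq> 0}" for y
      using that closure_subset[of "{x. \<phi> x \<noteq> 0}"] by auto
  qed
  then have "(\<lambda>h. h \<bullet> D x) = (\<lambda>h. 0)"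
    using has_derivative_unique has_derivative_const by blast
  then have "D x \<bullet> D x = 0" by meson
  then show ?thesis by simp
qed

lemma continuous_compact_support_L2:
  assumes f: "continuous_on UNIV f" and K: "compact K" and z: "\<And>x. x \<notin> K \<Longrightarrow> f x = 0"
    and S: "S \<in> lmeasurable"
  shows "f \<in> L2 S"
proof -
  have "bounded (f ` K)"
    by (rule compact_imp_bounded, rule compact_continuous_image)
       (use f K continuous_on_subset in auto)
  then obtain c where c: "\<And>x. x \<in> K \<Longrightarrow> norm (f x) \<le> c" "c > 0"
    unfolding bounded_pos by auto
  have "norm (f x) \<le> c" for x using c z by (cases "x \<in> K") auto
  moreover have "f \<in> borel_measurable (lebesgue_on S)"
    by (rule continuous_imp_measurable_on_sets_lebesgue)
       (use f S continuous_on_subset in \<open>auto simp: fmeasurableD\<close>)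
  ultimately show ?thesis using L2_bounded S by blast
qed

lemma test_function_L2:
  assumes t: "test_function S \<phi> D" and S: "S' \<in> lmeasurable"
  shows "\<phi> \<in> L2 S'" "D \<in> L2 S'"
proof -
  have K: "compact (closure {x. \<phi> x \<noteq> 0})" and D: "continuous_on UNIV D"
    using t by (auto simp: test_function_def)
  show "\<phi> \<in> L2 S'"
    by (rule continuous_compact_support_L2[OF test_function_continuous[OF t] K _ S])
       (use closure_subset[of "{x. \<phi> x \<noteq> 0}"] in auto)
  show "D \<in> L2 S'"
    by (rule continuous_compact_support_L2[OF D K _ S]) (rule test_function_grad_zero[OF t])
qed

lemma test_function_add:
  assumes 1: "test_function S \<phi> D" and 2: "test_function S \<psi> E"
  shows "test_function S (\<lambda>x. \<phi> x + \<psi> x) (\<lambda>x. D x + E x)"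
proof -
  let ?A = "closure {x. \<phi> x \<noteq> 0}" and ?B = "closure {x. \<psi> x \<noteq> 0}"
  have sub: "closure {x. \<phi> x + \<psi> x \<noteq> 0} \<subseteq> ?A \<union> ?B"
    unfolding closure_Un[symmetric] by (rule closure_mono) auto
  have "compact (?A \<union> ?B)" using 1 2 by (auto simp: test_function_def)
  then have "compact ((?A \<union> ?B) \<inter> closure {x. \<phi> x + \<psi> x \<noteq> 0})" by (rule compact_Int_closed) simp
  then have "compact (closure {x. \<phi> x + \<psi> x \<noteq> 0})" using sub by (simp add: Int_absorb1)
  then show ?thesis
    using 1 2 sub unfolding test_function_def
    by (auto intro!: continuous_intros GDERIV_add)
qed

text \<open>Composition with a \<open>C\<^sup>1\<close> function that fixes \<open>0\<close> keeps the support inside the old one.\<close>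

lemma test_function_compose:
  assumes t: "test_function S \<phi> D"
    and F: "\<And>s. DERIV F s :> F' s" and F': "continuous_on UNIV F'" and F0: "F 0 = 0"
  shows "test_function S (\<lambda>x. F (\<phi> x)) (\<lambda>x. F' (\<phi> x) *\<^sub>R D x)"
proof -
  let ?A = "closure {x. \<phi> x \<noteq> 0}"
  have sub: "closure {x. F (\<phi> x) \<noteq> 0} \<subseteq> ?A"
    by (rule closure_mono) (use F0 in auto)
  have "compact (?A \<inter> closure {x. F (\<phi> x) \<noteq> 0})"
    by (rule compact_Int_closed) (use t in \<open>auto simp: test_function_def\<close>)
  then have "compact (closure {x. F (\<phi> x) \<noteq> 0})" using sub by (simp add: Int_absorb1)
  moreover have "continuous_on UNIV (\<lambda>x. F' (\<phi> x) *\<^sub>R D x)"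
    using t continuous_on_compose2[OF F' test_function_continuous[OF t]]
    by (auto intro!: continuous_intros simp: test_function_def)
  ultimately show ?thesis
    using t sub GDERIV_DERIV_compose[OF _ F] unfolding test_function_def by fast
qed

lemma test_function_scale:
  assumes t: "test_function S \<phi> D"
  shows "test_function S (\<lambda>x. c * \<phi> x) (\<lambda>x. c *\<^sub>R D x)"
  by (rule test_function_compose[OF t, where F="\<lambda>s. c * s" and F'="\<lambda>s. c"])
     (auto intro!: derivative_eq_intros)

lemma test_function_zero: "test_function S (\<lambda>x. 0) (\<lambda>x. 0)"
  by (simp add: test_function_def GDERIV_const)

lemma DERIV_max0_power2: "DERIV (\<lambda>s::real. (max 0 s)\<^sup>2) s :> 2 * max 0 s"
proof -
  consider "s > 0" | "s < 0" | "s = 0" by linarith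
  then show ?thesis
  proof cases
    case 1
    have "DERIV (\<lambda>s::real. s\<^sup>2) s :> 2 * s" by (auto intro!: derivative_eq_intros)
    then show ?thesis
      by (rule DERIV_cong_ev[THEN iffD1, rotated -1])
         (use 1 in \<open>auto intro!: eventually_mono[OF eventually_nhds_in_open[of "{0<..}"]]\<close>)
  next
    case 2
    have "DERIV (\<lambda>s::real. 0) s :> 0" by simp
    then show ?thesis
      by (rule DERIV_cong_ev[THEN iffD1, rotated -1])
         (use 2 in \<open>auto intro!: eventually_mono[OF eventually_nhds_in_open[of "{..<0}"]]\<close>)
  next
    case 3
    have "((\<lambda>h::real. max 0 h) \<longlongrightarrow> max 0 0) (at 0)" by (intro tendsto_intros)
    then have "((\<lambda>h::real. max 0 h) \<longlongrightarrow> 0) (at 0)" by simp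
    then have "((\<lambda>h::real. (max 0 h)\<^sup>2 / h) \<longlongrightarrow> 0) (at 0)"
      by (rule Lim_transform_eventually)
         (auto simp: eventually_at_filter max_def power2_eq_square)
    then show ?thesis using 3 by (simp add: DERIV_def)
  qed
qed

text \<open>The function is \<open>(r\<^sup>2 - \<bar>x - c\<bar>\<^sup>2)\<^sub>+\<^sup>2\<close>; squaring the positive part makes it \<open>C\<^sup>1\<close> across the sphere.\<close>

lemma test_function_of_ball:
  assumes r: "r > 0" and sub: "cball c r \<subseteq> S"
  shows "\<exists>\<phi>\<in>test_functions S. (\<forall>x. \<phi> x \<ge> 0) \<and> {x. \<phi> x \<noteq> 0} = ball c r"
proof -
  define q where "q = (\<lambda>x. r\<^sup>2 - (x - c) \<bullet> (x - c))"
  let ?phi = "\<lambda>x. (max 0 (q x))\<^sup>2"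
  have qpos: "q x > 0 \<longleftrightarrow> x \<in> ball c r" for x
  proof -
    have "q x = r\<^sup>2 - (dist c x)\<^sup>2"
      by (simp add: q_def dist_norm norm_minus_commute[of c] power2_norm_eq_inner)
    moreover have "dist c x < r \<longleftrightarrow> (dist c x)\<^sup>2 < r\<^sup>2"
      using r power_strict_mono[of "dist c x" r 2] power2_less_imp_less[of "dist c x" r] by auto
    ultimately show ?thesis by simp
  qed
  have "?phi x \<noteq> 0 \<longleftrightarrow> q x > 0" for x by (simp add: max_def) linarith
  then have ne: "{x. ?phi x \<noteq> 0} = ball c r" using qpos by auto
  have "GDERIV q x :> (-2) *\<^sub>R (x - c)" for x
  proof -
    have "(q has_derivative (\<lambda>h. 0 - ((x - c) \<bullet> (h - 0) + (h - 0) \<bullet> (x - c)))) (at x)"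
      unfolding q_def by (intro derivative_intros)
    then show ?thesis unfolding gderiv_def by (simp add: inner_commute)
  qed
  then have g: "GDERIV ?phi x :> (2 * max 0 (q x)) *\<^sub>R ((-2) *\<^sub>R (x - c))" for x
    by (rule GDERIV_DERIV_compose[of q x "(-2) *\<^sub>R (x - c)" "\<lambda>s. (max 0 s)\<^sup>2", OF _ DERIV_max0_power2])
  have "test_function S ?phi (\<lambda>x. (2 * max 0 (q x)) *\<^sub>R ((-2) *\<^sub>R (x - c)))"
    unfolding test_function_def ne using g r sub
    by (auto simp: q_def intro!: continuous_intros simp del: scaleR_minus_left)
  then have "?phi \<in> test_functions S" by (auto simp: test_functions_def)
  then show ?thesis using ne by (intro bexI[of _ ?phi]) simp_all
qed

lemma test_function_of_ball_union:
  assumes "finite I" and "\<And>i. i \<in> I \<Longrightarrow> r i > 0 \<and> cball (c i) (r i) \<subseteq> S"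
  shows "\<exists>\<phi>\<in>test_functions S. (\<forall>x. \<phi> x \<ge> 0) \<and> {x. \<phi> x \<noteq> 0} = (\<Union>i\<in>I. ball (c i) (r i))"
  using assms
proof (induction I rule: finite_induct)
  case empty
  then show ?case using test_function_zero by (auto simp: test_functions_def intro!: bexI[of _ "\<lambda>x. 0"])
next
  case (insert a I)
  obtain \<phi> where \<phi>: "\<phi> \<in> test_functions S" "\<forall>x. \<phi> x \<ge> 0" "{x. \<phi> x \<noteq> 0} = (\<Union>i\<in>I. ball (c i) (r i))"
    using insert.IH insert.prems by auto
  obtain \<psi> where \<psi>: "\<psi> \<in> test_functions S" "\<forall>x. \<psi> x \<ge> 0" "{x. \<psi> x \<noteq> 0} = ball (c a) (r a)"
    using test_function_of_ball[of "r a" "c a" S] insert.prems by auto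
  have "(\<lambda>x. \<phi> x + \<psi> x) \<in> test_functions S"
    using \<phi>(1) \<psi>(1) test_function_add unfolding test_functions_def by blast
  moreover have "{x. \<phi> x + \<psi> x \<noteq> 0} = {x. \<phi> x \<noteq> 0} \<union> {x. \<psi> x \<noteq> 0}"
    using \<phi>(2) \<psi>(2) by (auto simp: add_nonneg_eq_0_iff)
  ultimately show ?case
    using \<phi> \<psi> by (intro bexI[of _ "\<lambda>x. \<phi> x + \<psi> x"]) auto
qed

lemma indicator_L2:
  assumes "A \<in> sets lebesgue" "S \<in> lmeasurable"
  shows "(indicator A :: 'b::euclidean_space \<Rightarrow> real) \<in> L2 S"
proof (rule L2_bounded[where c=1])
  show "indicator A \<in> borel_measurable (lebesgue_on S)"
    by (rule measurable_restrict_space1, rule borel_measurable_indicator[OF assms(1)])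
  show "norm (indicator A x :: real) \<le> 1" for x by (simp add: indicator_def)
qed (rule assms(2))

lemma test_functions_L2: "S \<in> lmeasurable \<Longrightarrow> test_functions S \<subseteq> L2 S"
  unfolding test_functions_def using test_function_L2 by blast

text \<open>The indicator of \<open>{\<phi> \<noteq> 0}\<close> is the bounded pointwise limit of the test functions
  \<open>n \<phi>\<^sup>2 / (1 + n \<phi>\<^sup>2)\<close>.\<close>

lemma indicator_support_in_closure:
  assumes \<phi>: "\<phi> \<in> test_functions S" and S: "S \<in> lmeasurable"
  shows "indicator {x. \<phi> x \<noteq> 0} \<in> L2_closure S (test_functions S)"
proof -
  obtain D where t: "test_function S \<phi> D" using \<phi> by (auto simp: test_functions_def)
  define F where "F n s = 1 - inverse (1 + real n * s\<^sup>2)" for n and s :: real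
  have pos: "1 + real n * s\<^sup>2 > 0" for n s by (simp add: add_pos_nonneg)
  have F: "DERIV (F n) s :> 2 * real n * s / (1 + real n * s\<^sup>2)\<^sup>2" for n s
    unfolding F_def using pos[of n s]
    by (auto intro!: derivative_eq_intros simp: field_simps power2_eq_square)
  have "test_function S (\<lambda>x. F n (\<phi> x)) (\<lambda>x. (2 * real n * \<phi> x / (1 + real n * (\<phi> x)\<^sup>2)\<^sup>2) *\<^sub>R D x)" for n
  proof (rule test_function_compose[OF t F])
    show "continuous_on UNIV (\<lambda>s. 2 * real n * s / (1 + real n * s\<^sup>2)\<^sup>2)"
      using pos[of n] by (intro continuous_intros) (auto simp: less_imp_neq[symmetric])
  qed (simp add: F_def)
  then have tn: "(\<lambda>x. F n (\<phi> x)) \<in> test_functions S" for n by (auto simp: test_functions_def)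
  have op: "open {x. \<phi> x \<noteq> 0}"
    by (rule open_Collect_neq) (use test_function_continuous[OF t] in auto)
  show ?thesis
  proof (rule L2_closure_dominated[where s="\<lambda>n x. F n (\<phi> x)" and w="\<lambda>x. 1"])
    show "test_functions S \<subseteq> L2 S" by (rule test_functions_L2[OF S])
    show "(indicator {x. \<phi> x \<noteq> 0} :: _ \<Rightarrow> real) \<in> L2 S" 
      by (rule indicator_L2[OF open_lebesgue_measurable[OF op] S])
    show "(\<lambda>x. F n (\<phi> x)) \<in> L2_closure S (test_functions S)" for n
      using tn L2_closure_superset[OF test_functions_L2[OF S]] by auto
    show "(\<lambda>x. 1::real) \<in> L2 S" by (rule L2_bounded[where c=1]) (use S in auto)
    show "S \<in> sets lebesgue" using S by auto
    show "\<bar>F n (\<phi> x)\<bar> \<le> 1" for n x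
    proof -
      have "1 + real n * (\<phi> x)\<^sup>2 \<ge> 1" by simp
      then have "inverse (1 + real n * (\<phi> x)\<^sup>2) \<le> 1" by (rule inverse_le_1_iff[THEN iffD2, OF disjI2])
      moreover have "inverse (1 + real n * (\<phi> x)\<^sup>2) \<ge> 0" using pos[of n "\<phi> x"] by simp
      ultimately show ?thesis by (simp add: F_def)
    qed
    show "(\<lambda>n. F n (\<phi> x)) \<longlonglongrightarrow> indicator {x. \<phi> x \<noteq> 0} x" for x
    proof (cases "\<phi> x = 0")
      case True then show ?thesis by (simp add: F_def)
    next
      case False
      have "filterlim (\<lambda>n. 1 + real n * (\<phi> x)\<^sup>2) at_top sequentially"
        by (intro filterlim_tendsto_add_at_top[OF tendsto_const] 
            filterlim_at_top_mult_tendsto_pos[OF tendsto_const] filterlim_real_sequentially)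
           (use False in auto)
      from tendsto_inverse_0_at_top[OF this]
      have "(\<lambda>n. 1 - inverse (1 + real n * (\<phi> x)\<^sup>2)) \<longlonglongrightarrow> 1 - 0" by (intro tendsto_intros)
      then show ?thesis using False by (simp add: F_def)
    qed
  qed
qed

text \<open>By regularity a measurable set \<open>A\<close> lies between a compact \<open>K\<close> and an open \<open>U\<close> with little
  room in between, and finitely many balls inside \<open>U\<close> cover \<open>K\<close>; the indicator of their union is a
  limit of test functions.\<close>

lemma indicator_in_closure_test_functions:
  assumes A: "A \<in> sets lebesgue" "A \<subseteq> S" and S: "open S" "bounded S"
  shows "indicator A \<in> L2_closure S (test_functions S)"
proof (rule L2_closure_idem)
  have Sm: "S \<in> lmeasurable" using S by (rule lmeasurable_open[rotated])
  show "test_functions S \<subseteq> L2 S" by (rule test_functions_L2[OF Sm])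
  show iA: "(indicator A :: _ \<Rightarrow> real) \<in> L2 S" by (rule indicator_L2[OF A(1) Sm])
  fix e :: real assume e: "e > 0"
  \<comment> \<open>the two gaps \<open>U0 - A\<close> and \<open>A - K\<close> share the admissible measure \<open>e\<^sup>2\<close>\<close>
  define d where "d = e\<^sup>2 / 2"
  have d: "d > 0" using e by (simp add: d_def)
  obtain U0 where U0: "open U0" "A \<subseteq> U0" "U0 - A \<in> lmeasurable" "emeasure lebesgue (U0 - A) < ennreal d"
    using sets_lebesgue_outer_open[OF A(1) d] by metis
  obtain K where K: "closed K" "K \<subseteq> A" "A - K \<in> lmeasurable" "emeasure lebesgue (A - K) < ennreal d"
    using sets_lebesgue_inner_closed[OF A(1) d] by metis
  define U where "U = U0 \<inter> S"
  have U: "open U" "A \<subseteq> U" "U \<subseteq> S" using U0 A S by (auto simp: U_def)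
  have "compact K" using K(1,2) A(2) S(2) bounded_subset compact_eq_bounded_closed by (metis subset_trans)
  have "\<exists>r>0. cball x r \<subseteq> U" if "x \<in> K" for x
    using that K(2) U(1,2) open_contains_cball by blast
  then obtain r where r: "\<And>x. x \<in> K \<Longrightarrow> r x > 0 \<and> cball x (r x) \<subseteq> U" by metis
  have "K \<subseteq> (\<Union>x\<in>K. ball x (r x))" using r by force
  from compactE_image[OF \<open>compact K\<close> _ this]
  obtain I where I: "I \<subseteq> K" "finite I" "K \<subseteq> (\<Union>x\<in>I. ball x (r x))" by (metis open_ball)
  define V where "V = (\<Union>x\<in>I. ball x (r x))"
  have VU: "V \<subseteq> U" using r I(1) ball_subset_cball unfolding V_def by blast
  have "\<exists>\<phi>\<in>test_functions S. (\<forall>x. \<phi> x \<ge> 0) \<and> {x. \<phi> x \<noteq> 0} = (\<Union>x\<in>I. ball x (r x))"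
    using test_function_of_ball_union[OF I(2), of r "\<lambda>x. x" S] r I(1) U(3) by blast
  then have V: "indicator V \<in> L2_closure S (test_functions S)"
    using indicator_support_in_closure[OF _ Sm] unfolding V_def by metis
  let ?B = "(U0 - A) \<union> (A - K)"
  have Bm: "?B \<in> lmeasurable" using U0(3) K(3) by auto
  have Bmeas: "measure lebesgue ?B < e\<^sup>2"
  proof -
    have "measure lebesgue (U0 - A) < d" "measure lebesgue (A - K) < d"
      using U0(3,4) K(3,4) d by (auto simp: emeasure_eq_measure2 ennreal_less_iff)
    then show ?thesis
      using measure_Un_le[of "U0 - A" lebesgue "A - K"] U0(3) K(3) by (auto simp: d_def)
  qed
  have iV: "(indicator V :: _ \<Rightarrow> real) \<in> L2 S" using L2_closure_L2[OF V] .
  have "(L2_norm S (\<lambda>x. indicator A x - indicator V x :: real))\<^sup>2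
      = (LINT x|lebesgue_on S. (indicator A x - indicator V x :: real)\<^sup>2)"
    by (simp add: L2_norm_sq real_norm_def)
  also have "\<dots> \<le> (LINT x|lebesgue_on S. indicator ?B x)"
  proof (rule integral_mono)
    show "integrable (lebesgue_on S) (\<lambda>x. (indicator A x - indicator V x :: real)\<^sup>2)"
      using L2_integrable_sq[OF L2_diff[OF iA iV]] by simp
    show "integrable (lebesgue_on S) (indicator ?B :: _ \<Rightarrow> real)"
      by (rule L2_integrable[OF indicator_L2[OF _ Sm] Sm]) (use Bm in auto)
    show "(indicator A x - indicator V x :: real)\<^sup>2 \<le> indicator ?B x" for x
      using K(2) U0(2) I(3) VU A unfolding V_def[symmetric] U_def
      by (auto simp: indicator_def)
  qed
  also have "\<dots> = (LINT x|lebesgue. indicator S x * indicator ?B x)"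
    using Sm by (subst integral_restrict_space) auto
  also have "\<dots> = (LINT x|lebesgue. indicator (S \<inter> ?B) x)"
    by (simp add: indicator_inter_arith)
  also have "\<dots> = measure lebesgue (S \<inter> ?B)" by simp
  also have "\<dots> \<le> measure lebesgue ?B"
    by (rule measure_mono_fmeasurable) (use Bm Sm in auto)
  also have "\<dots> < e\<^sup>2" by (rule Bmeas)
  finally have "L2_norm S (\<lambda>x. indicator A x - indicator V x :: real) < e"
    by (rule power2_less_imp_less) (use e in simp)
  then show "\<exists>g\<in>L2_closure S (test_functions S). L2_norm S (\<lambda>x. indicator A x - g x) < e"
    using V by blast
qed

lemma test_functions_add: "f \<in> test_functions S \<Longrightarrow> g \<in> test_functions S \<Longrightarrow> (\<lambda>x. f x + g x) \<in> test_functions S"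
  unfolding test_functions_def using test_function_add by blast

lemma test_functions_scale: "f \<in> test_functions S \<Longrightarrow> (\<lambda>x. c * f x) \<in> test_functions S"
  unfolding test_functions_def using test_function_scale by blast

text \<open>Indicators give simple functions, and these converge to any \<open>f\<close> in \<open>L\<^sup>2\<close> dominated by \<open>2 \<bar>f\<bar>\<close>.\<close>

theorem test_functions_dense:
  fixes S :: "'b::euclidean_space set"
  assumes S: "open S" "bounded S"
  shows "L2_closure S (test_functions S) = L2 S"
proof (rule antisym)
  have Sm: "S \<in> lmeasurable" using S by (rule lmeasurable_open[rotated])
  note T = test_functions_L2[OF Sm]
  show "L2_closure S (test_functions S) \<subseteq> L2 S" by (auto simp: L2_closure_def)
  have simple: "s \<in> L2_closure S (test_functions S)" if s: "simple_function (lebesgue_on S) s" for s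
  proof -
    have fin: "finite (s ` S)" using s by (simp add: simple_function_def)
    have lev: "s -` {y} \<inter> S \<in> sets lebesgue" for y
    proof -
      have "s -` {y} \<inter> S \<in> sets (lebesgue_on S)" 
        using simple_functionD(2)[OF s, of "{y}"] by simp
      then show ?thesis using Sm by (auto simp: sets_restrict_space_iff)
    qed
    have "(\<lambda>x. \<Sum>y\<in>Y. y * indicator (s -` {y} \<inter> S) x) \<in> L2_closure S (test_functions S)"
      if "finite Y" for Y
      using that
    proof (induction Y rule: finite_induct)
      case empty
      then show ?case
        using L2_closure_superset[OF T] test_function_zero by (auto simp: test_functions_def)
    next
      case (insert y Y)
      have "(\<lambda>x. y * indicator (s -` {y} \<inter> S) x) \<in> L2_closure S (test_functions S)"
        by (intro L2_closure_scale T test_functions_scale indicator_in_closure_test_functions lev S) auto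
      note add = L2_closure_add[OF T test_functions_add this insert.IH]
      have eq: "(\<lambda>x. \<Sum>y\<in>insert y Y. y * indicator (s -` {y} \<inter> S) x) =
         (\<lambda>x. y * indicator (s -` {y} \<inter> S) x + (\<Sum>y\<in>Y. y * indicator (s -` {y} \<inter> S) x))"
        by (rule ext, rule sum.insert[OF insert.hyps])
      show ?case unfolding eq by (rule add)
    qed
    from this[OF fin] have c: "(\<lambda>x. \<Sum>y\<in>s ` S. y * indicator (s -` {y} \<inter> S) x) \<in> L2_closure S (test_functions S)" .
    have eq: "s x = (\<Sum>y\<in>s ` S. y * indicator (s -` {y} \<inter> S) x)" if x: "x \<in> S" for x
    proof -
      have "(\<Sum>y\<in>s ` S. y * indicator (s -` {y} \<inter> S) x) = (\<Sum>y\<in>s ` S. if y = s x then y else 0)"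
        using x by (intro sum.cong) (auto simp: indicator_def)
      also have "\<dots> = s x" using fin x by simp
      finally show ?thesis by simp
    qed
    have bs: "bounded (s ` S)" using fin by (rule finite_imp_bounded)
    then obtain b where b: "\<And>x. x \<in> S \<Longrightarrow> norm (s x) \<le> b" unfolding bounded_iff by auto
    have sL: "s \<in> L2 S"
      using L2_bounded[OF borel_measurable_simple_function[OF s] Sm b] .
    show ?thesis
    proof (rule L2_closure_idem[OF T sL])
      fix e :: real assume "e > 0"
      have "L2_norm S (\<lambda>x. s x - (\<Sum>y\<in>s ` S. y * indicator (s -` {y} \<inter> S) x)) = L2_norm S (\<lambda>x. 0::real)"
        unfolding L2_norm_def
        by (intro arg_cong[where f=sqrt] Bochner_Integration.integral_cong refl)
           (simp add: eq_iff_diff_eq_0[THEN iffD1, OF eq])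
      then show "\<exists>g\<in>L2_closure S (test_functions S). L2_norm S (\<lambda>x. s x - g x) < e"
        using c \<open>e > 0\<close> by (intro bexI[OF _ c]) (simp add: L2_norm_def)
    qed
  qed
  show "L2 S \<subseteq> L2_closure S (test_functions S)"
  proof
    fix f :: "'b \<Rightarrow> real" assume f: "f \<in> L2 S"
    obtain F where F: "\<And>i. simple_function (lebesgue_on S) (F i)"
      "\<And>x. x \<in> S \<Longrightarrow> (\<lambda>i. F i x) \<longlonglongrightarrow> f x" "\<And>i x. x \<in> S \<Longrightarrow> \<bar>F i x\<bar> \<le> 2 * \<bar>f x\<bar>"
      using borel_measurable_implies_sequence_metric[OF L2_measurable[OF f], of 0]
      by (simp add: dist_norm) blast
    have "(\<lambda>x. 2 * \<bar>f x\<bar>) \<in> L2 S"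
    proof (rule L2_mult_left)
      have "(\<lambda>x. \<bar>f x\<bar>) \<in> borel_measurable (lebesgue_on S)"
        using L2_measurable[OF f] by (rule borel_measurable_abs)
      then show "(\<lambda>x. \<bar>f x\<bar>) \<in> L2 S" using f by (simp add: L2_def)
    qed
    then show "f \<in> L2_closure S (test_functions S)"
      by (rule L2_closure_dominated[OF T f simple[OF F(1)] _ _ F(2,3)]) (use Sm in auto)
  qed
qed

section \<open>Weak derivatives\<close>

text \<open>For every \<open>\<phi>\<close> in \<open>X\<close> one has \<open>\<parallel>h\<parallel>\<^sup>2 = \<langle>h - \<phi>, h\<rangle> \<le> \<parallel>h - \<phi>\<parallel> \<parallel>h\<parallel>\<close>, and \<open>\<phi>\<close> may approximate \<open>h\<close>. With the
  test functions as \<open>X\<close> this is the fundamental lemma of the calculus of variations.\<close>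

lemma AE_zero_if_orthogonal_to_dense:
  fixes h :: "'b::euclidean_space \<Rightarrow> real"
  assumes h: "h \<in> L2_closure S X" and X: "X \<subseteq> L2 S"
    and o: "\<And>\<phi>. \<phi> \<in> X \<Longrightarrow> (LINT x|lebesgue_on S. \<phi> x * h x) = 0"
  shows "AE x in lebesgue_on S. h x = 0"
proof -
  have hL: "h \<in> L2 S" using h by (rule L2_closure_L2)
  have "L2_norm S h \<le> e" if e: "e > 0" for e
  proof (rule ccontr)
    assume n: "\<not> L2_norm S h \<le> e"
    obtain \<phi> where \<phi>: "\<phi> \<in> X" "L2_norm S (\<lambda>x. h x - \<phi> x) < e" using h e by (auto simp: L2_closure_def)
    have \<phi>L: "\<phi> \<in> L2 S" using \<phi> X by auto
    have "(L2_norm S h)\<^sup>2 = (LINT x|lebesgue_on S. h x * h x)"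
      unfolding L2_norm_sq by (simp add: power2_eq_square)
    also have "\<dots> = (LINT x|lebesgue_on S. (h x - \<phi> x) * h x + \<phi> x * h x)"
      by (simp add: algebra_simps)
    also have "\<dots> = (LINT x|lebesgue_on S. (h x - \<phi> x) * h x)"
      using L2_integrable_mult[OF L2_diff[OF hL \<phi>L] hL] L2_integrable_mult[OF \<phi>L hL] o[OF \<phi>(1)] by simp
    also have "\<dots> \<le> L2_norm S (\<lambda>x. h x - \<phi> x) * L2_norm S h"
      using L2_Cauchy_Schwarz_mult[OF L2_diff[OF hL \<phi>L] hL] by simp
    also have "\<dots> \<le> e * L2_norm S h" using \<phi>(2) by (intro mult_right_mono) (auto simp: L2_norm_nonneg)
    finally show False using n e by (simp add: power2_eq_square)
  qed
  then have "L2_norm S h \<le> 0" using field_le_epsilon[of "L2_norm S h" 0] by simp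
  then have "L2_norm S h = 0" using L2_norm_nonneg[of S h] by simp
  then show ?thesis using L2_norm_eq_0_AE[OF hL] by simp
qed

lemma L2_inner_const: "f \<in> L2 S \<Longrightarrow> (\<lambda>x. f x \<bullet> b) \<in> L2 S"
proof -
  assume f: "f \<in> L2 S"
  have "integrable (lebesgue_on S) (\<lambda>x. (norm (f x \<bullet> b))\<^sup>2)"
  proof (rule Bochner_Integration.integrable_bound)
    show "integrable (lebesgue_on S) (\<lambda>x. (norm b)\<^sup>2 * (norm (f x))\<^sup>2)"
      using L2_integrable_sq[OF f] by simp
    show "(\<lambda>x. (norm (f x \<bullet> b))\<^sup>2) \<in> borel_measurable (lebesgue_on S)"
      using L2_measurable[OF f] by simp
    have "(f x \<bullet> b)\<^sup>2 \<le> (norm b)\<^sup>2 * (norm (f x))\<^sup>2" for x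
      using power_mono[OF Cauchy_Schwarz_ineq2[of "f x" b], of 2]
      by (simp add: power_mult_distrib mult.commute)
    then show "AE x in lebesgue_on S. norm ((norm (f x \<bullet> b))\<^sup>2) \<le> norm ((norm b)\<^sup>2 * (norm (f x))\<^sup>2)"
      by simp
  qed
  then show ?thesis using L2_measurable[OF f] by (simp add: L2_def)
qed

lemma L2_product_integrable:
  assumes "(\<phi> :: 'b::euclidean_space \<Rightarrow> real) \<in> L2 S" "g \<in> L2 S"
  shows "integrable (lebesgue_on S) (\<lambda>x. \<phi> x *\<^sub>R g x)"
proof (rule Bochner_Integration.integrable_bound)
  have "(\<lambda>x. norm (g x)) \<in> L2 S" using assms(2) by (auto simp: L2_def)
  from L2_integrable_mult[OF assms(1) this]
  show "integrable (lebesgue_on S) (\<lambda>x. \<phi> x * norm (g x))" .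
  show "(\<lambda>x. \<phi> x *\<^sub>R g x) \<in> borel_measurable (lebesgue_on S)"
    using assms by (intro borel_measurable_scaleR L2_measurable)
qed (simp add: abs_mult)

text \<open>Each component of the difference of two weak gradients is orthogonal to all test functions.\<close>

lemma has_weak_grad_unique:
  assumes S: "open S" "bounded S" and 1: "has_weak_grad S f g" and 2: "has_weak_grad S f h"
  shows "AE x in lebesgue_on S. g x = h x"
proof -
  have Sm: "S \<in> lmeasurable" using S by (rule lmeasurable_open[rotated])
  have gL: "g \<in> L2 S" and hL: "h \<in> L2 S" using 1 2 by (auto simp: has_weak_grad_def)
  have "AE x in lebesgue_on S. (g x - h x) \<bullet> b = 0" for b
  proof (rule AE_zero_if_orthogonal_to_dense)
    show "(\<lambda>x. (g x - h x) \<bullet> b) \<in> L2_closure S (test_functions S)"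
      unfolding test_functions_dense[OF S] by (intro L2_inner_const L2_diff gL hL)
    show "test_functions S \<subseteq> L2 S" by (rule test_functions_L2[OF Sm])
    fix \<phi> assume \<phi>: "\<phi> \<in> test_functions S"
    then obtain D where t: "test_function S \<phi> D" by (auto simp: test_functions_def)
    have pL: "\<phi> \<in> L2 S" using test_function_L2[OF t Sm] by simp
    note ig = L2_product_integrable[OF pL gL] and ih = L2_product_integrable[OF pL hL]
    have "(LINT x|lebesgue_on S. \<phi> x * ((g x - h x) \<bullet> b)) = 
       (LINT x|lebesgue_on S. (\<phi> x *\<^sub>R g x - \<phi> x *\<^sub>R h x) \<bullet> b)"
      by (simp add: inner_diff_left algebra_simps)
    also have "\<dots> = (LINT x|lebesgue_on S. \<phi> x *\<^sub>R g x - \<phi> x *\<^sub>R h x) \<bullet> b"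
      using ig ih by (intro integral_inner_left) simp
    also have "(LINT x|lebesgue_on S. \<phi> x *\<^sub>R g x - \<phi> x *\<^sub>R h x)
        = (LINT x|lebesgue_on S. \<phi> x *\<^sub>R g x) - (LINT x|lebesgue_on S. \<phi> x *\<^sub>R h x)"
      by (rule Bochner_Integration.integral_diff[OF ig ih])
    also have "(LINT x|lebesgue_on S. \<phi> x *\<^sub>R g x) = (LINT x|lebesgue_on S. \<phi> x *\<^sub>R h x)"
    proof -
      have "(LINT x|lebesgue_on S. f x *\<^sub>R D x) = - (LINT x|lebesgue_on S. \<phi> x *\<^sub>R g x)"
        "(LINT x|lebesgue_on S. f x *\<^sub>R D x) = - (LINT x|lebesgue_on S. \<phi> x *\<^sub>R h x)"
        using 1 2 t unfolding has_weak_grad_def by blast+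
      then show ?thesis by simp
    qed
    finally show "(LINT x|lebesgue_on S. \<phi> x * ((g x - h x) \<bullet> b)) = 0" by simp
  qed
  then have "AE x in lebesgue_on S. \<forall>b\<in>Basis. (g x - h x) \<bullet> b = 0"
    by (subst AE_ball_countable) (auto intro: countable_finite)
  then show ?thesis
  proof eventually_elim
    case (elim x)
    show ?case by (rule euclidean_eqI) (use elim in \<open>simp add: inner_diff_left\<close>)
  qed
qed

lemma has_weak_grad_lincomb:
  assumes S: "S \<in> lmeasurable" and 1: "has_weak_grad S f g" and 2: "has_weak_grad S f' g'"
  shows "has_weak_grad S (\<lambda>x. f x + c * f' x) (\<lambda>x. g x + c *\<^sub>R g' x)"
proof -
  have L: "f \<in> L2 S" "f' \<in> L2 S" "g \<in> L2 S" "g' \<in> L2 S" using 1 2 by (auto simp: has_weak_grad_def)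
  have "(LINT x|lebesgue_on S. (f x + c * f' x) *\<^sub>R D x) = - (LINT x|lebesgue_on S. \<phi> x *\<^sub>R (g x + c *\<^sub>R g' x))"
    if t: "test_function S \<phi> D" for \<phi> D
  proof -
    note TL = test_function_L2[OF t S]
    have "(LINT x|lebesgue_on S. (f x + c * f' x) *\<^sub>R D x) =
      (LINT x|lebesgue_on S. f x *\<^sub>R D x + c *\<^sub>R (f' x *\<^sub>R D x))" by (simp add: algebra_simps)
    also have "\<dots> = (LINT x|lebesgue_on S. f x *\<^sub>R D x) + c *\<^sub>R (LINT x|lebesgue_on S. f' x *\<^sub>R D x)"
      using L2_product_integrable[OF L(1) TL(2)] L2_product_integrable[OF L(2) TL(2)]
      by (simp del: scaleR_scaleR)
    also have "\<dots> = - ((LINT x|lebesgue_on S. \<phi> x *\<^sub>R g x) + c *\<^sub>R (LINT x|lebesgue_on S. \<phi> x *\<^sub>R g' x))"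
      using 1 2 t unfolding has_weak_grad_def by simp
    also have "(LINT x|lebesgue_on S. \<phi> x *\<^sub>R g x) + c *\<^sub>R (LINT x|lebesgue_on S. \<phi> x *\<^sub>R g' x)
       = (LINT x|lebesgue_on S. \<phi> x *\<^sub>R g x + c *\<^sub>R (\<phi> x *\<^sub>R g' x))"
      using L2_product_integrable[OF TL(1) L(3)] L2_product_integrable[OF TL(1) L(4)]
      by (simp del: scaleR_scaleR)
    also have "\<dots> = (LINT x|lebesgue_on S. \<phi> x *\<^sub>R (g x + c *\<^sub>R g' x))" by (simp add: algebra_simps)
    finally show ?thesis .
  qed
  then show ?thesis
    using L by (simp add: has_weak_grad_def L2_add L2_mult_left L2_scaleR)
qed

lemma L2_convergence_lincomb:
  fixes f g :: "nat \<Rightarrow> 'b::euclidean_space \<Rightarrow> 'c::euclidean_space"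
  assumes f: "\<And>n. f n \<in> L2 S" "f' \<in> L2 S" "(\<lambda>n. L2_norm S (\<lambda>x. f n x - f' x)) \<longlonglongrightarrow> 0"
    and g: "\<And>n. g n \<in> L2 S" "g' \<in> L2 S" "(\<lambda>n. L2_norm S (\<lambda>x. g n x - g' x)) \<longlonglongrightarrow> 0"
  shows "(\<lambda>n. L2_norm S (\<lambda>x. (f n x + c *\<^sub>R g n x) - (f' x + c *\<^sub>R g' x))) \<longlonglongrightarrow> 0"
proof (rule tendsto_sandwich[OF always_eventually always_eventually tendsto_const])
  show "(\<lambda>n. L2_norm S (\<lambda>x. f n x - f' x) + \<bar>c\<bar> * L2_norm S (\<lambda>x. g n x - g' x)) \<longlonglongrightarrow> 0"
    using tendsto_add[OF f(3) tendsto_mult_left[OF g(3), of "\<bar>c\<bar>"]] by simp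
  have "L2_norm S (\<lambda>x. (f n x - f' x) + c *\<^sub>R (g n x - g' x))
      \<le> L2_norm S (\<lambda>x. f n x - f' x) + \<bar>c\<bar> * L2_norm S (\<lambda>x. g n x - g' x)" for n
    using L2_norm_triangle[OF L2_diff[OF f(1)[of n] f(2)] L2_scaleR[OF L2_diff[OF g(1)[of n] g(2)], of c]]
    by (simp add: L2_norm_scaleR)
  then show "\<forall>n. L2_norm S (\<lambda>x. (f n x + c *\<^sub>R g n x) - (f' x + c *\<^sub>R g' x))
      \<le> L2_norm S (\<lambda>x. f n x - f' x) + \<bar>c\<bar> * L2_norm S (\<lambda>x. g n x - g' x)"
    by (simp add: algebra_simps)
qed (simp add: L2_norm_nonneg)

lemma L2_convergence_inner:
  assumes h: "h \<in> L2 S" and f: "\<And>n. f n \<in> L2 S" and g: "g \<in> L2 S"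
    and l: "(\<lambda>n. L2_norm S (\<lambda>x. f n x - g x)) \<longlonglongrightarrow> 0"
  shows "(\<lambda>n. (LINT x|lebesgue_on S. h x \<bullet> f n x)) \<longlonglongrightarrow> (LINT x|lebesgue_on S. h x \<bullet> g x)"
proof (rule LIM_zero_cancel, rule Lim_null_comparison[OF always_eventually])
  show "(\<lambda>n. L2_norm S h * L2_norm S (\<lambda>x. f n x - g x)) \<longlonglongrightarrow> 0"
    using tendsto_mult_left[OF l] by fastforce
  show "\<forall>n. norm ((LINT x|lebesgue_on S. h x \<bullet> f n x) - (LINT x|lebesgue_on S. h x \<bullet> g x))
      \<le> L2_norm S h * L2_norm S (\<lambda>x. f n x - g x)"
  proof
    fix n
    have "(LINT x|lebesgue_on S. h x \<bullet> f n x) - (LINT x|lebesgue_on S. h x \<bullet> g x) =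
       (LINT x|lebesgue_on S. h x \<bullet> (f n x - g x))"
      using L2_integrable_inner[OF h f[of n]] L2_integrable_inner[OF h g] by (simp add: inner_diff_right)
    then show "norm ((LINT x|lebesgue_on S. h x \<bullet> f n x) - (LINT x|lebesgue_on S. h x \<bullet> g x))
      \<le> L2_norm S h * L2_norm S (\<lambda>x. f n x - g x)"
      using L2_Cauchy_Schwarz[OF h L2_diff[OF f[of n] g]] by simp
  qed
qed

lemma H10_lincomb:
  assumes S: "S \<in> lmeasurable" and 1: "f \<in> H10 S" and 2: "f' \<in> H10 S"
  shows "(\<lambda>x. f x + c * f' x) \<in> H10 S"
proof -
  obtain g \<phi> D where g: "has_weak_grad S f g" and t: "\<And>n::nat. test_function S (\<phi> n) (D n)"
    and l: "(\<lambda>n. L2_norm S (\<lambda>x. \<phi> n x - f x)) \<longlonglongrightarrow> 0" "(\<lambda>n. L2_norm S (\<lambda>x. D n x - g x)) \<longlonglongrightarrow> 0"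
    using 1 unfolding H10_def by auto
  obtain g' \<phi>' D' where g': "has_weak_grad S f' g'" and t': "\<And>n::nat. test_function S (\<phi>' n) (D' n)"
    and l': "(\<lambda>n. L2_norm S (\<lambda>x. \<phi>' n x - f' x)) \<longlonglongrightarrow> 0" "(\<lambda>n. L2_norm S (\<lambda>x. D' n x - g' x)) \<longlonglongrightarrow> 0"
    using 2 unfolding H10_def by auto
  have L: "f \<in> L2 S" "f' \<in> L2 S" "g \<in> L2 S" "g' \<in> L2 S" using g g' by (auto simp: has_weak_grad_def)
  note TL = test_function_L2[OF t S] and TL' = test_function_L2[OF t' S]
  have b1: "(\<lambda>n. L2_norm S (\<lambda>x. (\<phi> n x + c * \<phi>' n x) - (f x + c * f' x))) \<longlonglongrightarrow> 0"
    using L2_convergence_lincomb[OF TL(1) L(1) l(1) TL'(1) L(2) l'(1), of c] by simp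
  have b2: "(\<lambda>n. L2_norm S (\<lambda>x. (D n x + c *\<^sub>R D' n x) - (g x + c *\<^sub>R g' x))) \<longlonglongrightarrow> 0"
    by (rule L2_convergence_lincomb[OF TL(2) L(3) l(2) TL'(2) L(4) l'(2)])
  have "test_function S (\<lambda>x. \<phi> n x + c * \<phi>' n x) (\<lambda>x. D n x + c *\<^sub>R D' n x)" for n
    by (intro test_function_add test_function_scale t t')
  with has_weak_grad_lincomb[OF S g g', of c] b1 b2 show ?thesis
    unfolding H10_def mem_Collect_eq
    by (intro exI[of _ "\<lambda>x. g x + c *\<^sub>R g' x"] conjI exI[of _ "\<lambda>n x. \<phi> n x + c * \<phi>' n x"]
      exI[of _ "\<lambda>n x. D n x + c *\<^sub>R D' n x"]) auto
qed

text \<open>The test functions converging to \<open>w\<close> in \<open>H\<^sup>1\<close> carry the defining identity of the weak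
  divergence over to \<open>w\<close>.\<close>

lemma weak_div_H10:
  assumes S: "open S" "bounded S" and d: "has_weak_div S \<tau> h"
    and w: "w \<in> H10 S" and g: "has_weak_grad S w g"
  shows "(LINT x|lebesgue_on S. \<tau> x \<bullet> g x) = - (LINT x|lebesgue_on S. h x * w x)"
proof -
  have Sm: "S \<in> lmeasurable" using S by (rule lmeasurable_open[rotated])
  obtain g' \<phi> D where g': "has_weak_grad S w g'" and t: "\<And>n::nat. test_function S (\<phi> n) (D n)"
    and l: "(\<lambda>n. L2_norm S (\<lambda>x. \<phi> n x - w x)) \<longlonglongrightarrow> 0" "(\<lambda>n. L2_norm S (\<lambda>x. D n x - g' x)) \<longlonglongrightarrow> 0"
    using w unfolding H10_def by auto
  have L: "\<tau> \<in> L2 S" "h \<in> L2 S" "w \<in> L2 S" "g \<in> L2 S" "g' \<in> L2 S"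
    using d g g' by (auto simp: has_weak_grad_def has_weak_div_def)
  note TL = test_function_L2[OF t Sm]
  have gg': "AE x in lebesgue_on S. g x = g' x" by (rule has_weak_grad_unique[OF S g g'])
  have 1: "(\<lambda>n. (LINT x|lebesgue_on S. \<tau> x \<bullet> D n x)) \<longlonglongrightarrow> (LINT x|lebesgue_on S. \<tau> x \<bullet> g' x)"
    by (rule L2_convergence_inner[OF L(1) TL(2) L(5) l(2)])
  have 2: "(\<lambda>n. - (LINT x|lebesgue_on S. h x * \<phi> n x)) \<longlonglongrightarrow> - (LINT x|lebesgue_on S. h x * w x)"
    using tendsto_minus[OF L2_convergence_inner[OF L(2) TL(1) L(3) l(1)]] by simp
  have "(LINT x|lebesgue_on S. \<tau> x \<bullet> D n x) = - (LINT x|lebesgue_on S. h x * \<phi> n x)" for n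
    using d t[of n] unfolding has_weak_div_def by blast
  with 1 2 have "(LINT x|lebesgue_on S. \<tau> x \<bullet> g' x) = - (LINT x|lebesgue_on S. h x * w x)"
    using LIMSEQ_unique by simp
  moreover have "(LINT x|lebesgue_on S. \<tau> x \<bullet> g x) = (LINT x|lebesgue_on S. \<tau> x \<bullet> g' x)"
    by (rule integral_cong_AE) (use gg' L in \<open>auto intro!: borel_measurable_inner dest: L2_measurable\<close>)
  ultimately show ?thesis by simp
qed

section \<open>Orthonormal systems\<close>

definition orthonormal_on :: "'b::euclidean_space set \<Rightarrow> (nat \<Rightarrow> 'b \<Rightarrow> real) \<Rightarrow> bool" where
  "orthonormal_on S e \<longleftrightarrow> (\<forall>i. e i \<in> L2 S) \<and>
     (\<forall>i j. (LINT x|lebesgue_on S. e i x * e j x) = (if i = j then 1 else 0))"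

definition lin_span :: "(nat \<Rightarrow> 'b \<Rightarrow> real) \<Rightarrow> ('b \<Rightarrow> real) set" where
  "lin_span e = {p. \<exists>N c. p = (\<lambda>x. \<Sum>i<N. c i * e i x)}"

abbreviation ortho_coeff :: "'b::euclidean_space set \<Rightarrow> (nat \<Rightarrow> 'b \<Rightarrow> real) \<Rightarrow> ('b \<Rightarrow> real) \<Rightarrow> nat \<Rightarrow> real" where
  "ortho_coeff S e f i \<equiv> (LINT x|lebesgue_on S. f x * e i x)"

lemma lin_spanI: "(\<lambda>x. \<Sum>i<N. c i * e i x) \<in> lin_span e"
  by (auto simp: lin_span_def)

definition ortho_proj :: "'b::euclidean_space set \<Rightarrow> (nat \<Rightarrow> 'b \<Rightarrow> real) \<Rightarrow> nat \<Rightarrow> ('b \<Rightarrow> real) \<Rightarrow> 'b \<Rightarrow> real" where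
  "ortho_proj S e N f x = (\<Sum>i<N. ortho_coeff S e f i * e i x)"

lemma L2_lincomb:
  fixes e :: "nat \<Rightarrow> 'b::euclidean_space \<Rightarrow> real"
  assumes "\<And>i. e i \<in> L2 S" shows "(\<lambda>x. \<Sum>i<N. c i * e i x) \<in> L2 S"
  by (rule L2_sum) (auto intro: L2_mult_left assms)

lemma integral_lincomb:
  fixes e :: "nat \<Rightarrow> 'b::euclidean_space \<Rightarrow> real"
  assumes e: "\<And>i. e i \<in> L2 S" and g: "g \<in> L2 S"
  shows "(LINT x|lebesgue_on S. (\<Sum>i<N. c i * e i x) * g x) = (\<Sum>i<N. c i * ortho_coeff S e g i)"
proof -
  have "(LINT x|lebesgue_on S. (\<Sum>i<N. c i * e i x) * g x) =
     (LINT x|lebesgue_on S. (\<Sum>i<N. c i * (g x * e i x)))"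
    by (intro Bochner_Integration.integral_cong refl) (simp add: sum_distrib_left mult_ac)
  also have "\<dots> = (\<Sum>i<N. (LINT x|lebesgue_on S. c i * (g x * e i x)))"
    by (rule Bochner_Integration.integral_sum)
       (intro integrable_mult_right L2_integrable_mult[OF g e])
  finally show ?thesis by simp
qed

context
  fixes S :: "'b::euclidean_space set" and e :: "nat \<Rightarrow> 'b \<Rightarrow> real"
  assumes e: "orthonormal_on S e"
begin

lemma ortho_L2: "e i \<in> L2 S"
  using e by (simp add: orthonormal_on_def)

lemma ortho_proj_L2: "ortho_proj S e N f \<in> L2 S"
  unfolding ortho_proj_def[abs_def] by (rule L2_lincomb[OF ortho_L2])

lemma ortho_proj_inner:
  assumes g: "g \<in> L2 S"
  shows "(LINT x|lebesgue_on S. ortho_proj S e N f x * g x) =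
    (\<Sum>i<N. ortho_coeff S e f i * ortho_coeff S e g i)"
  unfolding ortho_proj_def by (rule integral_lincomb[OF ortho_L2 g])

lemma ortho_coeff_proj:
  assumes "j < N"
  shows "ortho_coeff S e (ortho_proj S e N f) j = ortho_coeff S e f j"
proof -
  have "ortho_coeff S e (ortho_proj S e N f) j = (\<Sum>i<N. ortho_coeff S e f i * ortho_coeff S e (e j) i)"
    by (rule ortho_proj_inner[OF ortho_L2])
  also have "\<dots> = (\<Sum>i<N. if i = j then ortho_coeff S e f i else 0)"
    using e by (intro sum.cong) (auto simp: orthonormal_on_def)
  finally show ?thesis using assms by simp
qed

lemma ortho_proj_norm_sq:
  "(L2_norm S (ortho_proj S e N f))\<^sup>2 = (\<Sum>i<N. (ortho_coeff S e f i)\<^sup>2)"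
proof -
  have "(L2_norm S (ortho_proj S e N f))\<^sup>2 =
     (LINT x|lebesgue_on S. ortho_proj S e N f x * ortho_proj S e N f x)"
    unfolding L2_norm_sq by (simp add: power2_eq_square)
  also have "\<dots> = (\<Sum>i<N. ortho_coeff S e f i * ortho_coeff S e (ortho_proj S e N f) i)"
    by (rule ortho_proj_inner[OF ortho_proj_L2])
  also have "\<dots> = (\<Sum>i<N. (ortho_coeff S e f i)\<^sup>2)"
    by (intro sum.cong refl) (simp add: ortho_coeff_proj power2_eq_square)
  finally show ?thesis .
qed

text \<open>\<open>\<parallel>P f\<parallel>\<^sup>2 = \<langle>P f, f\<rangle> \<le> \<parallel>P f\<parallel> \<parallel>f\<parallel>\<close> for the projection \<open>P\<close>.\<close>

lemma Bessel:
  assumes f: "f \<in> L2 S"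
  shows "L2_norm S (ortho_proj S e N f) \<le> L2_norm S f"
proof -
  have "(L2_norm S (ortho_proj S e N f))\<^sup>2 = (LINT x|lebesgue_on S. ortho_proj S e N f x * f x)"
    unfolding ortho_proj_norm_sq ortho_proj_inner[OF f] by (simp add: power2_eq_square)
  also have "\<dots> \<le> L2_norm S (ortho_proj S e N f) * L2_norm S f"
    using L2_Cauchy_Schwarz_mult[OF ortho_proj_L2 f, of N f] by simp
  finally have "L2_norm S (ortho_proj S e N f) * L2_norm S (ortho_proj S e N f) 
      \<le> L2_norm S (ortho_proj S e N f) * L2_norm S f" by (simp add: power2_eq_square)
  then show ?thesis
    using L2_norm_nonneg[of S "ortho_proj S e N f"] L2_norm_nonneg[of S f]
    by (cases "L2_norm S (ortho_proj S e N f) = 0") (auto simp: mult_le_cancel_left)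
qed

lemma Bessel_product:
  assumes f: "f \<in> L2 S" and g: "g \<in> L2 S"
  shows "\<bar>\<Sum>i<N. ortho_coeff S e f i * ortho_coeff S e g i\<bar> \<le> L2_norm S f * L2_norm S g"
proof -
  have "\<bar>\<Sum>i<N. ortho_coeff S e f i * ortho_coeff S e g i\<bar> \<le> L2_norm S (ortho_proj S e N f) * L2_norm S g"
    unfolding ortho_proj_inner[OF g, symmetric] by (rule L2_Cauchy_Schwarz_mult[OF ortho_proj_L2 g])
  also have "\<dots> \<le> L2_norm S f * L2_norm S g"
    by (rule mult_right_mono[OF Bessel[OF f] L2_norm_nonneg])
  finally show ?thesis .
qed

text \<open>The remainder \<open>f - P f\<close> is orthogonal to \<open>p\<close> and to \<open>P f\<close>, so its square is \<open>\<langle>f - P f, f - p\<rangle>\<close>.\<close>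

lemma ortho_proj_best_approx:
  assumes f: "f \<in> L2 S" and p: "p = (\<lambda>x. \<Sum>i<M. c i * e i x)" and "M \<le> N"
  shows "L2_norm S (\<lambda>x. f x - ortho_proj S e N f x) \<le> L2_norm S (\<lambda>x. f x - p x)"
proof -
  let ?r = "\<lambda>x. f x - ortho_proj S e N f x"
  have r: "?r \<in> L2 S" by (rule L2_diff[OF f ortho_proj_L2])
  have pL: "p \<in> L2 S" unfolding p by (rule L2_lincomb[OF ortho_L2])
  have perp: "ortho_coeff S e ?r i = 0" if "i < N" for i
    using L2_integrable_mult[OF f ortho_L2[of i]] L2_integrable_mult[OF ortho_proj_L2 ortho_L2[of i]]
      ortho_coeff_proj[OF that, of f]
    by (simp add: left_diff_distrib)
  have 1: "(LINT x|lebesgue_on S. p x * ?r x) = 0"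
    unfolding p integral_lincomb[OF ortho_L2 r] using perp \<open>M \<le> N\<close> by (intro sum.neutral) auto
  have 2: "(LINT x|lebesgue_on S. ortho_proj S e N f x * ?r x) = 0"
    unfolding ortho_proj_inner[OF r] using perp by (intro sum.neutral) auto
  have "(L2_norm S ?r)\<^sup>2 = (LINT x|lebesgue_on S. (f x - p x) * ?r x + p x * ?r x - ortho_proj S e N f x * ?r x)"
    unfolding L2_norm_sq by (intro Bochner_Integration.integral_cong refl) (simp add: power2_eq_square algebra_simps)
  also have "\<dots> = (LINT x|lebesgue_on S. (f x - p x) * ?r x)"
    using L2_integrable_mult[OF L2_diff[OF f pL] r] L2_integrable_mult[OF pL r]
      L2_integrable_mult[OF ortho_proj_L2[of N f] r] 1 2 by simp
  also have "\<dots> \<le> L2_norm S (\<lambda>x. f x - p x) * L2_norm S ?r"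
    using L2_Cauchy_Schwarz_mult[OF L2_diff[OF f pL] r] by simp
  finally have "L2_norm S ?r * L2_norm S ?r \<le> L2_norm S (\<lambda>x. f x - p x) * L2_norm S ?r"
    by (simp add: power2_eq_square)
  then show ?thesis
    using L2_norm_nonneg[of S ?r] L2_norm_nonneg[of S "\<lambda>x. f x - p x"]
    by (cases "L2_norm S ?r = 0") (auto simp: mult_le_cancel_right)
qed

text \<open>Beyond the length of a good approximation \<open>p\<close> of \<open>f\<close> the projections of \<open>f\<close> are at least as close
  to \<open>f\<close> as \<open>p\<close>, and the partial sums are the inner products of these projections with \<open>g\<close>.\<close>

theorem Parseval:
  assumes f: "f \<in> L2_closure S (lin_span e)" and g: "g \<in> L2 S"
  shows "(\<lambda>N. \<Sum>i<N. ortho_coeff S e f i * ortho_coeff S e g i)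
    \<longlonglongrightarrow> (LINT x|lebesgue_on S. f x * g x)"
proof (rule LIMSEQ_I)
  fix r :: real assume r: "r > 0"
  have fL: "f \<in> L2 S" using f by (rule L2_closure_L2)
  define d where "d = r / (L2_norm S g + 1)"
  have ng: "L2_norm S g + 1 > 0" using L2_norm_nonneg[of S g] by simp
  have d: "d > 0" using r ng by (simp add: d_def)
  obtain p where p: "p \<in> lin_span e" "L2_norm S (\<lambda>x. f x - p x) < d"
    using L2_closure_approx[OF f d] by blast
  obtain M c where pc: "p = (\<lambda>x. \<Sum>i<M. c i * e i x)" using p(1) by (auto simp: lin_span_def)
  have "norm ((\<Sum>i<N. ortho_coeff S e f i * ortho_coeff S e g i) - (LINT x|lebesgue_on S. f x * g x)) < r"
    if "M \<le> N" for N
  proof -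
    let ?r = "\<lambda>x. f x - ortho_proj S e N f x"
    have rL: "?r \<in> L2 S" by (rule L2_diff[OF fL ortho_proj_L2])
    have "(LINT x|lebesgue_on S. ?r x * g x) = 
        (LINT x|lebesgue_on S. f x * g x) - (\<Sum>i<N. ortho_coeff S e f i * ortho_coeff S e g i)"
      unfolding ortho_proj_inner[OF g, symmetric]
      using L2_integrable_mult[OF fL g] L2_integrable_mult[OF ortho_proj_L2[of N f] g]
      by (simp add: left_diff_distrib)
    then have "norm ((\<Sum>i<N. ortho_coeff S e f i * ortho_coeff S e g i) - (LINT x|lebesgue_on S. f x * g x))
       = \<bar>LINT x|lebesgue_on S. ?r x * g x\<bar>" by simp
    also have "\<dots> \<le> L2_norm S ?r * L2_norm S g" by (rule L2_Cauchy_Schwarz_mult[OF rL g])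
    also have "\<dots> \<le> d * L2_norm S g"
      using ortho_proj_best_approx[OF fL pc that] p(2) by (intro mult_right_mono L2_norm_nonneg) simp
    also have "\<dots> < d * (L2_norm S g + 1)" using d by simp
    also have "\<dots> = r" using ng by (simp add: d_def)
    finally show ?thesis .
  qed
  then show "\<exists>M. \<forall>N\<ge>M. norm ((\<Sum>i<N. ortho_coeff S e f i * ortho_coeff S e g i)
      - (LINT x|lebesgue_on S. f x * g x)) < r" by blast
qed

end

section \<open>The trigonometric system\<close>

lemma FTC_lebesgue_interval:
  fixes F :: "real \<Rightarrow> real"
  assumes "T > 0" and d: "\<And>t. DERIV F t :> f t" and c: "continuous_on UNIV f"
  shows "(LINT t|lebesgue_on {0<..<T}. f t) = F T - F 0"
proof -
  have "bounded (f ` {0..T})"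
    by (intro compact_imp_bounded compact_continuous_image continuous_on_subset[OF c]) auto
  then obtain b where b0: "\<forall>t\<in>{0..T}. norm (f t) \<le> b" unfolding bounded_iff by auto
  have b: "norm (f t) \<le> b" if "t \<in> {0<..<T}" for t using b0 that by auto
  have m: "f \<in> borel_measurable (lebesgue_on {0<..<T})"
    by (rule continuous_imp_measurable_on_sets_lebesgue) (auto intro: continuous_on_subset[OF c])
  have lm: "{0<..<T} \<in> lmeasurable" by simp
  have "integrable (lebesgue_on {0<..<T}) f"
    by (rule L2_integrable[OF L2_bounded[OF m lm b] lm])
  then have "(LINT t|lebesgue_on {0<..<T}. f t) = integral {0<..<T} f"
    by (rule lebesgue_integral_eq_integral) simp
  also have "\<dots> = integral {0..T} f" by (rule integral_open_interval_real[symmetric])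
  also have "\<dots> = F T - F 0"
    by (rule integral_unique, rule fundamental_theorem_of_calculus)
       (use assms in \<open>auto intro: has_field_derivative_at_within
          simp: has_real_derivative_iff_has_vector_derivative[symmetric]\<close>)
  finally show ?thesis .
qed

lemma integral_cos_freq:
  assumes T: "T > 0"
  shows "(LINT t|lebesgue_on {0<..<T}. cos (of_int m * freq T * t)) = (if m = 0 then T else 0)"
proof (cases "m = 0")
  case True
  have "(LINT t|lebesgue_on {0<..<T}. (1::real)) = T - 0"
    by (rule FTC_lebesgue_interval[OF T, where F="\<lambda>t. t"]) auto
  then show ?thesis using True by simp
next
  case False
  let ?a = "of_int m * freq T"
  have a: "?a \<noteq> 0" using False T by (simp add: freq_def)
  have "(LINT t|lebesgue_on {0<..<T}. cos (?a * t)) = sin (?a * T) / ?a - sin (?a * 0) / ?a"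
    by (rule FTC_lebesgue_interval[OF T]) (use a in \<open>auto intro!: derivative_eq_intros continuous_intros\<close>)
  also have "?a * T = of_int m * (2 * pi)" using T by (simp add: freq_def)
  also have "sin (of_int m * (2 * pi)) = (0::real)"
    using sin_int_2pin[of m] by (simp add: mult.commute)
  finally show ?thesis using False by simp
qed

lemma integral_sin_freq:
  assumes T: "T > 0"
  shows "(LINT t|lebesgue_on {0<..<T}. sin (of_int m * freq T * t)) = 0"
proof (cases "m = 0")
  case True
  then show ?thesis by simp
next
  case False
  let ?a = "of_int m * freq T"
  have a: "?a \<noteq> 0" using False T by (simp add: freq_def)
  have "(LINT t|lebesgue_on {0<..<T}. sin (?a * t)) = - cos (?a * T) / ?a - - cos (?a * 0) / ?a"
    by (rule FTC_lebesgue_interval[OF T]) (use a in \<open>auto intro!: derivative_eq_intros continuous_intros\<close>)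
  also have "?a * T = of_int m * (2 * pi)" using T by (simp add: freq_def)
  also have "cos (of_int m * (2 * pi)) = (1::real)"
    using cos_int_2pin[of m] by (simp add: mult.commute)
  finally show ?thesis using False by simp
qed

text \<open>Both harmonics of frequency \<open>k\<close> are listed together, the sine at \<open>2 k - 1\<close> and the cosine at
  \<open>2 k\<close>; the factors normalise in \<open>L\<^sup>2(0, T)\<close>.\<close>

definition trig :: "real \<Rightarrow> nat \<Rightarrow> real \<Rightarrow> real" where
  "trig T i t = (if i = 0 then 1 / sqrt T
     else if even i then sqrt (2 / T) * cos (real (i div 2) * freq T * t)
     else sqrt (2 / T) * sin (real ((i + 1) div 2) * freq T * t))"

lemma trig_bounded_L2:
  fixes f :: "real \<Rightarrow> real"
  assumes "continuous_on UNIV f" "\<And>t. \<bar>f t\<bar> \<le> b"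
  shows "f \<in> L2 {0<..<T::real}"
  by (rule L2_bounded[where c=b])
     (use assms in \<open>auto intro!: continuous_imp_measurable_on_sets_lebesgue intro: continuous_on_subset\<close>)

lemma cos_L2: "(\<lambda>t. cos (a * t)) \<in> L2 {0<..<T::real}"
  and sin_L2: "(\<lambda>t. sin (a * t)) \<in> L2 {0<..<T::real}"
  by (rule trig_bounded_L2[where b=1]; auto intro!: continuous_intros)+

lemma const_L2: "S \<in> lmeasurable \<Longrightarrow> (\<lambda>x. c) \<in> L2 S"
  by (rule L2_bounded[where c="norm c"]) auto

lemma trig_L2: "trig T i \<in> L2 {0<..<T}"
proof -
  consider "i = 0" | "i \<noteq> 0" "even i" | "i \<noteq> 0" "odd i" by blast
  then show ?thesis
  proof cases
    case 1
    then have "trig T i = (\<lambda>t. 1 / sqrt T)" by (auto simp: trig_def)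
    then show ?thesis by (simp add: const_L2)
  next
    case 2
    then have "trig T i = (\<lambda>t. sqrt (2 / T) * cos (real (i div 2) * freq T * t))" by (auto simp: trig_def)
    then show ?thesis by (simp only: L2_mult_left[OF cos_L2])
  next
    case 3
    then have "trig T i = (\<lambda>t. sqrt (2 / T) * sin (real ((i + 1) div 2) * freq T * t))" by (auto simp: trig_def)
    then show ?thesis by (simp only: L2_mult_left[OF sin_L2])
  qed
qed

lemma integral_trig_products:
  fixes j k :: nat
  assumes T: "T > 0"
  shows "(LINT t|lebesgue_on {0<..<T}. cos (real j * freq T * t) * cos (real k * freq T * t))
      = (if j = k then if k = 0 then T else T / 2 else 0)"
    and "(LINT t|lebesgue_on {0<..<T}. sin (real j * freq T * t) * sin (real k * freq T * t))
      = (if j = k \<and> k \<noteq> 0 then T / 2 else 0)"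
    and "(LINT t|lebesgue_on {0<..<T}. sin (real j * freq T * t) * cos (real k * freq T * t)) = 0"
proof -
  let ?C = "\<lambda>m t. cos (of_int m * freq T * t)" and ?S = "\<lambda>m t. sin (of_int m * freq T * t)"
  let ?I = "{0<..<T}"
  have lm: "?I \<in> lmeasurable" by simp
  have iC: "integrable (lebesgue_on ?I) (?C m)" and iS: "integrable (lebesgue_on ?I) (?S m)" for m
    by (rule L2_integrable[OF cos_L2 lm], rule L2_integrable[OF sin_L2 lm])
  have d: "of_int (int j - int k) * freq T * t = real j * freq T * t - real k * freq T * t"
    "of_int (int j + int k) * freq T * t = real j * freq T * t + real k * freq T * t" for t
    by (simp_all add: algebra_simps)
  have lin: "(LINT t|lebesgue_on ?I. 1/2 * f t + c * g t) =
      1/2 * (LINT t|lebesgue_on ?I. f t) + c * (LINT t|lebesgue_on ?I. g t)"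
    if "integrable (lebesgue_on ?I) f" "integrable (lebesgue_on ?I) g" for f g :: "real \<Rightarrow> real" and c
    using that by simp
  have "(LINT t|lebesgue_on ?I. cos (real j * freq T * t) * cos (real k * freq T * t)) =
      (LINT t|lebesgue_on ?I. 1/2 * ?C (int j - int k) t + 1/2 * ?C (int j + int k) t)"
    unfolding d by (simp add: cos_times_cos add_divide_distrib)
  also have "\<dots> = 1/2 * (LINT t|lebesgue_on ?I. ?C (int j - int k) t) + 1/2 * (LINT t|lebesgue_on ?I. ?C (int j + int k) t)"
    by (rule lin[OF iC iC])
  also have "\<dots> = (if j = k then if k = 0 then T else T / 2 else 0)"
    unfolding integral_cos_freq[OF T] by auto
  finally show "(LINT t|lebesgue_on {0<..<T}. cos (real j * freq T * t) * cos (real k * freq T * t))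
      = (if j = k then if k = 0 then T else T / 2 else 0)" .
  have "(LINT t|lebesgue_on ?I. sin (real j * freq T * t) * sin (real k * freq T * t)) =
      (LINT t|lebesgue_on ?I. 1/2 * ?C (int j - int k) t + (-1/2) * ?C (int j + int k) t)"
    unfolding d by (simp add: sin_times_sin diff_divide_distrib)
  also have "\<dots> = 1/2 * (LINT t|lebesgue_on ?I. ?C (int j - int k) t) + (-1/2) * (LINT t|lebesgue_on ?I. ?C (int j + int k) t)"
    by (rule lin[OF iC iC])
  also have "\<dots> = (if j = k \<and> k \<noteq> 0 then T / 2 else 0)"
    unfolding integral_cos_freq[OF T] by auto
  finally show "(LINT t|lebesgue_on {0<..<T}. sin (real j * freq T * t) * sin (real k * freq T * t))
      = (if j = k \<and> k \<noteq> 0 then T / 2 else 0)" .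
  have "(LINT t|lebesgue_on ?I. sin (real j * freq T * t) * cos (real k * freq T * t)) =
      (LINT t|lebesgue_on ?I. 1/2 * ?S (int j + int k) t + 1/2 * ?S (int j - int k) t)"
    unfolding d by (simp add: sin_times_cos add_divide_distrib)
  also have "\<dots> = 1/2 * (LINT t|lebesgue_on ?I. ?S (int j + int k) t) + 1/2 * (LINT t|lebesgue_on ?I. ?S (int j - int k) t)"
    by (rule lin[OF iS iS])
  also have "\<dots> = 0" unfolding integral_sin_freq[OF T] by simp
  finally show "(LINT t|lebesgue_on {0<..<T}. sin (real j * freq T * t) * cos (real k * freq T * t)) = 0" .
qed

lemma trig_0: "trig T 0 t = 1 / sqrt T"
  by (simp add: trig_def)

lemma trig_even: "k > 0 \<Longrightarrow> trig T (2 * k) t = sqrt (2 / T) * cos (real k * freq T * t)"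
  by (simp add: trig_def)

lemma trig_odd: "k > 0 \<Longrightarrow> trig T (2 * k - 1) t = sqrt (2 / T) * sin (real k * freq T * t)"
  by (simp add: trig_def)

lemma trig_cases:
  fixes i :: nat
  obtains "i = 0" | k where "k > 0" "i = 2 * k" | k where "k > 0" "i = 2 * k - 1"
proof -
  have "i = 0 \<or> (\<exists>k>0. i = 2 * k) \<or> (\<exists>k>0. i = 2 * k - 1)" by presburger
  then show ?thesis using that by blast
qed

lemma trig_orthonormal:
  assumes T: "T > 0"
  shows "orthonormal_on {0<..<T} (trig T)"
proof -
  let ?I = "\<lambda>f. (LINT t|lebesgue_on {0<..<T}. f t)"
  have c0: "?I (\<lambda>t. cos (real k * freq T * t)) = 0" if "k > 0" for k
    using integral_cos_freq[OF T, of "int k"] that by simp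
  have s0: "?I (\<lambda>t. sin (real k * freq T * t)) = 0" for k
    using integral_sin_freq[OF T, of "int k"] by simp
  have one: "?I (\<lambda>t. 1::real) = T" using integral_cos_freq[OF T, of 0] by simp
  note P = integral_trig_products[OF T]
  have P3: "?I (\<lambda>t. cos (real j * freq T * t) * sin (real k * freq T * t)) = 0" for j k
    using P(3)[of k j] by (simp add: mult.commute)
  have q: "sqrt (2 / T) * (sqrt (2 / T) * T) = 2" using T by (simp flip: mult.assoc)
  have q0: "1 / sqrt T * (1 / sqrt T * T) = 1" using T by (simp add: divide_simps)
  have sc: "?I (\<lambda>t. a * f t * (b * g t)) = a * (b * ?I (\<lambda>t. f t * g t))" for a b and f g :: "real \<Rightarrow> real"
  proof -
    have "(\<lambda>t. a * f t * (b * g t)) = (\<lambda>t. a * (b * (f t * g t)))" by (auto simp: mult_ac)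
    then show ?thesis by simp
  qed
  have sc1: "?I (\<lambda>t. a * (b * g t)) = a * (b * ?I g)" "?I (\<lambda>t. b * g t * a) = a * (b * ?I g)" 
    for a b and g :: "real \<Rightarrow> real" by simp_all
  have "?I (\<lambda>t. trig T i t * trig T j t) = (if i = j then 1 else 0)" for i j
  proof -
    show ?thesis
    proof (cases i rule: trig_cases)
      case 1
      show ?thesis
      proof (cases j rule: trig_cases)
        case 1
        have "(LINT t|lebesgue_on {0<..<T}. 1 / sqrt T * (1 / sqrt T * 1)) = 1 / sqrt T * (1 / sqrt T * T)"
          unfolding sc1 one ..
        then show ?thesis using 1 \<open>i = 0\<close> q0 by (simp add: trig_0)
      next
        case (2 l)
        then show ?thesis using \<open>i = 0\<close> by (simp only: trig_0 trig_even sc1 c0) simp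
      next
        case (3 l)
        then show ?thesis using \<open>i = 0\<close> by (simp only: trig_0 trig_odd sc1 s0) simp
      qed
    next
      case (2 k)
      show ?thesis
      proof (cases j rule: trig_cases)
        case 1
        then show ?thesis using 2 by (simp only: trig_0 trig_even sc1 c0) simp
      next
        case (2 l)
        then show ?thesis using \<open>k > 0\<close> \<open>i = 2 * k\<close> by (simp only: trig_even sc P(1)) (simp add: q)
      next
        case (3 l)
        then have "i \<noteq> j" using \<open>i = 2 * k\<close> by presburger
        then show ?thesis using 3 \<open>k > 0\<close> \<open>i = 2 * k\<close> by (simp only: trig_even trig_odd sc P3) simp
      qed
    next
      case (3 k)
      show ?thesis
      proof (cases j rule: trig_cases)
        case 1
        then show ?thesis using 3 by (simp only: trig_0 trig_odd sc1 s0) simp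
      next
        case (2 l)
        then have "i \<noteq> j" using \<open>k > 0\<close> \<open>i = 2 * k - 1\<close> by presburger
        then show ?thesis using 2 \<open>k > 0\<close> \<open>i = 2 * k - 1\<close> by (simp only: trig_even trig_odd sc P(3)) simp
      next
        case (3 l)
        have "2 * k - 1 = 2 * l - 1 \<longleftrightarrow> k = l" using 3 \<open>k > 0\<close> by auto
        then show ?thesis using 3 \<open>k > 0\<close> \<open>i = 2 * k - 1\<close> by (simp only: trig_odd sc P(2)) (simp add: q)
      qed
    qed
  qed
  then show ?thesis by (simp add: orthonormal_on_def trig_L2)
qed

lemma lin_span_add:
  assumes "p \<in> lin_span e" "q \<in> lin_span e" shows "(\<lambda>x. p x + q x) \<in> lin_span e"
proof -
  obtain N c where p: "p = (\<lambda>x. \<Sum>i<N. c i * e i x)" using assms(1) by (auto simp: lin_span_def)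
  obtain M d where q: "q = (\<lambda>x. \<Sum>i<M. d i * e i x)" using assms(2) by (auto simp: lin_span_def)
  let ?c = "\<lambda>i. (if i < N then c i else 0) + (if i < M then d i else 0)"
  have extend: "(\<Sum>i<K. a i * e i x) = (\<Sum>i<max N M. (if i < K then a i else 0) * e i x)"
    if "K \<le> max N M" for K a x
    by (rule sum.mono_neutral_cong_left) (use that in auto)
  have "p x + q x = (\<Sum>i<max N M. ?c i * e i x)" for x
    unfolding p q extend[of N c x, OF max.cobounded1] extend[of M d x, OF max.cobounded2]
    by (simp add: sum.distrib[symmetric] distrib_right)
  then have "(\<lambda>x. p x + q x) = (\<lambda>x. \<Sum>i<max N M. ?c i * e i x)" by (rule ext)
  then show ?thesis using lin_spanI by simp
qed

lemma lin_span_scale: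
  assumes "p \<in> lin_span e" shows "(\<lambda>x. a * p x) \<in> lin_span e"
proof -
  obtain N c where p: "p = (\<lambda>x. \<Sum>i<N. c i * e i x)" using assms(1) by (auto simp: lin_span_def)
  have "(\<lambda>x. a * p x) = (\<lambda>x. \<Sum>i<N. (a * c i) * e i x)"
    unfolding p by (simp add: sum_distrib_left mult.assoc)
  then show ?thesis using lin_spanI by simp
qed

lemma lin_span_base: "e i \<in> lin_span e"
proof -
  have "e i x = (\<Sum>j<Suc i. (if j = i then 1 else 0) * e j x)" for x
    by (simp add: if_distrib[of "\<lambda>c. c * _"] cong: if_cong)
  then have "e i = (\<lambda>x. \<Sum>j<Suc i. (if j = i then 1 else 0) * e j x)" by (rule ext)
  then show ?thesis using lin_spanI by metis
qed

lemma lin_span_sum: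
  assumes "finite I" "\<And>i. i \<in> I \<Longrightarrow> p i \<in> lin_span e" shows "(\<lambda>x. \<Sum>i\<in>I. p i x) \<in> lin_span e"
  using assms
proof (induction I rule: finite_induct)
  case empty
  have "(\<lambda>x. 0 * e 0 x) \<in> lin_span e" by (rule lin_span_scale[OF lin_span_base])
  then show ?case by simp
next
  case (insert a I)
  then show ?case using lin_span_add[of "p a" e "\<lambda>x. \<Sum>i\<in>I. p i x"] by simp
qed

lemma lin_span_mult:
  assumes e: "\<And>i j. (\<lambda>x. e i x * e j x) \<in> lin_span e" and "p \<in> lin_span e" "q \<in> lin_span e"
  shows "(\<lambda>x. p x * q x) \<in> lin_span e"
proof -
  obtain N c where p: "p = (\<lambda>x. \<Sum>i<N. c i * e i x)" using assms(2) by (auto simp: lin_span_def)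
  obtain M d where q: "q = (\<lambda>x. \<Sum>i<M. d i * e i x)" using assms(3) by (auto simp: lin_span_def)
  have "(\<lambda>x. p x * q x) = (\<lambda>x. \<Sum>i<N. \<Sum>j<M. (c i * d j) * (e i x * e j x))"
    unfolding p q sum_product by (simp add: mult_ac)
  also have "\<dots> \<in> lin_span e"
    by (intro lin_span_sum lin_span_scale e) auto
  finally show ?thesis .
qed

lemma trig_span_const: "T > 0 \<Longrightarrow> (\<lambda>t. a) \<in> lin_span (trig T)"
  using lin_span_scale[OF lin_span_base[of "trig T" 0], of "a * sqrt T"] by (simp add: trig_0)

lemma trig_span_cos: 
  assumes T: "T > 0" shows "(\<lambda>t. cos (of_int m * freq T * t)) \<in> lin_span (trig T)"
proof (cases "m = 0")
  case True then show ?thesis using trig_span_const[OF T, of 1] by simp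
next
  case False
  have "cos (of_int m * freq T * t) = cos (real (nat \<bar>m\<bar>) * freq T * t)" for t
    by (cases "m \<ge> 0") (simp_all add: abs_if)
  moreover have "(\<lambda>t. cos (real (nat \<bar>m\<bar>) * freq T * t)) \<in> lin_span (trig T)"
    using lin_span_scale[OF lin_span_base[of "trig T" "2 * nat \<bar>m\<bar>"], of "1 / sqrt (2 / T)"] False T
    by (simp add: trig_even)
  ultimately show ?thesis by simp
qed

lemma trig_span_sin: 
  assumes T: "T > 0" shows "(\<lambda>t. sin (of_int m * freq T * t)) \<in> lin_span (trig T)"
proof (cases "m = 0")
  case True then show ?thesis using trig_span_const[OF T, of 0] by simp
next
  case False
  have s: "(\<lambda>t. sin (real (nat \<bar>m\<bar>) * freq T * t)) \<in> lin_span (trig T)"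
    using lin_span_scale[OF lin_span_base[of "trig T" "2 * nat \<bar>m\<bar> - 1"], of "1 / sqrt (2 / T)"] False T
    by (simp add: trig_odd del: One_nat_def)
  have "sin (of_int m * freq T * t) = (if m \<ge> 0 then 1 else -1) * sin (real (nat \<bar>m\<bar>) * freq T * t)" for t
    by (cases "m \<ge> 0") (simp_all add: abs_if)
  then show ?thesis using lin_span_scale[OF s] by simp
qed

text \<open>The product-to-sum formulas make the trigonometric polynomials an algebra.\<close>

lemma trig_span_mult:
  assumes T: "T > 0" and "p \<in> lin_span (trig T)" "q \<in> lin_span (trig T)"
  shows "(\<lambda>t. p t * q t) \<in> lin_span (trig T)"
proof (rule lin_span_mult[OF _ assms(2,3)])
  have d: "of_int (int j - int k) * freq T * t = real j * freq T * t - real k * freq T * t"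
    "of_int (int j + int k) * freq T * t = real j * freq T * t + real k * freq T * t" for t j k
    by (simp_all add: algebra_simps)
  let ?V = "lin_span (trig T)"
  have cc: "(\<lambda>t. cos (real j * freq T * t) * cos (real k * freq T * t)) \<in> ?V" for j k
    using lin_span_add[OF lin_span_scale[OF trig_span_cos[OF T, of "int j - int k"], of "1/2"] 
        lin_span_scale[OF trig_span_cos[OF T, of "int j + int k"], of "1/2"]]
    unfolding d by (simp add: cos_times_cos add_divide_distrib)
  have ss: "(\<lambda>t. sin (real j * freq T * t) * sin (real k * freq T * t)) \<in> ?V" for j k
    using lin_span_add[OF lin_span_scale[OF trig_span_cos[OF T, of "int j - int k"], of "1/2"] 
        lin_span_scale[OF trig_span_cos[OF T, of "int j + int k"], of "-1/2"]]
    unfolding d by (simp add: sin_times_sin diff_divide_distrib)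
  have sc: "(\<lambda>t. sin (real j * freq T * t) * cos (real k * freq T * t)) \<in> ?V" for j k
    using lin_span_add[OF lin_span_scale[OF trig_span_sin[OF T, of "int j + int k"], of "1/2"] 
        lin_span_scale[OF trig_span_sin[OF T, of "int j - int k"], of "1/2"]]
    unfolding d by (simp add: sin_times_cos add_divide_distrib)
  have pr: "(\<lambda>t. (a * f t) * (b * g t)) \<in> ?V" if "(\<lambda>t. f t * g t) \<in> ?V" for a b f g
    using lin_span_scale[OF that, of "a * b"] by (simp add: mult_ac)
  have form: "\<exists>a k. trig T i = (\<lambda>t. a * cos (real k * freq T * t)) \<or> trig T i = (\<lambda>t. a * sin (real k * freq T * t))" for i
  proof (cases i rule: trig_cases)
    case 1
    then have "trig T i = (\<lambda>t. 1 / sqrt T * cos (real 0 * freq T * t))" by (auto simp: trig_0)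
    then show ?thesis by blast
  next
    case (2 k)
    then have "trig T i = (\<lambda>t. sqrt (2 / T) * cos (real k * freq T * t))" using trig_even by blast
    then show ?thesis by blast
  next
    case (3 k)
    then have "trig T i = (\<lambda>t. sqrt (2 / T) * sin (real k * freq T * t))" using trig_odd by blast
    then show ?thesis by blast
  qed
  fix i j
  obtain a k where i: "trig T i = (\<lambda>t. a * cos (real k * freq T * t)) \<or> trig T i = (\<lambda>t. a * sin (real k * freq T * t))"
    using form by blast
  obtain b l where j: "trig T j = (\<lambda>t. b * cos (real l * freq T * t)) \<or> trig T j = (\<lambda>t. b * sin (real l * freq T * t))"
    using form by blast
  have cs: "(\<lambda>t. cos (real k * freq T * t) * sin (real l * freq T * t)) \<in> ?V"
    using sc[of l k] by (simp add: mult.commute)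
  show "(\<lambda>t. trig T i t * trig T j t) \<in> ?V"
    using i j pr[OF cc] pr[OF ss] pr[OF sc] pr[OF cs] by fastforce
qed

lemma trig_span_polynomial:
  assumes T: "T > 0" and q: "real_polynomial_function q"
  shows "(\<lambda>t. q (cis (freq T * t))) \<in> lin_span (trig T)"
  using q
proof (induction q rule: real_polynomial_function.induct)
  case (linear f)
  interpret bounded_linear f by fact
  have "f (cis \<theta>) = f 1 * cos \<theta> + f \<i> * sin \<theta>" for \<theta>
  proof -
    have "cis \<theta> = cos \<theta> *\<^sub>R 1 + sin \<theta> *\<^sub>R \<i>" by (simp add: complex_eq_iff)
    then have "f (cis \<theta>) = f (cos \<theta> *\<^sub>R 1 + sin \<theta> *\<^sub>R \<i>)" by simp
    then show ?thesis unfolding add scale by simp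
  qed
  then show ?case
    using lin_span_add[OF lin_span_scale[OF trig_span_cos[OF T, of 1], of "f 1"]
        lin_span_scale[OF trig_span_sin[OF T, of 1], of "f \<i>"]] by simp
next
  case (const c)
  then show ?case by (rule trig_span_const[OF T])
next
  case (add f g)
  then show ?case by (intro lin_span_add)
next
  case (mult f g)
  then show ?case by (intro trig_span_mult[OF T])
qed

text \<open>A continuous function on a period with equal end values is a continuous function on the unit
  circle, where the Stone--Weierstrass theorem supplies polynomials in \<open>cos\<close> and \<open>sin\<close>.\<close>

lemma trig_uniform_approx:
  fixes f :: "real \<Rightarrow> real"
  assumes T: "T > 0" and f: "continuous_on UNIV f" and per: "f 0 = f T" and e: "e > 0"
  shows "\<exists>p\<in>lin_span (trig T). \<forall>t\<in>{0<..<T}. \<bar>f t - p t\<bar> < e"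
proof -
  let ?p = "\<lambda>s. f (T * s)"
  have "path ?p" unfolding path_def
    by (rule continuous_on_compose2[OF f]) (auto intro!: continuous_intros)
  then have "homotopic_loops UNIV ?p ?p"
    by (simp add: homotopic_loops_refl pathfinish_def pathstart_def per)
  from homotopic_loops_imp_homotopic_circlemaps[OF this]
  have "continuous_on (sphere 0 1) (?p \<circ> (\<lambda>z. Arg2pi z / (2 * pi)))"
    using homotopic_with_imp_continuous by blast
  then obtain q where q: "real_polynomial_function q" 
    "\<And>z. z \<in> sphere 0 1 \<Longrightarrow> \<bar>(?p \<circ> (\<lambda>z. Arg2pi z / (2 * pi))) z - q z\<bar> < e"
    using Stone_Weierstrass_real_polynomial_function[of "sphere (0::complex) 1"] e by (metis compact_sphere)
  have "\<bar>f t - q (cis (freq T * t))\<bar> < e" if t: "t \<in> {0<..<T}" for t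
  proof -
    have "Arg2pi (cis (freq T * t)) = freq T * t"
      by (rule Arg2pi_unique[of 1]) (use t T in \<open>auto simp: cis_conv_exp freq_def field_simps\<close>)
    moreover have "T * (freq T * t / (2 * pi)) = t" using T by (simp add: freq_def)
    ultimately show ?thesis using q(2)[of "cis (freq T * t)"] by simp
  qed
  then show ?thesis by (intro bexI[OF _ trig_span_polynomial[OF T q(1)]] ballI)
qed

lemma lin_span_L2: "(\<And>i. e i \<in> L2 S) \<Longrightarrow> lin_span e \<subseteq> L2 S"
  unfolding lin_span_def using L2_lincomb by blast

text \<open>Test functions on the open interval vanish at both ends, hence are uniform limits of trigonometric
  polynomials, and they are dense.\<close>

theorem trig_complete:
  assumes T: "T > 0"
  shows "L2_closure {0<..<T} (lin_span (trig T)) = L2 {0<..<T}"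
proof (rule antisym)
  let ?I = "{0<..<T}"
  have lm: "?I \<in> lmeasurable" by simp
  have X: "lin_span (trig T) \<subseteq> L2 ?I" by (rule lin_span_L2[OF trig_L2])
  have "test_functions ?I \<subseteq> L2_closure ?I (lin_span (trig T))"
  proof
    fix \<phi> assume "\<phi> \<in> test_functions ?I"
    then obtain D where t: "test_function ?I \<phi> D" by (auto simp: test_functions_def)
    have \<phi>L: "\<phi> \<in> L2 ?I" by (rule test_function_L2(1)[OF t lm])
    have "closure {x. \<phi> x \<noteq> 0} \<subseteq> ?I" using t by (simp add: test_function_def)
    then have out: "\<phi> x = 0" if "x \<notin> ?I" for x 
      using that \<open>closure {x. \<phi> x \<noteq> 0} \<subseteq> ?I\<close> closure_subset[of "{x. \<phi> x \<noteq> 0}"] by blast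
    have "\<exists>p\<in>lin_span (trig T). L2_norm ?I (\<lambda>x. \<phi> x - p x) < e" if e: "e > 0" for e
    proof -
      \<comment> \<open>a uniform error \<open>d\<close> costs \<open>d sqrt T = e / 2\<close> in the norm of \<open>L\<^sup>2(0, T)\<close>\<close>
      define d where "d = e / (2 * sqrt T)"
      have d: "d > 0" using e T by (simp add: d_def)
      obtain p where p: "p \<in> lin_span (trig T)" "\<And>t. t \<in> ?I \<Longrightarrow> \<bar>\<phi> t - p t\<bar> < d"
        using trig_uniform_approx[OF T test_function_continuous[OF t] _ d] out[of 0] out[of T] by auto
      have pL: "p \<in> L2 ?I" using p(1) X by auto
      have "(L2_norm ?I (\<lambda>x. \<phi> x - p x))\<^sup>2 \<le> (LINT t|lebesgue_on ?I. d\<^sup>2)"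
        unfolding L2_norm_sq
      proof (rule integral_mono)
        show "integrable (lebesgue_on ?I) (\<lambda>x. (norm (\<phi> x - p x))\<^sup>2)"
          by (rule L2_integrable_sq[OF L2_diff[OF \<phi>L pL]])
        show "integrable (lebesgue_on ?I) (\<lambda>x. d\<^sup>2)" by (rule L2_integrable[OF const_L2[OF lm] lm])
        show "(norm (\<phi> x - p x))\<^sup>2 \<le> d\<^sup>2" if "x \<in> space (lebesgue_on ?I)" for x
          using p(2)[of x] that by (intro power_mono) auto
      qed
      also have "\<dots> = d\<^sup>2 * T" using integral_cos_freq[OF T, of 0] by simp
      also have "\<dots> = (e / 2)\<^sup>2" using T by (simp add: d_def power_divide power_mult_distrib)
      finally have "L2_norm ?I (\<lambda>x. \<phi> x - p x) \<le> e / 2"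
        by (rule power2_le_imp_le) (use e in simp)
      then have "L2_norm ?I (\<lambda>x. \<phi> x - p x) < e" using e by linarith
      then show ?thesis using p(1) by (intro bexI[of _ p])
    qed
    then show "\<phi> \<in> L2_closure ?I (lin_span (trig T))" using \<phi>L by (simp add: L2_closure_def)
  qed
  then have "L2_closure ?I (test_functions ?I) \<subseteq> L2_closure ?I (lin_span (trig T))"
    by (rule L2_closure_mono_closure[OF _ X])
  then show "L2 ?I \<subseteq> L2_closure ?I (lin_span (trig T))"
    using test_functions_dense[of ?I] by auto
qed (auto simp: L2_closure_def)

section \<open>Fourier coefficients in time\<close>

definition time_coeff :: "real \<Rightarrow> (real \<Rightarrow> real) \<Rightarrow> nat \<Rightarrow> real \<times> real" where
  "time_coeff T f k =
     (2 / T * (LINT t|lebesgue_on {0<..<T}. f t * cos (real k * freq T * t)),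
      2 / T * (LINT t|lebesgue_on {0<..<T}. f t * sin (real k * freq T * t)))"

lemma fourier_coeff_eq: "fourier_coeff T w k x = time_coeff T (\<lambda>t. w (x, t)) k"
  by (simp add: fourier_coeff_def time_coeff_def)

text \<open>Passing from the orthonormal coefficients to the usual Fourier coefficients, with the factor \<open>T / 2\<close>;
  the partial sums are taken over complete frequencies.\<close>

lemma trig_coeff_sum:
  assumes T: "T > 0"
  shows "(\<Sum>i<2 * N + 1. ortho_coeff {0<..<T} (trig T) f i * ortho_coeff {0<..<T} (trig T) g i) =
    ortho_coeff {0<..<T} (trig T) f 0 * ortho_coeff {0<..<T} (trig T) g 0
    + T / 2 * (\<Sum>k<N. time_coeff T f (Suc k) \<bullet> time_coeff T g (Suc k))"
proof (induction N)
  case 0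
  show ?case by simp
next
  case (Suc N)
  let ?a = "ortho_coeff {0<..<T} (trig T)"
  let ?C = "\<lambda>f. LINT t|lebesgue_on {0<..<T}. f t * cos (real (Suc N) * freq T * t)"
  let ?S = "\<lambda>f. LINT t|lebesgue_on {0<..<T}. f t * sin (real (Suc N) * freq T * t)"
  have e: "?a f (2 * Suc N) = sqrt (2 / T) * ?C f" for f
  proof -
    have "f t * trig T (2 * Suc N) t = sqrt (2 / T) * (f t * cos (real (Suc N) * freq T * t))" for t
      by (simp only: trig_even[OF zero_less_Suc] mult.left_commute)
    then show ?thesis by (simp only: integral_mult_right_zero)
  qed
  have o: "?a f (2 * Suc N - 1) = sqrt (2 / T) * ?S f" for f
  proof -
    have "f t * trig T (2 * Suc N - 1) t = sqrt (2 / T) * (f t * sin (real (Suc N) * freq T * t))" for t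
      by (simp only: trig_odd[OF zero_less_Suc] mult.left_commute)
    then show ?thesis by (simp only: integral_mult_right_zero)
  qed
  have "2 * Suc N + 1 = Suc (Suc (2 * N + 1))" "2 * Suc N - 1 = 2 * N + 1" "2 * Suc N = Suc (2 * N + 1)"
    by simp_all
  then have split: "(\<Sum>i<2 * Suc N + 1. ?a f i * ?a g i) =
    (\<Sum>i<2 * N + 1. ?a f i * ?a g i) + ?a f (2 * Suc N - 1) * ?a g (2 * Suc N - 1)
      + ?a f (2 * Suc N) * ?a g (2 * Suc N)"
    by (simp only: sum.lessThan_Suc)
  have q: "sqrt (2 / T) * sqrt (2 / T) = 2 / T" using T by simp
  have pr: "sqrt (2 / T) * a * (sqrt (2 / T) * b) = 2 / T * (a * b)" for a b
    using q by (simp only: mult.assoc mult.left_commute flip: mult.assoc[of "sqrt (2 / T)" "sqrt (2 / T)"])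
  have t: "T / 2 * (time_coeff T f (Suc N) \<bullet> time_coeff T g (Suc N)) = 2 / T * (?C f * ?C g) + 2 / T * (?S f * ?S g)"
    using T by (simp only: time_coeff_def inner_prod_def fst_conv snd_conv inner_real_def)
      (simp add: field_simps)
  show ?case unfolding split Suc.IH e o pr using t by (simp add: distrib_left)
qed

lemma ortho_coeff_trig_0: "ortho_coeff {0<..<T} (trig T) f 0 = (LINT t|lebesgue_on {0<..<T}. f t) / sqrt T"
  by (simp add: trig_0)

lemma time_coeff_Bessel:
  assumes T: "T > 0" and f: "f \<in> L2 {0<..<T}"
  shows "T / 2 * (\<Sum>k<N. (norm (time_coeff T f (Suc k)))\<^sup>2) \<le> (L2_norm {0<..<T} f)\<^sup>2"
proof -
  let ?a = "ortho_coeff {0<..<T} (trig T)"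
  have "?a f 0 * ?a f 0 + T / 2 * (\<Sum>k<N. time_coeff T f (Suc k) \<bullet> time_coeff T f (Suc k))
      \<le> L2_norm {0<..<T} f * L2_norm {0<..<T} f"
    using Bessel_product[OF trig_orthonormal[OF T] f f, of "2 * N + 1"] trig_coeff_sum[OF T, where N=N and f=f and g=f]
    by linarith
  moreover have "0 \<le> ?a f 0 * ?a f 0" by (rule zero_le_square)
  ultimately have "T / 2 * (\<Sum>k<N. time_coeff T f (Suc k) \<bullet> time_coeff T f (Suc k))
      \<le> L2_norm {0<..<T} f * L2_norm {0<..<T} f" by linarith
  then show ?thesis by (simp only: power2_norm_eq_inner power2_eq_square[of "L2_norm _ _"])
qed

lemma time_coeff_product_bound:
  assumes T: "T > 0" and f: "f \<in> L2 {0<..<T}" and g: "g \<in> L2 {0<..<T}"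
    and m: "(LINT t|lebesgue_on {0<..<T}. f t) = 0"
  shows "\<bar>T / 2 * (\<Sum>k<N. time_coeff T f (Suc k) \<bullet> time_coeff T g (Suc k))\<bar>
    \<le> L2_norm {0<..<T} f * L2_norm {0<..<T} g"
  using Bessel_product[OF trig_orthonormal[OF T] f g, of "2 * N + 1"]
  unfolding trig_coeff_sum[OF T] ortho_coeff_trig_0 m by simp

lemma time_coeff_Parseval:
  assumes T: "T > 0" and f: "f \<in> L2 {0<..<T}" and g: "g \<in> L2 {0<..<T}"
    and m: "(LINT t|lebesgue_on {0<..<T}. f t) = 0"
  shows "(\<lambda>N. T / 2 * (\<Sum>k<N. time_coeff T f (Suc k) \<bullet> time_coeff T g (Suc k)))
    \<longlonglongrightarrow> (LINT t|lebesgue_on {0<..<T}. f t * g t)"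
proof -
  let ?a = "ortho_coeff {0<..<T} (trig T)"
  have "(\<lambda>N. \<Sum>i<N. ?a f i * ?a g i) \<longlonglongrightarrow> (LINT t|lebesgue_on {0<..<T}. f t * g t)"
    by (rule Parseval[OF trig_orthonormal[OF T] _ g]) (use f trig_complete[OF T] in simp)
  moreover have "strict_mono (\<lambda>N::nat. 2 * N + 1)" by (rule strict_monoI) simp
  ultimately have "((\<lambda>N. \<Sum>i<N. ?a f i * ?a g i) \<circ> (\<lambda>N. 2 * N + 1)) \<longlonglongrightarrow> (LINT t|lebesgue_on {0<..<T}. f t * g t)"
    by (rule LIMSEQ_subseq_LIMSEQ)
  then show ?thesis unfolding o_def trig_coeff_sum[OF T] ortho_coeff_trig_0 m by simp
qed

section \<open>Periodic functions with a weak time derivative\<close>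

text \<open>A \<open>C\<^sup>1\<close> step from \<open>0\<close> to \<open>1\<close> on the interval \<open>[1, 2]\<close>: the integral of a hat function.\<close>

definition step :: "real \<Rightarrow> real" where
  "step s = 2 * ((max 0 (s - 1))\<^sup>2 - 2 * (max 0 (s - 3/2))\<^sup>2 + (max 0 (s - 2))\<^sup>2)"

definition step' :: "real \<Rightarrow> real" where
  "step' s = 4 * (max 0 (s - 1) - 2 * max 0 (s - 3/2) + max 0 (s - 2))"

lemma DERIV_step: "DERIV step s :> step' s"
proof -
  have d: "DERIV (\<lambda>s. (max 0 (s - a))\<^sup>2) s :> 2 * max 0 (s - a)" for a :: real
  proof -
    have "DERIV (\<lambda>s. s - a) s :> 1" by (auto intro!: derivative_eq_intros)
    from DERIV_chain2[OF DERIV_max0_power2 this] show ?thesis by simp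
  qed
  have "DERIV step s :> 2 * (2 * max 0 (s - 1) - 2 * (2 * max 0 (s - 3/2)) + 2 * max 0 (s - 2))"
    unfolding step_def[abs_def] by (intro DERIV_cmult DERIV_add DERIV_diff d)
  then show ?thesis by (simp add: step'_def algebra_simps)
qed

lemma step_le_1: "s \<le> 1 \<Longrightarrow> step s = 0"
  by (simp add: step_def max_def)

lemma step_ge_2: "s \<ge> 2 \<Longrightarrow> step s = 1"
  by (simp add: step_def max_def power2_eq_square algebra_simps)

lemma step_range: "\<bar>step s\<bar> \<le> 6"
proof -
  consider "s \<le> 1" | "1 \<le> s" "s \<le> 2" | "s \<ge> 2" by linarith
  then show ?thesis
  proof cases
    case 2
    have "(max 0 (s - 1))\<^sup>2 \<le> 1" "(max 0 (s - 3/2))\<^sup>2 \<le> 1" "(max 0 (s - 2))\<^sup>2 = 0"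
      using 2 by (auto intro!: power_le_one)
    moreover have "\<bar>2 * (a - 2 * b + c)\<bar> \<le> 6" if "0 \<le> a" "a \<le> 1" "0 \<le> b" "b \<le> 1" "c = 0" for a b c :: real
      using that by (simp add: abs_le_iff)
    ultimately show ?thesis unfolding step_def by (simp only: zero_le_power2)
  qed (auto simp: step_le_1 step_ge_2)
qed

lemma step'_range: "\<bar>step' s\<bar> \<le> 2"
  by (auto simp: step'_def max_def)

lemma step'_zero: "s \<ge> 2 \<Longrightarrow> step' s = 0"
  by (simp add: step'_def max_def)

text \<open>The product \<open>t (T - t)\<close> vanishes at both end points, so a single step function cuts off both.\<close>

definition cutoff :: "real \<Rightarrow> nat \<Rightarrow> real \<Rightarrow> real" where
  "cutoff T n t = step (real n * (t * (T - t)))"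

definition cutoff' :: "real \<Rightarrow> nat \<Rightarrow> real \<Rightarrow> real" where
  "cutoff' T n t = step' (real n * (t * (T - t))) * (real n * (T - 2 * t))"

lemma DERIV_cutoff: "DERIV (cutoff T n) t :> cutoff' T n t"
proof -
  have "DERIV (\<lambda>t. real n * (t * (T - t))) t :> real n * (T - 2 * t)"
    by (auto intro!: derivative_eq_intros simp: algebra_simps)
  from DERIV_chain2[OF DERIV_step this] show ?thesis
    by (simp add: cutoff_def[abs_def] cutoff'_def)
qed

lemma continuous_step': "continuous_on UNIV step'"
  unfolding step'_def[abs_def]
  by (intro continuous_on_mult continuous_on_add continuous_on_diff continuous_on_max
      continuous_on_const continuous_on_id)

lemma continuous_cutoff': "continuous_on UNIV (cutoff' T n)"
  unfolding cutoff'_def[abs_def]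
  by (intro continuous_intros continuous_on_compose2[OF continuous_step']) auto

lemma cutoff_support:
  assumes T: "T > 0" and "cutoff T n t \<noteq> 0"
  shows "t \<in> {0<..<T} \<and> 1 \<le> real n * (t * (T - t))"
proof -
  have 1: "real n * (t * (T - t)) \<ge> 1"
    using assms(2) step_le_1[of "real n * (t * (T - t))"] unfolding cutoff_def by linarith
  have "t * (T - t) > 0"
  proof (rule ccontr)
    assume "\<not> t * (T - t) > 0"
    then have "t * (T - t) \<le> 0" by simp
    then have "real n * (t * (T - t)) \<le> 0" using mult_nonneg_nonpos[of "real n"] by simp
    then show False using 1 by simp
  qed
  then have "0 < t \<and> t < T" using T by (auto simp: zero_less_mult_iff)
  then show ?thesis using 1 by simp
qed

text \<open>Where the derivative does not vanish, \<open>n t (T - t) < 2\<close>, and the larger of \<open>t\<close> and \<open>T - t\<close> is at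
  least \<open>T / 2\<close>.\<close>

lemma cutoff'_bound:
  assumes T: "T > 0" and n: "n > 0" and t: "t \<in> {0<..<T}" 
  shows "\<bar>cutoff' T n t\<bar> \<le> 2 * real n * T * indicator ({0<..4 / (n * T)} \<union> {T - 4 / (n * T)..<T}) t"
proof (cases "real n * (t * (T - t)) \<ge> 2")
  case True
  then show ?thesis using T by (simp add: cutoff'_def step'_zero)
next
  case False
  have "t \<in> {0<..4 / (n * T)} \<union> {T - 4 / (n * T)..<T}"
  proof (cases "t \<le> T / 2")
    case True
    have "real n * (t * (T / 2)) \<le> real n * (t * (T - t))"
      using t True by (intro mult_left_mono) auto
    then have "t \<le> 4 / (n * T)" using False n T by (simp add: field_simps)
    then show ?thesis using t by simp
  next
    case f: False
    have "real n * ((T / 2) * (T - t)) \<le> real n * (t * (T - t))"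
      using t f by (intro mult_left_mono mult_right_mono) auto
    then have "T - t \<le> 4 / (n * T)" using False n T by (simp add: field_simps)
    then show ?thesis using t by auto
  qed
  moreover have "\<bar>cutoff' T n t\<bar> \<le> 2 * (real n * T)"
    unfolding cutoff'_def abs_mult
    by (intro mult_mono step'_range) (use t in auto)
  ultimately show ?thesis by simp
qed

lemma test_function_cutoff:
  assumes T: "T > 0" and p: "\<And>t. DERIV \<psi> t :> \<psi>' t" and c: "continuous_on UNIV \<psi>'"
  shows "test_function {0<..<T} (\<lambda>t. cutoff T n t * \<psi> t) (\<lambda>t. cutoff' T n t * \<psi> t + cutoff T n t * \<psi>' t)"
proof -
  have cp: "continuous_on UNIV \<psi>" and cc: "continuous_on UNIV (cutoff T n)"
    using p DERIV_cutoff by (blast intro: DERIV_continuous_on has_field_derivative_at_within)+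
  let ?K = "{t. 1 \<le> real n * (t * (T - t))} \<inter> {0..T}"
  have sub: "{t. cutoff T n t * \<psi> t \<noteq> 0} \<subseteq> ?K"
    using cutoff_support[OF T, of n] by (auto simp: less_imp_le)
  have "closed {t. 1 \<le> real n * (t * (T - t))}" by (intro closed_Collect_le continuous_intros)
  then have K: "compact ?K" by (intro closed_Int_compact) auto
  then have cl: "closure {t. cutoff T n t * \<psi> t \<noteq> 0} \<subseteq> ?K"
    using sub by (intro closure_minimal compact_imp_closed)
  then have "compact (?K \<inter> closure {t. cutoff T n t * \<psi> t \<noteq> 0})"
    by (intro compact_Int_closed K) simp
  then have co: "compact (closure {t. cutoff T n t * \<psi> t \<noteq> 0})" using cl by (simp add: Int_absorb1)
  have "?K \<subseteq> {0<..<T}"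
  proof
    fix t assume t: "t \<in> ?K"
    then have "t \<noteq> 0" "t \<noteq> T" by auto
    then show "t \<in> {0<..<T}" using t by auto
  qed
  moreover have "DERIV (\<lambda>t. cutoff T n t * \<psi> t) t :> cutoff' T n t * \<psi> t + cutoff T n t * \<psi>' t" for t
    using DERIV_mult[OF DERIV_cutoff p] by (simp add: mult.commute add.commute)
  moreover have "continuous_on UNIV (\<lambda>t. cutoff' T n t * \<psi> t + cutoff T n t * \<psi>' t)"
    by (intro continuous_intros continuous_cutoff' cp cc c)
  ultimately show ?thesis using cl co unfolding test_function_def gderiv_deriv by blast
qed

lemma continuous_L2_interval:
  fixes f :: "real \<Rightarrow> real"
  assumes "continuous_on {0..T} f" shows "f \<in> L2 {0<..<T}"
proof -
  have "bounded (f ` {0..T})" by (intro compact_imp_bounded compact_continuous_image assms) auto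
  then obtain b where b0: "\<forall>t\<in>{0..T}. norm (f t) \<le> b" unfolding bounded_iff by auto
  then have b: "norm (f t) \<le> b" if "t \<in> {0<..<T}" for t using that by auto
  have "f \<in> borel_measurable (lebesgue_on {0<..<T})"
    by (rule continuous_imp_measurable_on_sets_lebesgue) (auto intro: continuous_on_subset[OF assms])
  from L2_bounded[OF this _ b] show ?thesis by simp
qed

lemma continuous_UNIV_L2: "continuous_on UNIV f \<Longrightarrow> (f :: real \<Rightarrow> real) \<in> L2 {0<..<T}"
  by (rule continuous_L2_interval) (rule continuous_on_subset, auto)

text \<open>The derivative of the cutoff has integral zero and bounded \<open>L\<^sup>1\<close> norm and concentrates at the
  end points, where \<open>h\<close> takes the same value \<open>h 0\<close>.\<close>

lemma cutoff'_vanishing: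
  assumes T: "T > 0" and h: "continuous_on {0..T} h" and per: "h 0 = h T"
  shows "(\<lambda>n. LINT t|lebesgue_on {0<..<T}. h t * cutoff' T n t) \<longlonglongrightarrow> 0"
proof (rule LIMSEQ_I)
  fix r :: real assume r: "r > 0"
  let ?I = "{0<..<T}"
  \<comment> \<open>the estimate below yields \<open>16 e\<close>: height \<open>2 n T\<close> on two intervals of length \<open>4 / (n T)\<close>\<close>
  define e where "e = r / 17"
  have e: "e > 0" using r by (simp add: e_def)
  have "\<exists>d>0. \<forall>t\<in>{0..T}. \<bar>t - s\<bar> < d \<longrightarrow> \<bar>h t - h s\<bar> < e" if "s \<in> {0..T}" for s
    using h that e unfolding continuous_on_iff dist_real_def by blast
  from this[of 0] this[of T] T obtain d1 d2 where d: "d1 > 0" "d2 > 0"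
    and d1: "\<And>t. t \<in> {0..T} \<Longrightarrow> \<bar>t - 0\<bar> < d1 \<Longrightarrow> \<bar>h t - h 0\<bar> < e"
    and d2: "\<And>t. t \<in> {0..T} \<Longrightarrow> \<bar>t - T\<bar> < d2 \<Longrightarrow> \<bar>h t - h T\<bar> < e" by auto
  define \<delta> where "\<delta> = min d1 d2"
  have \<delta>: "\<delta> > 0" "\<delta> \<le> d1" "\<delta> \<le> d2" using d by (simp_all add: \<delta>_def)
  define M where "M = nat \<lceil>4 / (\<delta> * T)\<rceil> + 1"
  have "norm ((LINT t|lebesgue_on ?I. h t * cutoff' T n t) - 0) < r" if "n \<ge> M" for n
  proof -
    have nM: "real n > 4 / (\<delta> * T)" and n: "n > 0"
      using that unfolding M_def by linarith+
    define a where "a = 4 / (real n * T)"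
    have "a < \<delta>" "a > 0"
      using nM n T \<delta>(1) unfolding a_def by (auto simp: field_simps)
    then have a: "a < d1" "a < d2" "a > 0" using \<delta> by auto
    let ?B = "{0<..a} \<union> {T - a..<T}"
    have Bm: "{0<..a} \<in> lmeasurable" "{T - a..<T} \<in> lmeasurable"
      by (rule bounded_set_imp_lmeasurable; simp)+
    have lm: "?I \<in> lmeasurable" by simp
    have c'L: "cutoff' T n \<in> L2 ?I"
      by (rule continuous_UNIV_L2[OF continuous_cutoff'])
    have hL: "h \<in> L2 ?I" by (rule continuous_L2_interval[OF h])
    have "(LINT t|lebesgue_on ?I. cutoff' T n t) = cutoff T n T - cutoff T n 0"
      by (rule FTC_lebesgue_interval[OF T DERIV_cutoff continuous_cutoff'])
    then have z: "(LINT t|lebesgue_on ?I. cutoff' T n t) = 0" by (simp add: cutoff_def)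
    have i1: "integrable (lebesgue_on ?I) (\<lambda>t. h t * cutoff' T n t)" by (rule L2_integrable_mult[OF hL c'L])
    have i2: "integrable (lebesgue_on ?I) (\<lambda>t. h 0 * cutoff' T n t)"
      using L2_integrable[OF c'L lm] by simp
    have "(LINT t|lebesgue_on ?I. h t * cutoff' T n t) = (LINT t|lebesgue_on ?I. h t * cutoff' T n t - h 0 * cutoff' T n t)"
      using i1 i2 z by simp
    then have "\<bar>LINT t|lebesgue_on ?I. h t * cutoff' T n t\<bar> \<le> (LINT t|lebesgue_on ?I. \<bar>h t * cutoff' T n t - h 0 * cutoff' T n t\<bar>)"
      by (simp only: integral_abs_bound)
    also have "\<dots> \<le> (LINT t|lebesgue_on ?I. e * (2 * real n * T) * indicator ?B t)"
    proof (rule integral_mono)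
      show "integrable (lebesgue_on ?I) (\<lambda>t. \<bar>h t * cutoff' T n t - h 0 * cutoff' T n t\<bar>)"
        using i1 i2 by simp
      show "integrable (lebesgue_on ?I) (\<lambda>t. e * (2 * real n * T) * indicator ?B t)"
        by (intro integrable_mult_right L2_integrable[OF indicator_L2] lm) auto
      fix t assume "t \<in> space (lebesgue_on ?I)"
      then have t: "t \<in> ?I" by simp
      have cb: "\<bar>cutoff' T n t\<bar> \<le> 2 * real n * T * indicator ?B t"
        using cutoff'_bound[OF T n t] unfolding a_def .
      show "\<bar>h t * cutoff' T n t - h 0 * cutoff' T n t\<bar> \<le> e * (2 * real n * T) * indicator ?B t"
      proof (cases "t \<in> ?B")
        case True
        then have "\<bar>t - 0\<bar> < d1 \<or> \<bar>t - T\<bar> < d2" using a t by auto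
        then have "\<bar>h t - h 0\<bar> \<le> e" using d1[of t] d2[of t] t per by auto
        then have "\<bar>h t - h 0\<bar> * \<bar>cutoff' T n t\<bar> \<le> e * (2 * real n * T * indicator ?B t)"
          using cb e by (intro mult_mono) auto
        then show ?thesis by (simp add: left_diff_distrib[symmetric] abs_mult mult.assoc)
      next
        case False
        then have "cutoff' T n t = 0" using cb by simp
        then show ?thesis using e T by simp
      qed
    qed
    also have "\<dots> = e * (2 * real n * T) * (LINT t|lebesgue_on ?I. indicator ?B t)" by simp
    also have "\<dots> \<le> e * (2 * real n * T) * (2 * a)"
    proof (rule mult_left_mono)
      have "(LINT t|lebesgue_on ?I. indicator ?B t :: real) = (LINT t|lebesgue. indicator ?I t * indicator ?B t)"
        by (subst integral_restrict_space) auto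
      also have "\<dots> = measure lebesgue (?I \<inter> ?B)"
        by (simp add: indicator_inter_arith[symmetric])
      also have "\<dots> \<le> measure lebesgue ?B"
        by (rule measure_mono_fmeasurable) (use fmeasurable.Un[OF Bm] in auto)
      also have "\<dots> \<le> measure lebesgue {0<..a} + measure lebesgue {T - a..<T}"
        by (rule measure_Un_le) (use Bm in auto)
      also have "\<dots> = 2 * a" using a(3) by simp
      finally show "(LINT t|lebesgue_on ?I. indicator ?B t) \<le> 2 * a" .
    qed (use e T in auto)
    also have "\<dots> = 16 * e" using n T by (simp add: a_def)
    also have "\<dots> < r" using r by (simp add: e_def)
    finally show ?thesis by simp
  qed
  then show "\<exists>M. \<forall>n\<ge>M. norm ((LINT t|lebesgue_on ?I. h t * cutoff' T n t) - 0) < r" by blast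
qed

lemma cutoff_limit:
  assumes T: "T > 0" and t: "t \<in> {0<..<T}"
  shows "(\<lambda>n. cutoff T n t) \<longlonglongrightarrow> 1"
proof (rule tendsto_eventually)
  have p: "t * (T - t) > 0" using t by simp
  have "cutoff T n t = 1" if "n \<ge> nat \<lceil>2 / (t * (T - t))\<rceil>" for n
  proof -
    have "2 / (t * (T - t)) \<le> real n" using that by linarith
    then have "2 \<le> real n * (t * (T - t))" using p by (simp add: pos_divide_le_eq)
    then show ?thesis by (simp add: cutoff_def step_ge_2)
  qed
  then show "\<forall>\<^sub>F n in sequentially. cutoff T n t = 1" by (rule eventually_sequentiallyI)
qed

lemma cutoff_integral_limit:
  assumes T: "T > 0" and g: "integrable (lebesgue_on {0<..<T}) g"
  shows "(\<lambda>n. LINT t|lebesgue_on {0<..<T}. cutoff T n t * g t) \<longlonglongrightarrow> (LINT t|lebesgue_on {0<..<T}. g t)"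
proof (rule integral_dominated_convergence[where w="\<lambda>t. 6 * \<bar>g t\<bar>"])
  have "continuous_on UNIV (cutoff T n)" for n
    using DERIV_cutoff by (blast intro: DERIV_continuous_on has_field_derivative_at_within)
  then have "cutoff T n \<in> borel_measurable (lebesgue_on {0<..<T})" for n
    by (intro continuous_imp_measurable_on_sets_lebesgue) (auto intro: continuous_on_subset)
  then show "(\<lambda>t. cutoff T n t * g t) \<in> borel_measurable (lebesgue_on {0<..<T})" for n
    using g by (intro borel_measurable_times) auto
  show "integrable (lebesgue_on {0<..<T}) (\<lambda>t. 6 * \<bar>g t\<bar>)" using g by simp
  show "AE t in lebesgue_on {0<..<T}. (\<lambda>n. cutoff T n t * g t) \<longlonglongrightarrow> g t"
  proof (rule AE_I2)
    fix t assume "t \<in> space (lebesgue_on {0<..<T})"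
    then have "(\<lambda>n. cutoff T n t * g t) \<longlonglongrightarrow> 1 * g t"
      by (intro tendsto_mult cutoff_limit[OF T] tendsto_const) simp
    then show "(\<lambda>n. cutoff T n t * g t) \<longlonglongrightarrow> g t" by simp
  qed
  show "AE t in lebesgue_on {0<..<T}. norm (cutoff T n t * g t) \<le> 6 * \<bar>g t\<bar>" for n
    by (intro AE_I2) (auto simp: abs_mult cutoff_def intro!: mult_right_mono step_range)
qed (use g in auto)

text \<open>The products of \<open>\<psi>\<close> with the cutoffs are test functions. In the limit the terms with the derivative
  of the cutoff are boundary values of \<open>f \<psi>\<close>, which cancel by periodicity.\<close>

theorem periodic_integration_by_parts:
  fixes w d :: "real \<Rightarrow> real"
  assumes T: "T > 0" and wd: "has_weak_grad {0<..<T} w d"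
    and f: "continuous_on {0..T} f" and wf: "AE t in lebesgue_on {0<..<T}. w t = f t" and fT: "f 0 = f T"
    and p: "\<And>t. DERIV \<psi> t :> \<psi>' t" and c: "continuous_on UNIV \<psi>'" and pT: "\<psi> 0 = \<psi> T"
  shows "(LINT t|lebesgue_on {0<..<T}. d t * \<psi> t) = - (LINT t|lebesgue_on {0<..<T}. w t * \<psi>' t)"
proof -
  let ?I = "{0<..<T}"
  have cp: "continuous_on UNIV \<psi>"
    using p by (blast intro: DERIV_continuous_on has_field_derivative_at_within)
  have wL: "w \<in> L2 ?I" and dL: "d \<in> L2 ?I" using wd by (auto simp: has_weak_grad_def)
  have pL: "\<psi> \<in> L2 ?I" and p'L: "\<psi>' \<in> L2 ?I"
    using cp c by (auto intro: continuous_UNIV_L2)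
  have fL: "f \<in> L2 ?I" by (rule continuous_L2_interval[OF f])
  have cL: "cutoff' T n \<in> L2 ?I" for n
    by (rule continuous_UNIV_L2[OF continuous_cutoff'])
  have hc: "continuous_on {0..T} (\<lambda>t. f t * \<psi> t)"
    by (intro continuous_intros f continuous_on_subset[OF cp]) simp
  have eq: "(LINT t|lebesgue_on ?I. (f t * \<psi> t) * cutoff' T n t) + (LINT t|lebesgue_on ?I. cutoff T n t * (w t * \<psi>' t))
     = - (LINT t|lebesgue_on ?I. cutoff T n t * (d t * \<psi> t))" for n
  proof -
    have t: "test_function ?I (\<lambda>t. cutoff T n t * \<psi> t) (\<lambda>t. cutoff' T n t * \<psi> t + cutoff T n t * \<psi>' t)"
      by (rule test_function_cutoff[OF T p c])
    have "continuous_on UNIV (cutoff T n)"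
      using DERIV_cutoff by (blast intro: DERIV_continuous_on has_field_derivative_at_within)
    then have cpL: "(\<lambda>t. cutoff T n t * \<psi>' t) \<in> L2 ?I"
      by (intro continuous_UNIV_L2 continuous_on_mult c)
    have hL: "(\<lambda>t. \<psi> t * cutoff' T n t) \<in> L2 ?I"
      by (intro continuous_UNIV_L2 continuous_on_mult cp continuous_cutoff')
    have i1: "integrable (lebesgue_on ?I) (\<lambda>t. w t * (\<psi> t * cutoff' T n t))"
      by (rule L2_integrable_mult[OF wL hL])
    have i2: "integrable (lebesgue_on ?I) (\<lambda>t. w t * (cutoff T n t * \<psi>' t))"
      by (rule L2_integrable_mult[OF wL cpL])
    have "(LINT t|lebesgue_on ?I. (f t * \<psi> t) * cutoff' T n t) = (LINT t|lebesgue_on ?I. w t * (\<psi> t * cutoff' T n t))"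
    proof (rule integral_cong_AE)
      have "integrable (lebesgue_on ?I) (\<lambda>t. f t * (\<psi> t * cutoff' T n t))"
        by (rule L2_integrable_mult[OF fL hL])
      then show "(\<lambda>t. f t * \<psi> t * cutoff' T n t) \<in> borel_measurable (lebesgue_on ?I)"
        by (auto simp: mult.assoc)
      show "(\<lambda>t. w t * (\<psi> t * cutoff' T n t)) \<in> borel_measurable (lebesgue_on ?I)" using i1 by auto
      show "AE t in lebesgue_on ?I. f t * \<psi> t * cutoff' T n t = w t * (\<psi> t * cutoff' T n t)"
        using wf by eventually_elim simp
    qed
    moreover have "(LINT t|lebesgue_on ?I. cutoff T n t * (w t * \<psi>' t)) = (LINT t|lebesgue_on ?I. w t * (cutoff T n t * \<psi>' t))"
      by (simp add: mult.left_commute)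
    ultimately have "(LINT t|lebesgue_on ?I. (f t * \<psi> t) * cutoff' T n t) + (LINT t|lebesgue_on ?I. cutoff T n t * (w t * \<psi>' t))
      = (LINT t|lebesgue_on ?I. w t * (\<psi> t * cutoff' T n t) + w t * (cutoff T n t * \<psi>' t))"
      using i1 i2 by simp
    also have "\<dots> = (LINT t|lebesgue_on ?I. w t *\<^sub>R (cutoff' T n t * \<psi> t + cutoff T n t * \<psi>' t))"
      by (simp add: distrib_left mult.commute)
    also have "\<dots> = - (LINT t|lebesgue_on ?I. (cutoff T n t * \<psi> t) *\<^sub>R d t)"
      using wd t unfolding has_weak_grad_def by blast
    finally show ?thesis by (simp add: mult_ac)
  qed
  have "(\<lambda>n. (LINT t|lebesgue_on ?I. (f t * \<psi> t) * cutoff' T n t) + (LINT t|lebesgue_on ?I. cutoff T n t * (w t * \<psi>' t)))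
     \<longlonglongrightarrow> 0 + (LINT t|lebesgue_on ?I. w t * \<psi>' t)"
    by (intro tendsto_add cutoff'_vanishing[OF T hc] cutoff_integral_limit[OF T] L2_integrable_mult[OF wL p'L])
       (simp add: fT pT)
  moreover have "(\<lambda>n. - (LINT t|lebesgue_on ?I. cutoff T n t * (d t * \<psi> t))) \<longlonglongrightarrow> - (LINT t|lebesgue_on ?I. d t * \<psi> t)"
    by (intro tendsto_minus cutoff_integral_limit[OF T] L2_integrable_mult[OF dL pL])
  ultimately have "0 + (LINT t|lebesgue_on ?I. w t * \<psi>' t) = - (LINT t|lebesgue_on ?I. d t * \<psi> t)"
    unfolding eq using LIMSEQ_unique by blast
  then show ?thesis by simp
qed

lemma time_coeff_weak_deriv:
  assumes T: "T > 0" and wd: "has_weak_grad {0<..<T} w d"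
    and f: "continuous_on {0..T} f" "AE t in lebesgue_on {0<..<T}. w t = f t" "f 0 = f T"
  shows "time_coeff T d k = (real k * freq T * snd (time_coeff T w k), - (real k * freq T * fst (time_coeff T w k)))"
    and "(LINT t|lebesgue_on {0<..<T}. d t) = 0"
proof -
  let ?a = "real k * freq T"
  note P = periodic_integration_by_parts[OF T wd f]
  have a: "?a * T = of_int (int k) * (2 * pi)" using T by (simp add: freq_def)
  have ca: "cos (?a * T) = 1" unfolding a using cos_int_2pin[of "int k"] by (simp add: mult.commute)
  have sa: "sin (?a * T) = 0" unfolding a using sin_int_2pin[of "int k"] by (simp add: mult.commute)
  have "(LINT t|lebesgue_on {0<..<T}. d t * cos (?a * t)) = - (LINT t|lebesgue_on {0<..<T}. w t * (- sin (?a * t) * ?a))"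
    by (rule P) (auto intro!: derivative_eq_intros continuous_intros simp: ca)
  also have "\<dots> = ?a * (LINT t|lebesgue_on {0<..<T}. w t * sin (?a * t))"
  proof -
    have "(\<lambda>t. w t * (- sin (?a * t) * ?a)) = (\<lambda>t. - ?a * (w t * sin (?a * t)))" by auto
    then show ?thesis by (simp only: integral_mult_right_zero) simp
  qed
  finally have 1: "(LINT t|lebesgue_on {0<..<T}. d t * cos (?a * t)) = ?a * (LINT t|lebesgue_on {0<..<T}. w t * sin (?a * t))" .
  have "(LINT t|lebesgue_on {0<..<T}. d t * sin (?a * t)) = - (LINT t|lebesgue_on {0<..<T}. w t * (cos (?a * t) * ?a))"
    by (rule P) (auto intro!: derivative_eq_intros continuous_intros simp: sa)
  also have "\<dots> = - (?a * (LINT t|lebesgue_on {0<..<T}. w t * cos (?a * t)))"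
  proof -
    have "(\<lambda>t. w t * (cos (?a * t) * ?a)) = (\<lambda>t. ?a * (w t * cos (?a * t)))" by auto
    then show ?thesis by (simp only: integral_mult_right_zero)
  qed
  finally show "time_coeff T d k = (?a * snd (time_coeff T w k), - (?a * fst (time_coeff T w k)))"
    using 1 by (simp add: time_coeff_def)
  show "(LINT t|lebesgue_on {0<..<T}. d t) = 0"
    using P[of "\<lambda>t. 1" "\<lambda>t. 0"] by simp
qed

section \<open>Sections of square-integrable functions on the cylinder\<close>

lemma open_cyl: "open \<Omega> \<Longrightarrow> open (cyl \<Omega> T)"
  unfolding cyl_def by (intro open_Times) auto

lemma cyl_lmeasurable:
  assumes "open \<Omega>" "bounded \<Omega>" shows "cyl \<Omega> T \<in> lmeasurable"
proof (rule lmeasurable_open[OF _ open_cyl[OF assms(1)]])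
  show "bounded (cyl \<Omega> T)" unfolding cyl_def using assms by (intro bounded_Times) auto
qed

lemma L2_section_time:
  fixes w :: "'a::euclidean_space \<times> real \<Rightarrow> real"
  assumes O: "open \<Omega>" "bounded \<Omega>" and w: "w \<in> L2 (cyl \<Omega> T)"
  shows "AE x in lebesgue_on \<Omega>. (\<lambda>t. w (x, t)) \<in> L2 {0<..<T}"
proof -
  have I: "open {0<..<T}" by simp
  have i1: "integrable (lebesgue_on (\<Omega> \<times> {0<..<T})) w"
    using L2_integrable[OF w cyl_lmeasurable[OF O]] by (simp add: cyl_def)
  have i2: "integrable (lebesgue_on (\<Omega> \<times> {0<..<T})) (\<lambda>z. (norm (w z))\<^sup>2)"
    using L2_integrable_sq[OF w] by (simp add: cyl_def)
  from Fubini_lebesgue_on(1)[OF O(1) I i1] Fubini_lebesgue_on(1)[OF O(1) I i2]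
  show ?thesis by eventually_elim (auto simp: L2_def)
qed

lemma L2_norm_section:
  fixes w :: "'a::euclidean_space \<times> real \<Rightarrow> 'c::euclidean_space"
  assumes O: "open \<Omega>" and w: "w \<in> L2 (cyl \<Omega> T)"
  shows "integrable (lebesgue_on \<Omega>) (\<lambda>x. (L2_norm {0<..<T} (\<lambda>t. w (x, t)))\<^sup>2)"
    and "(LINT x|lebesgue_on \<Omega>. (L2_norm {0<..<T} (\<lambda>t. w (x, t)))\<^sup>2) = (L2_norm (cyl \<Omega> T) w)\<^sup>2"
    and "integrable (lebesgue_on {0<..<T}) (\<lambda>t. (L2_norm \<Omega> (\<lambda>x. w (x, t)))\<^sup>2)"
    and "(LINT t|lebesgue_on {0<..<T}. (L2_norm \<Omega> (\<lambda>x. w (x, t)))\<^sup>2) = (L2_norm (cyl \<Omega> T) w)\<^sup>2"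
proof -
  have I: "open {0<..<T}" by simp
  have i2: "integrable (lebesgue_on (\<Omega> \<times> {0<..<T})) (\<lambda>z. (norm (w z))\<^sup>2)"
    using L2_integrable_sq[OF w] by (simp add: cyl_def)
  note F = Fubini_lebesgue_on[OF O I i2]
  show "integrable (lebesgue_on \<Omega>) (\<lambda>x. (L2_norm {0<..<T} (\<lambda>t. w (x, t)))\<^sup>2)"
    "(LINT x|lebesgue_on \<Omega>. (L2_norm {0<..<T} (\<lambda>t. w (x, t)))\<^sup>2) = (L2_norm (cyl \<Omega> T) w)\<^sup>2"
    "integrable (lebesgue_on {0<..<T}) (\<lambda>t. (L2_norm \<Omega> (\<lambda>x. w (x, t)))\<^sup>2)"
    "(LINT t|lebesgue_on {0<..<T}. (L2_norm \<Omega> (\<lambda>x. w (x, t)))\<^sup>2) = (L2_norm (cyl \<Omega> T) w)\<^sup>2"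
    using F(2,3,5,6) unfolding L2_norm_sq cyl_def by simp_all
qed

lemma AE_lebesgue_fst:
  assumes "AE x in lebesgue. P x"
  shows "AE z in lebesgue. P (fst z)"
proof -
  have "AE x in lborel. P x" using assms by (simp add: AE_completion_iff)
  then obtain N where N: "N \<in> null_sets lborel" "{x \<in> space lborel. \<not> P x} \<subseteq> N"
    by (rule AE_E) (auto simp: null_sets_def)
  have "emeasure (lborel \<Otimes>\<^sub>M lborel) (N \<times> UNIV) = 0"
    using N(1) by (subst lborel.emeasure_pair_measure_Times) (auto simp: null_sets_def)
  then have null: "N \<times> UNIV \<in> null_sets (lborel \<Otimes>\<^sub>M lborel)"
    using N(1) by (intro null_setsI) (auto simp: null_sets_def)
  have "AE z in lborel \<Otimes>\<^sub>M lborel. P (fst z)"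
    by (rule AE_I'[OF null]) (use N(2) in auto)
  then show ?thesis unfolding lborel_prod by (simp add: AE_completion_iff)
qed

text \<open>The exceptional set of a Borel representative of \<open>\<sigma>\<close> is a null set \<open>N\<close>, and \<open>N \<times> \<real>\<close> is again null.\<close>

lemma measurable_fst_cyl:
  fixes \<sigma> :: "'a::euclidean_space \<Rightarrow> real"
  assumes O: "open \<Omega>" and s: "\<sigma> \<in> borel_measurable (lebesgue_on \<Omega>)"
  shows "(\<lambda>z. \<sigma> (fst z)) \<in> borel_measurable (lebesgue_on (cyl \<Omega> T))"
proof -
  note m = open_lebesgue_measurable[OF O]
  have s1: "(\<lambda>x. indicator \<Omega> x *\<^sub>R \<sigma> x) \<in> borel_measurable lebesgue"
    using s m by (simp add: borel_measurable_restrict_space_iff)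
  obtain g where g: "g \<in> borel_measurable lborel" and sg: "AE x in lborel. indicator \<Omega> x *\<^sub>R \<sigma> x = g x"
    using completion_ex_borel_measurable_real[OF s1] by auto
  have "AE z in lebesgue. indicator \<Omega> (fst z) *\<^sub>R \<sigma> (fst z) = g (fst z)"
    by (rule AE_lebesgue_fst) (rule AE_completion[OF sg])
  then have ae: "AE z in lebesgue. g (fst z) = indicator \<Omega> (fst z) *\<^sub>R \<sigma> (fst z)"
    by eventually_elim simp
  have "(\<lambda>z :: 'a \<times> real. g (fst z)) \<in> borel_measurable (lborel \<Otimes>\<^sub>M lborel)"
    using g by measurable
  then have "(\<lambda>z :: 'a \<times> real. g (fst z)) \<in> borel_measurable lebesgue"
    unfolding lborel_prod by (rule measurable_completion)
  from borel_measurable_AE[OF this ae]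
  have "(\<lambda>z :: 'a \<times> real. indicator \<Omega> (fst z) *\<^sub>R \<sigma> (fst z)) \<in> borel_measurable (lebesgue_on (cyl \<Omega> T))"
    by (rule measurable_restrict_space1)
  then show ?thesis
    by (rule measurable_cong[THEN iffD1, rotated]) (auto simp: cyl_def)
qed

section \<open>Fourier coefficients of functions on the cylinder\<close>

context
  fixes \<Omega> :: "'a::euclidean_space set" and T :: real
  assumes O: "open \<Omega>" "bounded \<Omega>" and T: "T > 0"
begin

lemma freq_pos: "freq T > 0"
  using T by (simp add: freq_def)

lemma time_integral_L2:
  fixes w :: "'a \<times> real \<Rightarrow> real"
  assumes w: "w \<in> L2 (cyl \<Omega> T)" and p: "continuous_on UNIV p" and b: "\<And>t. \<bar>p t\<bar> \<le> 1"
  shows "(\<lambda>x. LINT t|lebesgue_on {0<..<T}. w (x, t) * p t) \<in> L2 \<Omega>"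
proof -
  have I: "open {0<..<T}" by simp
  have Om: "\<Omega> \<in> lmeasurable" using O by (rule lmeasurable_open[rotated])
  have pm: "(\<lambda>z. p (snd z)) \<in> borel_measurable (lebesgue_on (cyl \<Omega> T))"
    by (intro continuous_imp_measurable_on_sets_lebesgue open_lebesgue_measurable open_cyl O(1)
        continuous_on_compose2[OF p]) (auto intro!: continuous_intros)
  have "(\<lambda>z. p (snd z) *\<^sub>R w z) \<in> L2 (cyl \<Omega> T)"
    by (rule L2_bounded_scaleR[OF w pm open_lebesgue_measurable[OF open_cyl[OF O(1)]] b])
  from L2_integrable[OF this cyl_lmeasurable[OF O]]
  have "integrable (lebesgue_on (\<Omega> \<times> {0<..<T})) (\<lambda>z. w z * p (snd z))"
    by (simp add: cyl_def mult.commute)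
  from Fubini_lebesgue_on(2)[OF O(1) I this]
  have m: "(\<lambda>x. LINT t|lebesgue_on {0<..<T}. w (x, t) * p t) \<in> borel_measurable (lebesgue_on \<Omega>)" by simp
  have pL: "p \<in> L2 {0<..<T}" by (rule trig_bounded_L2[OF p b])
  have "integrable (lebesgue_on \<Omega>) (\<lambda>x. (norm (LINT t|lebesgue_on {0<..<T}. w (x, t) * p t))\<^sup>2)"
  proof (rule Bochner_Integration.integrable_bound)
    show "integrable (lebesgue_on \<Omega>) (\<lambda>x. (L2_norm {0<..<T} p)\<^sup>2 * (L2_norm {0<..<T} (\<lambda>t. w (x, t)))\<^sup>2)"
      by (intro integrable_mult_right L2_norm_section(1)[OF O(1) w])
    show "(\<lambda>x. (norm (LINT t|lebesgue_on {0<..<T}. w (x, t) * p t))\<^sup>2) \<in> borel_measurable (lebesgue_on \<Omega>)"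
      using m by simp
    show "AE x in lebesgue_on \<Omega>. norm ((norm (LINT t|lebesgue_on {0<..<T}. w (x, t) * p t))\<^sup>2)
       \<le> norm ((L2_norm {0<..<T} p)\<^sup>2 * (L2_norm {0<..<T} (\<lambda>t. w (x, t)))\<^sup>2)"
      using L2_section_time[OF O w]
    proof eventually_elim
      case (elim x)
      show ?case
        using power_mono[OF L2_Cauchy_Schwarz_mult[OF elim pL], of 2]
        by (simp add: power_mult_distrib mult.commute)
    qed
  qed
  then show ?thesis using m by (simp add: L2_def)
qed

lemma L2_Pair_real:
  fixes f g :: "'a \<Rightarrow> real"
  assumes f: "f \<in> L2 \<Omega>" and g: "g \<in> L2 \<Omega>" shows "(\<lambda>x. (f x, g x)) \<in> L2 \<Omega>"
proof -
  have "(norm (f x, g x))\<^sup>2 = (norm (f x))\<^sup>2 + (norm (g x))\<^sup>2" for x by (simp add: norm_Pair)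
  then have "integrable (lebesgue_on \<Omega>) (\<lambda>x. (norm (f x, g x))\<^sup>2)"
    using L2_integrable_sq[OF f] L2_integrable_sq[OF g] by simp
  then show ?thesis
    using borel_measurable_Pair[OF L2_measurable[OF f] L2_measurable[OF g]] by (simp add: L2_def)
qed

lemma fourier_coeff_L2:
  assumes w: "w \<in> L2 (cyl \<Omega> T)" shows "fourier_coeff T w k \<in> L2 \<Omega>"
  unfolding fourier_coeff_def[abs_def]
  by (intro L2_Pair_real L2_mult_left time_integral_L2[OF w]) (auto intro!: continuous_intros)

lemma fourier_coeff_perp_L2:
  assumes w: "w \<in> L2 (cyl \<Omega> T)" shows "fourier_coeff_perp T w k \<in> L2 \<Omega>"
  unfolding fourier_coeff_perp_def[abs_def] fourier_coeff_def fst_conv snd_conv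
  by (intro L2_Pair_real L2_mult_left L2_uminus time_integral_L2[OF w]) (auto intro!: continuous_intros)

lemma fourier_coeff_lincomb:
  assumes w: "w \<in> L2 (cyl \<Omega> T)" and w': "w' \<in> L2 (cyl \<Omega> T)"
  shows "AE x in lebesgue_on \<Omega>. fourier_coeff T (\<lambda>z. w z + c * w' z) k x = fourier_coeff T w k x + c *\<^sub>R fourier_coeff T w' k x"
  using L2_section_time[OF O w] L2_section_time[OF O w']
proof eventually_elim
  case (elim x)
  have "(LINT t|lebesgue_on {0<..<T}. (w (x, t) + c * w' (x, t)) * p t) =
     (LINT t|lebesgue_on {0<..<T}. w (x, t) * p t) + c * (LINT t|lebesgue_on {0<..<T}. w' (x, t) * p t)"
    if p: "p \<in> L2 {0<..<T}" for p
    using L2_integrable_mult[OF elim(1) p] L2_integrable_mult[OF elim(2) p]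
    by (simp add: distrib_right mult.assoc)
  from this[OF cos_L2[of "real k * freq T"]] this[OF sin_L2[of "real k * freq T"]]
  show ?case by (simp add: fourier_coeff_def algebra_simps)
qed

section \<open>The bilinear form of the half derivative\<close>

context
  fixes \<sigma> :: "'a \<Rightarrow> real" and s :: real
  assumes \<sigma>m: "\<sigma> \<in> borel_measurable (lebesgue_on \<Omega>)" and \<sigma>b: "\<And>x. x \<in> \<Omega> \<Longrightarrow> \<bar>\<sigma> x\<bar> \<le> s"
begin

lemma weight_L2: "f \<in> L2 \<Omega> \<Longrightarrow> (\<lambda>x. \<sigma> x *\<^sub>R f x) \<in> L2 \<Omega>"
  by (rule L2_bounded_scaleR[OF _ \<sigma>m open_lebesgue_measurable[OF O(1)] \<sigma>b])

lemma weighted_inner_bound: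
  assumes f: "f \<in> L2 \<Omega>" and g: "g \<in> L2 \<Omega>"
  shows "\<bar>LINT x|lebesgue_on \<Omega>. (\<sigma> x *\<^sub>R f x) \<bullet> g x\<bar> \<le> \<bar>s\<bar> * ((L2_norm \<Omega> f)\<^sup>2 + (L2_norm \<Omega> g)\<^sup>2)"
proof -
  have "\<bar>LINT x|lebesgue_on \<Omega>. (\<sigma> x *\<^sub>R f x) \<bullet> g x\<bar> \<le> (LINT x|lebesgue_on \<Omega>. \<bar>(\<sigma> x *\<^sub>R f x) \<bullet> g x\<bar>)"
    by (rule integral_abs_bound)
  also have "\<dots> \<le> (LINT x|lebesgue_on \<Omega>. \<bar>s\<bar> * ((norm (f x))\<^sup>2 + (norm (g x))\<^sup>2))"
  proof (rule integral_mono)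
    show "integrable (lebesgue_on \<Omega>) (\<lambda>x. \<bar>(\<sigma> x *\<^sub>R f x) \<bullet> g x\<bar>)"
      by (intro integrable_abs L2_integrable_inner weight_L2 f g)
    show "integrable (lebesgue_on \<Omega>) (\<lambda>x. \<bar>s\<bar> * ((norm (f x))\<^sup>2 + (norm (g x))\<^sup>2))"
      by (intro integrable_mult_right Bochner_Integration.integrable_add L2_integrable_sq f g)
    fix x assume "x \<in> space (lebesgue_on \<Omega>)"
    then have sx: "\<bar>\<sigma> x\<bar> \<le> \<bar>s\<bar>" using \<sigma>b[of x] by simp
    have "2 * (norm (f x) * norm (g x)) \<le> (norm (f x))\<^sup>2 + (norm (g x))\<^sup>2"
      using sum_squares_bound[of "norm (f x)" "norm (g x)"] by simp
    moreover have "0 \<le> norm (f x) * norm (g x)" by simp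
    moreover have "\<bar>f x \<bullet> g x\<bar> \<le> norm (f x) * norm (g x)" by (rule Cauchy_Schwarz_ineq2)
    ultimately have "\<bar>f x \<bullet> g x\<bar> \<le> (norm (f x))\<^sup>2 + (norm (g x))\<^sup>2" by linarith
    then show "\<bar>(\<sigma> x *\<^sub>R f x) \<bullet> g x\<bar> \<le> \<bar>s\<bar> * ((norm (f x))\<^sup>2 + (norm (g x))\<^sup>2)"
      using sx by (simp add: abs_mult mult_mono)
  qed
  also have "\<dots> = \<bar>s\<bar> * ((L2_norm \<Omega> f)\<^sup>2 + (L2_norm \<Omega> g)\<^sup>2)"
    using L2_integrable_sq[OF f] L2_integrable_sq[OF g] by (simp add: L2_norm_sq)
  finally show ?thesis .
qed

lemma half_form_summable:
  assumes W: "\<And>k. W k \<in> L2 \<Omega>" and Z: "\<And>k. Z k \<in> L2 \<Omega>"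
    and sW: "summable (\<lambda>k. real k * freq T * (L2_norm \<Omega> (W k))\<^sup>2)"
    and sZ: "summable (\<lambda>k. real k * freq T * (L2_norm \<Omega> (Z k))\<^sup>2)"
  shows "summable (\<lambda>k. real k * freq T * (LINT x|lebesgue_on \<Omega>. (\<sigma> x *\<^sub>R W k x) \<bullet> Z k x))"
proof (rule summable_comparison_test')
  show "summable (\<lambda>k. \<bar>s\<bar> * (real k * freq T * (L2_norm \<Omega> (W k))\<^sup>2 + real k * freq T * (L2_norm \<Omega> (Z k))\<^sup>2))"
    by (intro summable_mult summable_add sW sZ)
  fix k :: nat
  have "real k * freq T * \<bar>LINT x|lebesgue_on \<Omega>. (\<sigma> x *\<^sub>R W k x) \<bullet> Z k x\<bar>
    \<le> real k * freq T * (\<bar>s\<bar> * ((L2_norm \<Omega> (W k))\<^sup>2 + (L2_norm \<Omega> (Z k))\<^sup>2))"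
    using freq_pos by (intro mult_left_mono weighted_inner_bound W Z) simp
  then show "norm (real k * freq T * (LINT x|lebesgue_on \<Omega>. (\<sigma> x *\<^sub>R W k x) \<bullet> Z k x))
    \<le> \<bar>s\<bar> * (real k * freq T * (L2_norm \<Omega> (W k))\<^sup>2 + real k * freq T * (L2_norm \<Omega> (Z k))\<^sup>2)"
    using freq_pos by (simp add: abs_mult algebra_simps)
qed

lemma half_form_lincomb:
  assumes w: "w \<in> L2 (cyl \<Omega> T)" "half_deriv_finite \<Omega> T w"
    and w': "w' \<in> L2 (cyl \<Omega> T)" "half_deriv_finite \<Omega> T w'"
    and q: "q \<in> L2 (cyl \<Omega> T)" "half_deriv_finite \<Omega> T q"
  shows "half_form \<Omega> T \<sigma> (fourier_coeff T (\<lambda>z. w z + c * w' z)) (fourier_coeff_perp T q)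
    = half_form \<Omega> T \<sigma> (fourier_coeff T w) (fourier_coeff_perp T q)
      + c * half_form \<Omega> T \<sigma> (fourier_coeff T w') (fourier_coeff_perp T q)"
proof -
  let ?Z = "fourier_coeff_perp T q"
  have Z: "?Z k \<in> L2 \<Omega>" for k by (rule fourier_coeff_perp_L2[OF q(1)])
  have "L2_norm \<Omega> (?Z k) = L2_norm \<Omega> (fourier_coeff T q k)" for k
    by (simp add: L2_norm_def fourier_coeff_perp_def fourier_coeff_def norm_Pair add.commute)
  then have sZ: "summable (\<lambda>k. real k * freq T * (L2_norm \<Omega> (?Z k))\<^sup>2)"
    using q(2) by (simp add: half_deriv_finite_def)
  let ?I = "\<lambda>W k. LINT x|lebesgue_on \<Omega>. (\<sigma> x *\<^sub>R W k x) \<bullet> ?Z k x"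
  have S: "summable (\<lambda>k. real k * freq T * ?I (fourier_coeff T w) k)"
    if "w \<in> L2 (cyl \<Omega> T)" "half_deriv_finite \<Omega> T w" for w
    using half_form_summable[OF fourier_coeff_L2[OF that(1)] Z _ sZ] that(2) by (simp add: half_deriv_finite_def)
  have lin: "?I (fourier_coeff T (\<lambda>z. w z + c * w' z)) k = ?I (fourier_coeff T w) k + c * ?I (fourier_coeff T w') k" for k
  proof -
    have L: "fourier_coeff T (\<lambda>z. w z + c * w' z) k \<in> L2 \<Omega>"
      by (intro fourier_coeff_L2 L2_add L2_mult_left w w')
    note L1 = fourier_coeff_L2[OF w(1), of k] and L2 = fourier_coeff_L2[OF w'(1), of k]
    have i1: "integrable (lebesgue_on \<Omega>) (\<lambda>x. (\<sigma> x *\<^sub>R fourier_coeff T w k x) \<bullet> ?Z k x)"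
      and i2: "integrable (lebesgue_on \<Omega>) (\<lambda>x. (\<sigma> x *\<^sub>R fourier_coeff T w' k x) \<bullet> ?Z k x)"
      and i3: "integrable (lebesgue_on \<Omega>) (\<lambda>x. (\<sigma> x *\<^sub>R fourier_coeff T (\<lambda>z. w z + c * w' z) k x) \<bullet> ?Z k x)"
      by (intro L2_integrable_inner weight_L2 L L1 L2 Z)+
    have "?I (fourier_coeff T (\<lambda>z. w z + c * w' z)) k = 
      (LINT x|lebesgue_on \<Omega>. (\<sigma> x *\<^sub>R fourier_coeff T w k x) \<bullet> ?Z k x + c * ((\<sigma> x *\<^sub>R fourier_coeff T w' k x) \<bullet> ?Z k x))"
    proof (rule integral_cong_AE)
      show "AE x in lebesgue_on \<Omega>. (\<sigma> x *\<^sub>R fourier_coeff T (\<lambda>z. w z + c * w' z) k x) \<bullet> ?Z k x =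
         (\<sigma> x *\<^sub>R fourier_coeff T w k x) \<bullet> ?Z k x + c * ((\<sigma> x *\<^sub>R fourier_coeff T w' k x) \<bullet> ?Z k x)"
        using fourier_coeff_lincomb[OF w(1) w'(1), of c k]
        by eventually_elim (simp add: inner_add_left algebra_simps)
    qed (use i1 i2 i3 in auto)
    then show ?thesis using i1 i2 by simp
  qed
  have "(\<Sum>k. real k * freq T * ?I (fourier_coeff T (\<lambda>z. w z + c * w' z)) k)
     = (\<Sum>k. real k * freq T * ?I (fourier_coeff T w) k + c * (real k * freq T * ?I (fourier_coeff T w') k))"
    unfolding lin by (simp add: algebra_simps)
  also have "\<dots> = (\<Sum>k. real k * freq T * ?I (fourier_coeff T w) k) + c * (\<Sum>k. real k * freq T * ?I (fourier_coeff T w') k)"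
    by (simp only: suminf_add[OF S[OF w] summable_mult[OF S[OF w']], symmetric] suminf_mult[OF S[OF w']])
  finally show ?thesis unfolding half_form_def by (simp add: algebra_simps)
qed

text \<open>Rotating both coefficient vectors by a right angle preserves their inner product, and
  rotating twice changes the sign.\<close>

lemma half_form_antisym:
  assumes w: "w \<in> L2 (cyl \<Omega> T)" "half_deriv_finite \<Omega> T w"
    and q: "q \<in> L2 (cyl \<Omega> T)" "half_deriv_finite \<Omega> T q"
  shows "half_form \<Omega> T \<sigma> (fourier_coeff T w) (fourier_coeff_perp T q)
    = - half_form \<Omega> T \<sigma> (fourier_coeff T q) (fourier_coeff_perp T w)"
proof -
  let ?I = "\<lambda>w q k. LINT x|lebesgue_on \<Omega>. (\<sigma> x *\<^sub>R fourier_coeff T w k x) \<bullet> fourier_coeff_perp T q k x"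
  have "L2_norm \<Omega> (fourier_coeff_perp T w k) = L2_norm \<Omega> (fourier_coeff T w k)" for k
    by (simp add: L2_norm_def fourier_coeff_perp_def fourier_coeff_def norm_Pair add.commute)
  then have sZ: "summable (\<lambda>k. real k * freq T * (L2_norm \<Omega> (fourier_coeff_perp T w k))\<^sup>2)"
    using w(2) by (simp add: half_deriv_finite_def)
  have S: "summable (\<lambda>k. real k * freq T * ?I q w k)"
    using half_form_summable[OF fourier_coeff_L2[OF q(1)] fourier_coeff_perp_L2[OF w(1)] _ sZ] q(2)
    by (simp add: half_deriv_finite_def)
  have "?I w q k = - ?I q w k" for k
  proof -
    have "?I w q k = (LINT x|lebesgue_on \<Omega>. - ((\<sigma> x *\<^sub>R fourier_coeff T q k x) \<bullet> fourier_coeff_perp T w k x))"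
      by (intro Bochner_Integration.integral_cong refl)
         (simp add: fourier_coeff_perp_def inner_prod_def algebra_simps)
    then show ?thesis by simp
  qed
  then have "(\<Sum>k. real k * freq T * ?I w q k) = (\<Sum>k. - (real k * freq T * ?I q w k))" by simp
  also have "\<dots> = - (\<Sum>k. real k * freq T * ?I q w k)" by (rule suminf_minus[OF S])
  finally show ?thesis unfolding half_form_def by simp
qed

end

text \<open>Integration by parts against \<open>cos\<close>, \<open>sin\<close> and the constant \<open>1\<close> on almost every fibre.\<close>

lemma fourier_coeff_time_deriv:
  assumes d: "has_time_deriv \<Omega> T w d" and p: "time_periodic \<Omega> T w"
  shows "AE x in lebesgue_on \<Omega>. (LINT t|lebesgue_on {0<..<T}. d (x, t)) = 0 \<and>
    (\<forall>k. fourier_coeff T d k x = (real k * freq T * snd (fourier_coeff T w k x), - (real k * freq T * fst (fourier_coeff T w k x))))"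
proof -
  have 1: "AE x in lebesgue_on \<Omega>. has_weak_grad {0<..<T} (\<lambda>t. w (x, t)) (\<lambda>t. d (x, t))"
    using d by (simp add: has_time_deriv_def)
  have 2: "AE x in lebesgue_on \<Omega>. \<exists>f. continuous_on {0..T} f \<and> (AE t in lebesgue_on {0<..<T}. w (x, t) = f t) \<and> f 0 = f T"
    using p by (simp add: time_periodic_def)
  from 1 2 show ?thesis
  proof eventually_elim
    case (elim x)
    then obtain f where f: "continuous_on {0..T} f" "AE t in lebesgue_on {0<..<T}. w (x, t) = f t" "f 0 = f T" by blast
    show ?case
      using time_coeff_weak_deriv[OF T elim(1) f] by (simp add: fourier_coeff_eq)
  qed
qed

text \<open>The weight satisfies \<open>k \<omega> \<le> (k \<omega>)\<^sup>2 / \<omega>\<close>, and the series with weights \<open>(k \<omega>)\<^sup>2\<close> is the one of the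
  coefficients of \<open>\<partial>\<^sub>t w\<close>, which converges by Bessel's inequality on almost every fibre.\<close>

lemma H_1_1_half_deriv_finite:
  assumes d: "has_time_deriv \<Omega> T w d" and p: "time_periodic \<Omega> T w"
  shows "half_deriv_finite \<Omega> T w"
proof -
  have wL: "w \<in> L2 (cyl \<Omega> T)" and dL: "d \<in> L2 (cyl \<Omega> T)" using d by (auto simp: has_time_deriv_def)
  note om = freq_pos
  let ?D = "fourier_coeff T d" and ?W = "fourier_coeff T w"
  have isq: "integrable (lebesgue_on \<Omega>) (\<lambda>x. (norm (?D k x))\<^sup>2)" for k
    by (rule L2_integrable_sq[OF fourier_coeff_L2[OF dL]])
  have "(\<Sum>k<N. (L2_norm \<Omega> (?D (Suc k)))\<^sup>2) \<le> 2 / T * (L2_norm (cyl \<Omega> T) d)\<^sup>2" for N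
  proof -
    have "T / 2 * (\<Sum>k<N. (L2_norm \<Omega> (?D (Suc k)))\<^sup>2) = (LINT x|lebesgue_on \<Omega>. T / 2 * (\<Sum>k<N. (norm (?D (Suc k) x))\<^sup>2))"
      using isq by (simp add: L2_norm_sq)
    also have "\<dots> \<le> (LINT x|lebesgue_on \<Omega>. (L2_norm {0<..<T} (\<lambda>t. d (x, t)))\<^sup>2)"
    proof (rule integral_mono_AE)
      show "integrable (lebesgue_on \<Omega>) (\<lambda>x. T / 2 * (\<Sum>k<N. (norm (?D (Suc k) x))\<^sup>2))"
        by (intro integrable_mult_right Bochner_Integration.integrable_sum isq)
      show "integrable (lebesgue_on \<Omega>) (\<lambda>x. (L2_norm {0<..<T} (\<lambda>t. d (x, t)))\<^sup>2)"
        by (rule L2_norm_section(1)[OF O(1) dL])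
      show "AE x in lebesgue_on \<Omega>. T / 2 * (\<Sum>k<N. (norm (?D (Suc k) x))\<^sup>2) \<le> (L2_norm {0<..<T} (\<lambda>t. d (x, t)))\<^sup>2"
        using L2_section_time[OF O dL]
        by eventually_elim (unfold fourier_coeff_eq, rule time_coeff_Bessel[OF T])
    qed
    also have "\<dots> = (L2_norm (cyl \<Omega> T) d)\<^sup>2" by (rule L2_norm_section(2)[OF O(1) dL])
    finally show ?thesis using T by (simp add: field_simps)
  qed
  then have "summable (\<lambda>k. (L2_norm \<Omega> (?D (Suc k)))\<^sup>2)"
    by (intro summableI_nonneg_bounded) auto
  then have sD: "summable (\<lambda>k. 1 / freq T * (L2_norm \<Omega> (?D k))\<^sup>2)"
    by (intro summable_mult) (simp only: summable_Suc_iff[of "\<lambda>k. (L2_norm \<Omega> (?D k))\<^sup>2"])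
  have "real k * freq T * (L2_norm \<Omega> (?W k))\<^sup>2 \<le> 1 / freq T * (L2_norm \<Omega> (?D k))\<^sup>2" for k
  proof -
    have "(L2_norm \<Omega> (?D k))\<^sup>2 = (LINT x|lebesgue_on \<Omega>. (real k * freq T)\<^sup>2 * (norm (?W k x))\<^sup>2)"
      unfolding L2_norm_sq
    proof (rule integral_cong_AE)
      show "(\<lambda>x. (norm (?D k x))\<^sup>2) \<in> borel_measurable (lebesgue_on \<Omega>)" using isq by auto
      show "(\<lambda>x. (real k * freq T)\<^sup>2 * (norm (?W k x))\<^sup>2) \<in> borel_measurable (lebesgue_on \<Omega>)"
        using L2_integrable_sq[OF fourier_coeff_L2[OF wL, of k]] by auto
      show "AE x in lebesgue_on \<Omega>. (norm (?D k x))\<^sup>2 = (real k * freq T)\<^sup>2 * (norm (?W k x))\<^sup>2"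
        using fourier_coeff_time_deriv[OF d p]
      proof eventually_elim
        case (elim x)
        obtain a b where ab: "?W k x = (a, b)" by fastforce
        have "?D k x = (real k * freq T * b, - (real k * freq T * a))" using elim ab by simp
        then show ?case unfolding ab by (simp add: norm_Pair power_mult_distrib algebra_simps)
      qed
    qed
    also have "\<dots> = (real k * freq T)\<^sup>2 * (L2_norm \<Omega> (?W k))\<^sup>2" by (simp add: L2_norm_sq)
    finally have e: "1 / freq T * (L2_norm \<Omega> (?D k))\<^sup>2 = (real k)\<^sup>2 * freq T * (L2_norm \<Omega> (?W k))\<^sup>2"
      using om by (simp add: power2_eq_square)
    have "real k \<le> (real k)\<^sup>2" unfolding power2_eq_square by (cases k) auto
    then show ?thesis unfolding e using om by (intro mult_right_mono) auto
  qed
  then show ?thesis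
    unfolding half_deriv_finite_def
    by (intro summable_comparison_test'[OF sD]) (use om in simp)
qed

text \<open>The \<open>k\<close>-th term of the half form of \<open>w\<close> and \<open>q\<^sup>\<bottom>\<close> is the \<open>k\<close>-th Parseval term of
  \<open>\<partial>\<^sub>t w\<close> and \<open>q\<close>; the constant modes do not contribute because \<open>\<partial>\<^sub>t w\<close> has mean zero.\<close>

lemma half_form_time_deriv:
  fixes \<sigma> :: "'a \<Rightarrow> real"
  assumes \<sigma>m: "\<sigma> \<in> borel_measurable (lebesgue_on \<Omega>)" and \<sigma>b: "\<And>x. x \<in> \<Omega> \<Longrightarrow> \<bar>\<sigma> x\<bar> \<le> s"
    and d: "has_time_deriv \<Omega> T w d" and p: "time_periodic \<Omega> T w" and q: "q \<in> L2 (cyl \<Omega> T)"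
  shows "half_form \<Omega> T \<sigma> (fourier_coeff T w) (fourier_coeff_perp T q)
    = (LINT z|lebesgue_on (cyl \<Omega> T). \<sigma> (fst z) * d z * q z)"
proof -
  have wL: "w \<in> L2 (cyl \<Omega> T)" and dL: "d \<in> L2 (cyl \<Omega> T)" using d by (auto simp: has_time_deriv_def)
  let ?D = "fourier_coeff T d" and ?W = "fourier_coeff T w" and ?Q = "fourier_coeff T q" and ?P = "fourier_coeff_perp T q"
  let ?nd = "\<lambda>x. L2_norm {0<..<T} (\<lambda>t. d (x, t))" and ?nq = "\<lambda>x. L2_norm {0<..<T} (\<lambda>t. q (x, t))"
  note wL2 = weight_L2[OF \<sigma>m \<sigma>b]
  have iD: "integrable (lebesgue_on \<Omega>) (\<lambda>x. (\<sigma> x *\<^sub>R ?D k x) \<bullet> ?Q k x)" for k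
    by (intro L2_integrable_inner wL2 fourier_coeff_L2 dL q)
  have coeff_term: "real k * freq T * (LINT x|lebesgue_on \<Omega>. (\<sigma> x *\<^sub>R ?W k x) \<bullet> ?P k x)
      = (LINT x|lebesgue_on \<Omega>. (\<sigma> x *\<^sub>R ?D k x) \<bullet> ?Q k x)" for k
  proof -
    have iW: "integrable (lebesgue_on \<Omega>) (\<lambda>x. (\<sigma> x *\<^sub>R ?W k x) \<bullet> ?P k x)"
      by (intro L2_integrable_inner wL2 fourier_coeff_L2 fourier_coeff_perp_L2 wL q)
    have "real k * freq T * (LINT x|lebesgue_on \<Omega>. (\<sigma> x *\<^sub>R ?W k x) \<bullet> ?P k x) =
       (LINT x|lebesgue_on \<Omega>. real k * freq T * ((\<sigma> x *\<^sub>R ?W k x) \<bullet> ?P k x))"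
      by (simp only: integral_mult_right_zero)
    also have "\<dots> = (LINT x|lebesgue_on \<Omega>. (\<sigma> x *\<^sub>R ?D k x) \<bullet> ?Q k x)"
    proof (rule integral_cong_AE)
      show "(\<lambda>x. real k * freq T * ((\<sigma> x *\<^sub>R ?W k x) \<bullet> ?P k x)) \<in> borel_measurable (lebesgue_on \<Omega>)"
        using iW by auto
      show "AE x in lebesgue_on \<Omega>. real k * freq T * ((\<sigma> x *\<^sub>R ?W k x) \<bullet> ?P k x) = (\<sigma> x *\<^sub>R ?D k x) \<bullet> ?Q k x"
        using fourier_coeff_time_deriv[OF d p]
      proof eventually_elim
        case (elim x)
        obtain a b where ab: "?W k x = (a, b)" by fastforce
        obtain a' b' where ab': "?Q k x = (a', b')" by fastforce
        have D: "?D k x = (real k * freq T * b, - (real k * freq T * a))" using elim ab by simp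
        show ?case unfolding fourier_coeff_perp_def D ab ab' by (simp add: algebra_simps)
      qed
    qed (use iD in auto)
    finally show ?thesis .
  qed
  let ?F = "\<lambda>N x. \<sigma> x * (T / 2 * (\<Sum>k<N. ?D (Suc k) x \<bullet> ?Q (Suc k) x))"
  have Fint: "T / 2 * (\<Sum>k<N. (LINT x|lebesgue_on \<Omega>. (\<sigma> x *\<^sub>R ?D (Suc k) x) \<bullet> ?Q (Suc k) x)) = (LINT x|lebesgue_on \<Omega>. ?F N x)"
    and Fm: "integrable (lebesgue_on \<Omega>) (?F N)" for N
  proof -
    have eq: "?F N x = T / 2 * (\<Sum>k<N. (\<sigma> x *\<^sub>R ?D (Suc k) x) \<bullet> ?Q (Suc k) x)" for x
      by (simp add: sum_distrib_left mult_ac)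
    show "T / 2 * (\<Sum>k<N. (LINT x|lebesgue_on \<Omega>. (\<sigma> x *\<^sub>R ?D (Suc k) x) \<bullet> ?Q (Suc k) x)) = (LINT x|lebesgue_on \<Omega>. ?F N x)"
      unfolding eq using iD by (simp only: integral_mult_right_zero Bochner_Integration.integral_sum)
    show "integrable (lebesgue_on \<Omega>) (?F N)"
      unfolding eq by (intro integrable_mult_right Bochner_Integration.integrable_sum iD)
  qed
  have "integrable (lebesgue_on (cyl \<Omega> T)) (\<lambda>z. (\<sigma> (fst z) *\<^sub>R d z) \<bullet> q z)"
    by (intro L2_integrable_inner L2_bounded_scaleR[OF dL measurable_fst_cyl[OF O(1) \<sigma>m]] q
        open_lebesgue_measurable open_cyl O(1)) (auto simp: cyl_def intro: \<sigma>b)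
  then have ic: "integrable (lebesgue_on (\<Omega> \<times> {0<..<T})) (\<lambda>z. \<sigma> (fst z) * d z * q z)"
    by (simp add: cyl_def)
  have I: "open {0<..<T}" by simp
  note Fub = Fubini_lebesgue_on[OF O(1) I ic]
  have inner: "(LINT t|lebesgue_on {0<..<T}. \<sigma> x * d (x, t) * q (x, t)) = \<sigma> x * (LINT t|lebesgue_on {0<..<T}. d (x, t) * q (x, t))" for x
    by (simp only: mult.assoc integral_mult_right_zero)
  have lim: "(\<lambda>N. LINT x|lebesgue_on \<Omega>. ?F N x) \<longlonglongrightarrow> (LINT x|lebesgue_on \<Omega>. \<sigma> x * (LINT t|lebesgue_on {0<..<T}. d (x, t) * q (x, t)))"
  proof (rule integral_dominated_convergence[where w="\<lambda>x. \<bar>s\<bar> * ((?nd x)\<^sup>2 + (?nq x)\<^sup>2)"])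
    show "(\<lambda>x. \<sigma> x * (LINT t|lebesgue_on {0<..<T}. d (x, t) * q (x, t))) \<in> borel_measurable (lebesgue_on \<Omega>)"
      using Fub(2) unfolding fst_conv inner by auto
    show "?F N \<in> borel_measurable (lebesgue_on \<Omega>)" for N using Fm by auto
    show "integrable (lebesgue_on \<Omega>) (\<lambda>x. \<bar>s\<bar> * ((?nd x)\<^sup>2 + (?nq x)\<^sup>2))"
      by (intro integrable_mult_right Bochner_Integration.integrable_add L2_norm_section(1)[OF O(1)] dL q)
    have mean: "AE x in lebesgue_on \<Omega>. (LINT t|lebesgue_on {0<..<T}. d (x, t)) = 0"
      using fourier_coeff_time_deriv[OF d p] by eventually_elim simp
    show "AE x in lebesgue_on \<Omega>. (\<lambda>N. ?F N x) \<longlonglongrightarrow> \<sigma> x * (LINT t|lebesgue_on {0<..<T}. d (x, t) * q (x, t))"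
      using L2_section_time[OF O dL] L2_section_time[OF O q] mean
      by eventually_elim (unfold fourier_coeff_eq, intro tendsto_mult tendsto_const time_coeff_Parseval[OF T])
    show "AE x in lebesgue_on \<Omega>. norm (?F N x) \<le> \<bar>s\<bar> * ((?nd x)\<^sup>2 + (?nq x)\<^sup>2)" for N
      using L2_section_time[OF O dL] L2_section_time[OF O q] mean AE_space
    proof eventually_elim
      case (elim x)
      have sx: "\<bar>\<sigma> x\<bar> \<le> \<bar>s\<bar>" using \<sigma>b[of x] elim(4) by simp
      have "\<bar>T / 2 * (\<Sum>k<N. ?D (Suc k) x \<bullet> ?Q (Suc k) x)\<bar> \<le> ?nd x * ?nq x"
        unfolding fourier_coeff_eq by (rule time_coeff_product_bound[OF T elim(1,2,3)])
      moreover have "2 * (?nd x * ?nq x) \<le> (?nd x)\<^sup>2 + (?nq x)\<^sup>2"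
        using sum_squares_bound[of "?nd x" "?nq x"] by simp
      moreover have "0 \<le> ?nd x * ?nq x" by (simp add: L2_norm_nonneg)
      ultimately have "\<bar>T / 2 * (\<Sum>k<N. ?D (Suc k) x \<bullet> ?Q (Suc k) x)\<bar> \<le> (?nd x)\<^sup>2 + (?nq x)\<^sup>2" by linarith
      then show ?case unfolding real_norm_def abs_mult[of "\<sigma> x"] using sx by (intro mult_mono) auto
    qed
  qed
  have sums: "(\<lambda>k. real k * freq T * (LINT x|lebesgue_on \<Omega>. (\<sigma> x *\<^sub>R ?W k x) \<bullet> ?P k x)) sums
      (2 / T * (LINT x|lebesgue_on \<Omega>. \<sigma> x * (LINT t|lebesgue_on {0<..<T}. d (x, t) * q (x, t))))"
  proof (rule sums_Suc_imp)
    have "(\<lambda>N. 2 / T * (LINT x|lebesgue_on \<Omega>. ?F N x)) \<longlonglongrightarrow>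
       2 / T * (LINT x|lebesgue_on \<Omega>. \<sigma> x * (LINT t|lebesgue_on {0<..<T}. d (x, t) * q (x, t)))"
      by (intro tendsto_mult_left lim)
    moreover have "2 / T * (LINT x|lebesgue_on \<Omega>. ?F N x) = (\<Sum>k<N. (LINT x|lebesgue_on \<Omega>. (\<sigma> x *\<^sub>R ?D (Suc k) x) \<bullet> ?Q (Suc k) x))" for N
      unfolding Fint[symmetric] using T by simp
    ultimately show "(\<lambda>k. real (Suc k) * freq T * (LINT x|lebesgue_on \<Omega>. (\<sigma> x *\<^sub>R ?W (Suc k) x) \<bullet> ?P (Suc k) x)) sums
      (2 / T * (LINT x|lebesgue_on \<Omega>. \<sigma> x * (LINT t|lebesgue_on {0<..<T}. d (x, t) * q (x, t))))"
      unfolding sums_def coeff_term by simp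
  qed simp
  have "half_form \<Omega> T \<sigma> ?W ?P = (LINT x|lebesgue_on \<Omega>. \<sigma> x * (LINT t|lebesgue_on {0<..<T}. d (x, t) * q (x, t)))"
    unfolding half_form_def sums_unique[OF sums, symmetric] using T by simp
  also have "\<dots> = (LINT z|lebesgue_on (cyl \<Omega> T). \<sigma> (fst z) * d z * q z)"
    using Fub(3) unfolding fst_conv inner cyl_def .
  finally show ?thesis .
qed

end

section \<open>Function spaces on the cylinder\<close>

lemma L2_norm_AE_zero: "AE x in lebesgue_on S. f x = 0 \<Longrightarrow> L2_norm S f = 0"
proof -
  assume "AE x in lebesgue_on S. f x = 0"
  then have "AE x in lebesgue_on S. (norm (f x))\<^sup>2 = 0" by eventually_elim simp
  then show ?thesis by (simp add: L2_norm_def integral_eq_zero_AE)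
qed

context
  fixes \<Omega> :: "'a::euclidean_space set" and T :: real
  assumes O: "open \<Omega>" "bounded \<Omega>" and T: "T > 0"
begin

lemma domain_lmeasurable: "\<Omega> \<in> lmeasurable"
  using O by (rule lmeasurable_open[rotated])

text \<open>On almost every time slice the two gradients agree, and the norm on the cylinder is the integral of
  the norms on the slices. So every statement about the chosen gradient is one about the class.\<close>

lemma has_space_grad_unique:
  assumes g: "has_space_grad \<Omega> T w g" and h: "has_space_grad \<Omega> T w h"
  shows "AE z in lebesgue_on (cyl \<Omega> T). g z = h z"
proof -
  have gL: "g \<in> L2 (cyl \<Omega> T)" and hL: "h \<in> L2 (cyl \<Omega> T)"
    using g h by (auto simp: has_space_grad_def)
  have d: "(\<lambda>z. g z - h z) \<in> L2 (cyl \<Omega> T)" by (rule L2_diff[OF gL hL])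
  have "AE t in lebesgue_on {0<..<T}. has_weak_grad \<Omega> (\<lambda>x. w (x, t)) (\<lambda>x. g (x, t))"
    "AE t in lebesgue_on {0<..<T}. has_weak_grad \<Omega> (\<lambda>x. w (x, t)) (\<lambda>x. h (x, t))"
    using g h by (auto simp: has_space_grad_def)
  then have "AE t in lebesgue_on {0<..<T}. (L2_norm \<Omega> (\<lambda>x. g (x, t) - h (x, t)))\<^sup>2 = 0"
  proof eventually_elim
    case (elim t)
    have "AE x in lebesgue_on \<Omega>. g (x, t) - h (x, t) = 0"
      using has_weak_grad_unique[OF O elim] by eventually_elim simp
    then show ?case by (simp add: L2_norm_AE_zero)
  qed
  then have "(LINT t|lebesgue_on {0<..<T}. (L2_norm \<Omega> (\<lambda>x. g (x, t) - h (x, t)))\<^sup>2) = 0"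
    by (rule integral_eq_zero_AE)
  then have "L2_norm (cyl \<Omega> T) (\<lambda>z. g z - h z) = 0"
    unfolding L2_norm_section(4)[OF O(1) d] by simp
  from L2_norm_eq_0_AE[OF d this] show ?thesis by eventually_elim simp
qed

lemma has_space_grad_lincomb:
  assumes g: "has_space_grad \<Omega> T w g" and h: "has_space_grad \<Omega> T w' h"
  shows "has_space_grad \<Omega> T (\<lambda>z. w z + c * w' z) (\<lambda>z. g z + c *\<^sub>R h z)"
proof -
  have "AE t in lebesgue_on {0<..<T}. has_weak_grad \<Omega> (\<lambda>x. w (x, t)) (\<lambda>x. g (x, t))"
    "AE t in lebesgue_on {0<..<T}. has_weak_grad \<Omega> (\<lambda>x. w' (x, t)) (\<lambda>x. h (x, t))"
    using g h by (auto simp: has_space_grad_def)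
  then have "AE t in lebesgue_on {0<..<T}. has_weak_grad \<Omega> (\<lambda>x. w (x, t) + c * w' (x, t)) (\<lambda>x. g (x, t) + c *\<^sub>R h (x, t))"
    by eventually_elim (rule has_weak_grad_lincomb[OF domain_lmeasurable])
  then show ?thesis
    using g h by (simp add: has_space_grad_def L2_add L2_mult_left L2_scaleR)
qed

lemma H_1_half_grad: "w \<in> H_1_half \<Omega> T \<Longrightarrow> has_space_grad \<Omega> T w (grad_x \<Omega> T w)"
  unfolding grad_x_def H_1_half_def using someI_ex[of "has_space_grad \<Omega> T w"] by simp

lemma H_1_half_L2: "w \<in> H_1_half \<Omega> T \<Longrightarrow> w \<in> L2 (cyl \<Omega> T)"
  by (simp add: H_1_half_def)

lemma H_1_half_half_deriv: "w \<in> H_1_half \<Omega> T \<Longrightarrow> half_deriv_finite \<Omega> T w"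
  by (simp add: H_1_half_def)

lemma grad_x_L2: "w \<in> H_1_half \<Omega> T \<Longrightarrow> grad_x \<Omega> T w \<in> L2 (cyl \<Omega> T)"
  using H_1_half_grad by (auto simp: has_space_grad_def)

lemma half_deriv_finite_lincomb:
  assumes w: "w \<in> L2 (cyl \<Omega> T)" "half_deriv_finite \<Omega> T w"
    and w': "w' \<in> L2 (cyl \<Omega> T)" "half_deriv_finite \<Omega> T w'"
  shows "half_deriv_finite \<Omega> T (\<lambda>z. w z + c * w' z)"
  unfolding half_deriv_finite_def
proof (rule summable_comparison_test')
  let ?W = "fourier_coeff T w" and ?W' = "fourier_coeff T w'" and ?V = "fourier_coeff T (\<lambda>z. w z + c * w' z)"
  show "summable (\<lambda>k. 2 * (real k * freq T * (L2_norm \<Omega> (?W k))\<^sup>2) + 2 * c\<^sup>2 * (real k * freq T * (L2_norm \<Omega> (?W' k))\<^sup>2))"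
    using w(2) w'(2) unfolding half_deriv_finite_def by (intro summable_add summable_mult)
  fix k :: nat
  note L = fourier_coeff_L2[OF O T]
  have "L2_norm \<Omega> (?V k) = L2_norm \<Omega> (\<lambda>x. ?W k x + c *\<^sub>R ?W' k x)"
    by (intro L2_norm_cong_AE fourier_coeff_lincomb[OF O T] L L2_add L2_scaleR L2_mult_left w w')
  also have "\<dots> \<le> L2_norm \<Omega> (?W k) + \<bar>c\<bar> * L2_norm \<Omega> (?W' k)"
    using L2_norm_triangle[OF L[OF w(1)] L2_scaleR[OF L[OF w'(1)]], of k c k] by (simp add: L2_norm_scaleR)
  finally have "(L2_norm \<Omega> (?V k))\<^sup>2 \<le> (L2_norm \<Omega> (?W k) + \<bar>c\<bar> * L2_norm \<Omega> (?W' k))\<^sup>2"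
    by (intro power_mono L2_norm_nonneg)
  also have "\<dots> \<le> 2 * (L2_norm \<Omega> (?W k))\<^sup>2 + 2 * c\<^sup>2 * (L2_norm \<Omega> (?W' k))\<^sup>2"
    using sum_squares_bound[of "L2_norm \<Omega> (?W k)" "\<bar>c\<bar> * L2_norm \<Omega> (?W' k)"]
    by (simp add: power2_sum power_mult_distrib)
  finally have "real k * freq T * (L2_norm \<Omega> (?V k))\<^sup>2
     \<le> real k * freq T * (2 * (L2_norm \<Omega> (?W k))\<^sup>2 + 2 * c\<^sup>2 * (L2_norm \<Omega> (?W' k))\<^sup>2)"
    using freq_pos[OF O T] by (intro mult_left_mono) auto
  then show "norm (real k * freq T * (L2_norm \<Omega> (?V k))\<^sup>2)
     \<le> 2 * (real k * freq T * (L2_norm \<Omega> (?W k))\<^sup>2) + 2 * c\<^sup>2 * (real k * freq T * (L2_norm \<Omega> (?W' k))\<^sup>2)"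
    using freq_pos[OF O T] by (simp add: algebra_simps)
qed

lemma H_1_half_lincomb:
  assumes w: "w \<in> H_1_half \<Omega> T" and w': "w' \<in> H_1_half \<Omega> T"
  shows "(\<lambda>z. w z + c * w' z) \<in> H_1_half \<Omega> T"
proof -
  have "AE t in lebesgue_on {0<..<T}. (\<lambda>x. w (x, t)) \<in> H10 \<Omega>" "AE t in lebesgue_on {0<..<T}. (\<lambda>x. w' (x, t)) \<in> H10 \<Omega>"
    using w w' by (auto simp: H_1_half_def zero_on_lateral_boundary_def)
  then have "AE t in lebesgue_on {0<..<T}. (\<lambda>x. w (x, t) + c * w' (x, t)) \<in> H10 \<Omega>"
    by eventually_elim (rule H10_lincomb[OF domain_lmeasurable])
  then show ?thesis
    using has_space_grad_lincomb[OF H_1_half_grad[OF w] H_1_half_grad[OF w'], of c] w w'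
      half_deriv_finite_lincomb[of w w' c]
    by (auto simp: H_1_half_def zero_on_lateral_boundary_def L2_add L2_mult_left)
qed

lemma H_1_half_diff:
  assumes "w \<in> H_1_half \<Omega> T" "w' \<in> H_1_half \<Omega> T"
  shows "(\<lambda>z. w z - w' z) \<in> H_1_half \<Omega> T"
  using H_1_half_lincomb[OF assms, of "-1"] by simp

lemma H_1_1_H_1_half: "w \<in> H_1_1 \<Omega> T \<Longrightarrow> w \<in> H_1_half \<Omega> T"
  unfolding H_1_1_def H_1_half_def using H_1_1_half_deriv_finite[OF O T] by blast

lemma dt_spec: "w \<in> H_1_1 \<Omega> T \<Longrightarrow> has_time_deriv \<Omega> T w (dt \<Omega> T w)"
  unfolding dt_def H_1_1_def using someI_ex[of "has_time_deriv \<Omega> T w"] by simp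

lemma dt_L2: "w \<in> H_1_1 \<Omega> T \<Longrightarrow> dt \<Omega> T w \<in> L2 (cyl \<Omega> T)"
  using dt_spec by (auto simp: has_time_deriv_def)

lemma div_x_spec: "\<tau> \<in> H_div \<Omega> T \<Longrightarrow> has_space_div \<Omega> T \<tau> (div_x \<Omega> T \<tau>)"
  unfolding div_x_def H_div_def using someI_ex[of "has_space_div \<Omega> T \<tau>"] by simp

lemma H_div_L2: "\<tau> \<in> H_div \<Omega> T \<Longrightarrow> \<tau> \<in> L2 (cyl \<Omega> T)" "\<tau> \<in> H_div \<Omega> T \<Longrightarrow> div_x \<Omega> T \<tau> \<in> L2 (cyl \<Omega> T)"
  using div_x_spec by (auto simp: has_space_div_def)

text \<open>Zero boundary values hold on almost every time slice; there the divergence identity extends from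
  test functions, and integration in time gives the identity on the cylinder.\<close>

lemma space_divergence:
  assumes t: "\<tau> \<in> H_div \<Omega> T" and w: "w \<in> H_1_half \<Omega> T"
  shows "(LINT z|lebesgue_on (cyl \<Omega> T). \<tau> z \<bullet> grad_x \<Omega> T w z) = - (LINT z|lebesgue_on (cyl \<Omega> T). div_x \<Omega> T \<tau> z * w z)"
proof -
  let ?g = "grad_x \<Omega> T w" and ?h = "div_x \<Omega> T \<tau>"
  have I: "open {0<..<T}" by simp
  have i1: "integrable (lebesgue_on (\<Omega> \<times> {0<..<T})) (\<lambda>z. \<tau> z \<bullet> ?g z)"
    using L2_integrable_inner[OF H_div_L2(1)[OF t] grad_x_L2[OF w]] by (simp add: cyl_def)
  have i2: "integrable (lebesgue_on (\<Omega> \<times> {0<..<T})) (\<lambda>z. ?h z * w z)"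
    using L2_integrable_mult[OF H_div_L2(2)[OF t] H_1_half_L2[OF w]] by (simp add: cyl_def)
  note F1 = Fubini_lebesgue_on(5,6)[OF O(1) I i1] and F2 = Fubini_lebesgue_on(5,6)[OF O(1) I i2]
  have "AE t in lebesgue_on {0<..<T}. has_weak_div \<Omega> (\<lambda>x. \<tau> (x, t)) (\<lambda>x. ?h (x, t))"
    using div_x_spec[OF t] by (simp add: has_space_div_def)
  moreover have "AE t in lebesgue_on {0<..<T}. (\<lambda>x. w (x, t)) \<in> H10 \<Omega>"
    using w by (simp add: H_1_half_def zero_on_lateral_boundary_def)
  moreover have "AE t in lebesgue_on {0<..<T}. has_weak_grad \<Omega> (\<lambda>x. w (x, t)) (\<lambda>x. ?g (x, t))"
    using H_1_half_grad[OF w] by (simp add: has_space_grad_def)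
  ultimately have "AE t in lebesgue_on {0<..<T}.
      (LINT x|lebesgue_on \<Omega>. \<tau> (x, t) \<bullet> ?g (x, t)) = - (LINT x|lebesgue_on \<Omega>. ?h (x, t) * w (x, t))"
    by eventually_elim (rule weak_div_H10[OF O])
  then have "(LINT t|lebesgue_on {0<..<T}. LINT x|lebesgue_on \<Omega>. \<tau> (x, t) \<bullet> ?g (x, t))
      = (LINT t|lebesgue_on {0<..<T}. - (LINT x|lebesgue_on \<Omega>. ?h (x, t) * w (x, t)))"
    using F1(1) F2(1) by (intro integral_cong_AE) auto
  then show ?thesis using F1(2) F2(2) by (simp add: cyl_def)
qed

lemma Friedrichs_cyl:
  assumes C: "friedrichs_constant \<Omega> C" and w: "w \<in> H_1_half \<Omega> T"
  shows "L2_norm (cyl \<Omega> T) w \<le> C * L2_norm (cyl \<Omega> T) (grad_x \<Omega> T w)"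
proof (rule power2_le_imp_le)
  let ?g = "grad_x \<Omega> T w"
  note S = L2_norm_section(3,4)[OF O(1)]
  have Cpos: "C > 0" using C by (simp add: friedrichs_constant_def)
  have "(L2_norm (cyl \<Omega> T) w)\<^sup>2 = (LINT t|lebesgue_on {0<..<T}. (L2_norm \<Omega> (\<lambda>x. w (x, t)))\<^sup>2)"
    by (rule S(2)[OF H_1_half_L2[OF w], symmetric])
  also have "\<dots> \<le> (LINT t|lebesgue_on {0<..<T}. C\<^sup>2 * (L2_norm \<Omega> (\<lambda>x. ?g (x, t)))\<^sup>2)"
  proof (rule integral_mono_AE)
    show "integrable (lebesgue_on {0<..<T}) (\<lambda>t. (L2_norm \<Omega> (\<lambda>x. w (x, t)))\<^sup>2)"
      by (rule S(1)[OF H_1_half_L2[OF w]])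
    show "integrable (lebesgue_on {0<..<T}) (\<lambda>t. C\<^sup>2 * (L2_norm \<Omega> (\<lambda>x. ?g (x, t)))\<^sup>2)"
      by (intro integrable_mult_right S(1)[OF grad_x_L2[OF w]])
    have "AE t in lebesgue_on {0<..<T}. (\<lambda>x. w (x, t)) \<in> H10 \<Omega>"
      using w by (simp add: H_1_half_def zero_on_lateral_boundary_def)
    moreover have "AE t in lebesgue_on {0<..<T}. has_weak_grad \<Omega> (\<lambda>x. w (x, t)) (\<lambda>x. ?g (x, t))"
      using H_1_half_grad[OF w] by (simp add: has_space_grad_def)
    ultimately show "AE t in lebesgue_on {0<..<T}. (L2_norm \<Omega> (\<lambda>x. w (x, t)))\<^sup>2 \<le> C\<^sup>2 * (L2_norm \<Omega> (\<lambda>x. ?g (x, t)))\<^sup>2"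
    proof eventually_elim
      case (elim t)
      then have "L2_norm \<Omega> (\<lambda>x. w (x, t)) \<le> C * L2_norm \<Omega> (\<lambda>x. ?g (x, t))"
        using C unfolding friedrichs_constant_def by blast
      from power_mono[OF this L2_norm_nonneg, of 2] show ?case by (simp add: power_mult_distrib)
    qed
  qed
  also have "\<dots> = (C * L2_norm (cyl \<Omega> T) ?g)\<^sup>2"
    using S(2)[OF grad_x_L2[OF w]] by (simp add: power_mult_distrib)
  finally show "(L2_norm (cyl \<Omega> T) w)\<^sup>2 \<le> (C * L2_norm (cyl \<Omega> T) ?g)\<^sup>2" .
  show "0 \<le> C * L2_norm (cyl \<Omega> T) ?g" using Cpos by (simp add: L2_norm_nonneg)
qed

section \<open>The space-time bilinear form\<close>

context
  fixes \<sigma> \<nu> :: "'a \<Rightarrow> real" and s n C n0 :: real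
  assumes \<sigma>m: "\<sigma> \<in> borel_measurable (lebesgue_on \<Omega>)" and \<sigma>b: "\<And>x. x \<in> \<Omega> \<Longrightarrow> \<bar>\<sigma> x\<bar> \<le> s"
    and \<nu>m: "\<nu> \<in> borel_measurable (lebesgue_on \<Omega>)" and \<nu>b: "\<And>x. x \<in> \<Omega> \<Longrightarrow> \<bar>\<nu> x\<bar> \<le> n"
    and n0: "n0 > 0" and \<nu>l: "\<And>x. x \<in> \<Omega> \<Longrightarrow> n0 \<le> \<nu> x"
    and C: "friedrichs_constant \<Omega> C"
begin

abbreviation (input) "Q \<equiv> cyl \<Omega> T"
abbreviation (input) "ipQ f g \<equiv> (LINT z|lebesgue_on Q. f z * g z :: real)"

definition diffusion_form :: "('a \<times> real \<Rightarrow> real) \<Rightarrow> ('a \<times> real \<Rightarrow> real) \<Rightarrow> real" where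
  "diffusion_form w q = (LINT z|lebesgue_on Q. \<nu> (fst z) * (grad_x \<Omega> T w z \<bullet> grad_x \<Omega> T q z))"

definition time_form :: "('a \<times> real \<Rightarrow> real) \<Rightarrow> ('a \<times> real \<Rightarrow> real) \<Rightarrow> real" where
  "time_form w q = half_form \<Omega> T \<sigma> (fourier_coeff T w) (fourier_coeff_perp T q)"

abbreviation (input) "st_form w q \<equiv> diffusion_form w q + time_form w q"

lemma is_state_eq:
  "is_state \<Omega> T \<sigma> \<nu> v y \<longleftrightarrow> y \<in> H_1_half \<Omega> T \<and> (\<forall>q\<in>H_1_half \<Omega> T. st_form y q = ipQ v q)"
  by (simp add: is_state_def diffusion_form_def time_form_def)

lemma weight_L2_cyl:
  assumes "f \<in> L2 Q"
  shows "(\<lambda>z. \<nu> (fst z) *\<^sub>R f z) \<in> L2 Q" "(\<lambda>z. \<sigma> (fst z) *\<^sub>R f z) \<in> L2 Q"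
  by (rule L2_bounded_scaleR[OF assms measurable_fst_cyl[OF O(1) \<nu>m] open_lebesgue_measurable[OF open_cyl[OF O(1)]]];
      auto simp: cyl_def intro: \<nu>b)
     (rule L2_bounded_scaleR[OF assms measurable_fst_cyl[OF O(1) \<sigma>m] open_lebesgue_measurable[OF open_cyl[OF O(1)]]];
      auto simp: cyl_def intro: \<sigma>b)

lemma sigma_mult_L2: "(f :: _ \<Rightarrow> real) \<in> L2 Q \<Longrightarrow> (\<lambda>z. \<sigma> (fst z) * f z) \<in> L2 Q"
  using weight_L2_cyl(2)[of f] by simp

lemma diffusion_integrable:
  "f \<in> L2 Q \<Longrightarrow> g \<in> L2 Q \<Longrightarrow> integrable (lebesgue_on Q) (\<lambda>z. \<nu> (fst z) * (f z \<bullet> g z))"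
  using L2_integrable_inner[OF weight_L2_cyl(1)] by fastforce

lemma diffusion_form_sym: "diffusion_form w q = diffusion_form q w"
  unfolding diffusion_form_def by (simp add: inner_commute)

lemma grad_x_lincomb:
  assumes w: "w \<in> H_1_half \<Omega> T" and w': "w' \<in> H_1_half \<Omega> T"
  shows "AE z in lebesgue_on Q. grad_x \<Omega> T (\<lambda>z. w z + c * w' z) z = grad_x \<Omega> T w z + c *\<^sub>R grad_x \<Omega> T w' z"
  by (rule has_space_grad_unique[OF H_1_half_grad[OF H_1_half_lincomb[OF w w']]
        has_space_grad_lincomb[OF H_1_half_grad[OF w] H_1_half_grad[OF w']]])

lemma diffusion_form_lincomb:
  assumes w: "w \<in> H_1_half \<Omega> T" and w': "w' \<in> H_1_half \<Omega> T" and q: "q \<in> H_1_half \<Omega> T"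
  shows "diffusion_form (\<lambda>z. w z + c * w' z) q = diffusion_form w q + c * diffusion_form w' q"
proof -
  note i = diffusion_integrable[OF grad_x_L2 grad_x_L2]
  have "diffusion_form (\<lambda>z. w z + c * w' z) q = (LINT z|lebesgue_on Q. 
     \<nu> (fst z) * (grad_x \<Omega> T w z \<bullet> grad_x \<Omega> T q z) + c * (\<nu> (fst z) * (grad_x \<Omega> T w' z \<bullet> grad_x \<Omega> T q z)))"
    unfolding diffusion_form_def
  proof (rule integral_cong_AE)
    show "AE z in lebesgue_on Q. \<nu> (fst z) * (grad_x \<Omega> T (\<lambda>z. w z + c * w' z) z \<bullet> grad_x \<Omega> T q z) =
       \<nu> (fst z) * (grad_x \<Omega> T w z \<bullet> grad_x \<Omega> T q z) + c * (\<nu> (fst z) * (grad_x \<Omega> T w' z \<bullet> grad_x \<Omega> T q z))"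
      using grad_x_lincomb[OF w w', of c] by eventually_elim (simp add: inner_add_left algebra_simps)
  qed (use i[OF w q] i[OF w' q] i[OF H_1_half_lincomb[OF w w'] q] in auto)
  then show ?thesis using i[OF w q] i[OF w' q] by (simp add: diffusion_form_def)
qed

lemma time_form_lincomb:
  assumes w: "w \<in> H_1_half \<Omega> T" and w': "w' \<in> H_1_half \<Omega> T" and q: "q \<in> H_1_half \<Omega> T"
  shows "time_form (\<lambda>z. w z + c * w' z) q = time_form w q + c * time_form w' q"
  unfolding time_form_def
  by (rule half_form_lincomb[OF O T \<sigma>m \<sigma>b]) (use assms H_1_half_L2 H_1_half_half_deriv in auto)

lemma time_form_antisym:
  assumes w: "w \<in> H_1_half \<Omega> T" and q: "q \<in> H_1_half \<Omega> T"
  shows "time_form w q = - time_form q w"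
  unfolding time_form_def
  by (rule half_form_antisym[OF O T \<sigma>m \<sigma>b]) (use assms H_1_half_L2 H_1_half_half_deriv in auto)

lemma st_form_diff:
  assumes w: "w \<in> H_1_half \<Omega> T" and w': "w' \<in> H_1_half \<Omega> T" and q: "q \<in> H_1_half \<Omega> T"
  shows "st_form (\<lambda>z. w z - w' z) q = st_form w q - st_form w' q"
  using diffusion_form_lincomb[OF assms, of "-1"] time_form_lincomb[OF assms, of "-1"] by simp

lemma time_form_dt:
  assumes w: "w \<in> H_1_1 \<Omega> T" and q: "q \<in> L2 Q"
  shows "time_form w q = (LINT z|lebesgue_on Q. \<sigma> (fst z) * dt \<Omega> T w z * q z)"
  unfolding time_form_def
  by (rule half_form_time_deriv[OF O T \<sigma>m \<sigma>b dt_spec[OF w] _ q]) (use w in \<open>auto simp: H_1_1_def\<close>)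

lemma diffusion_coercive:
  assumes w: "w \<in> H_1_half \<Omega> T"
  shows "n0 * (L2_norm Q (grad_x \<Omega> T w))\<^sup>2 \<le> diffusion_form w w"
proof -
  have "n0 * (L2_norm Q (grad_x \<Omega> T w))\<^sup>2 = (LINT z|lebesgue_on Q. n0 * (norm (grad_x \<Omega> T w z))\<^sup>2)"
    by (simp add: L2_norm_sq)
  also have "\<dots> \<le> diffusion_form w w"
    unfolding diffusion_form_def
  proof (rule integral_mono)
    show "integrable (lebesgue_on Q) (\<lambda>z. n0 * (norm (grad_x \<Omega> T w z))\<^sup>2)"
      by (intro integrable_mult_right L2_integrable_sq grad_x_L2 w)
    show "integrable (lebesgue_on Q) (\<lambda>z. \<nu> (fst z) * (grad_x \<Omega> T w z \<bullet> grad_x \<Omega> T w z))"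
      by (intro diffusion_integrable grad_x_L2 w)
    show "n0 * (norm (grad_x \<Omega> T w z))\<^sup>2 \<le> \<nu> (fst z) * (grad_x \<Omega> T w z \<bullet> grad_x \<Omega> T w z)"
      if "z \<in> space (lebesgue_on Q)" for z
      using \<nu>l[of "fst z"] that by (auto simp: cyl_def power2_norm_eq_inner intro!: mult_right_mono)
  qed
  finally show ?thesis .
qed

lemma R1_L2:
  assumes "\<eta> \<in> H_1_1 \<Omega> T" "\<tau> \<in> H_div \<Omega> T" "v \<in> L2 Q"
  shows "R1 \<Omega> T \<sigma> \<eta> \<tau> v \<in> L2 Q"
  unfolding R1_def[abs_def] by (intro L2_diff sigma_mult_L2 dt_L2 H_div_L2 assms)

lemma R2_L2:
  assumes "\<eta> \<in> H_1_1 \<Omega> T" "\<tau> \<in> H_div \<Omega> T"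
  shows "R2 \<Omega> T \<nu> \<eta> \<tau> \<in> L2 Q"
  unfolding R2_def[abs_def]
  by (intro L2_diff weight_L2_cyl grad_x_L2 H_div_L2 H_1_1_H_1_half assms)

lemma R3_L2:
  assumes "\<zeta> \<in> H_1_1 \<Omega> T" "\<rho> \<in> H_div \<Omega> T" "\<eta> \<in> L2 Q" "yd \<in> L2 Q"
  shows "R3 \<Omega> T \<sigma> yd \<zeta> \<rho> \<eta> \<in> L2 Q"
  unfolding R3_def[abs_def] by (intro L2_diff L2_add sigma_mult_L2 dt_L2 H_div_L2 assms)

lemma R4_eq_R2: "R4 = R2"
  by (intro ext) (simp add: R4_def R2_def)

text \<open>Both residual functionals are tested in the same way: the part in \<open>L\<^sup>2\<close> is bounded through
  the Friedrichs inequality and the flux part directly by the gradient of the test function.\<close>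

lemma residual_functional_bound:
  assumes r: "r \<in> L2 Q" and p: "p \<in> L2 Q" and q: "q \<in> H_1_half \<Omega> T"
  shows "\<bar>ipQ r q\<bar> + \<bar>LINT z|lebesgue_on Q. p z \<bullet> grad_x \<Omega> T q z\<bar>
    \<le> (C * L2_norm Q r + L2_norm Q p) * L2_norm Q (grad_x \<Omega> T q)"
proof -
  have "\<bar>ipQ r q\<bar> \<le> L2_norm Q r * L2_norm Q q"
    by (rule L2_Cauchy_Schwarz_mult[OF r H_1_half_L2[OF q]])
  also have "\<dots> \<le> L2_norm Q r * (C * L2_norm Q (grad_x \<Omega> T q))"
    by (intro mult_left_mono Friedrichs_cyl[OF C q] L2_norm_nonneg)
  finally have "\<bar>ipQ r q\<bar> \<le> C * L2_norm Q r * L2_norm Q (grad_x \<Omega> T q)" by (simp add: mult_ac)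
  moreover have "\<bar>LINT z|lebesgue_on Q. p z \<bullet> grad_x \<Omega> T q z\<bar> \<le> L2_norm Q p * L2_norm Q (grad_x \<Omega> T q)"
    by (rule L2_Cauchy_Schwarz[OF p grad_x_L2[OF q]])
  ultimately show ?thesis by (simp add: distrib_right)
qed

lemma flux_pairing:
  assumes \<eta>: "\<eta> \<in> H_1_1 \<Omega> T" and \<tau>: "\<tau> \<in> H_div \<Omega> T" and q: "q \<in> H_1_half \<Omega> T"
  shows "(LINT z|lebesgue_on Q. R2 \<Omega> T \<nu> \<eta> \<tau> z \<bullet> grad_x \<Omega> T q z) = - ipQ (div_x \<Omega> T \<tau>) q - diffusion_form \<eta> q"
proof -
  have i: "integrable (lebesgue_on Q) (\<lambda>z. \<tau> z \<bullet> grad_x \<Omega> T q z)"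
    by (rule L2_integrable_inner[OF H_div_L2(1)[OF \<tau>] grad_x_L2[OF q]])
  have j: "integrable (lebesgue_on Q) (\<lambda>z. \<nu> (fst z) * (grad_x \<Omega> T \<eta> z \<bullet> grad_x \<Omega> T q z))"
    by (rule diffusion_integrable[OF grad_x_L2[OF H_1_1_H_1_half[OF \<eta>]] grad_x_L2[OF q]])
  have "(LINT z|lebesgue_on Q. R2 \<Omega> T \<nu> \<eta> \<tau> z \<bullet> grad_x \<Omega> T q z) = 
    (LINT z|lebesgue_on Q. \<tau> z \<bullet> grad_x \<Omega> T q z - \<nu> (fst z) * (grad_x \<Omega> T \<eta> z \<bullet> grad_x \<Omega> T q z))"
    by (simp add: R2_def inner_diff_left)
  also have "\<dots> = - ipQ (div_x \<Omega> T \<tau>) q - diffusion_form \<eta> q"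
    using i j space_divergence[OF \<tau> q] by (simp add: diffusion_form_def)
  finally show ?thesis .
qed

text \<open>Adding and subtracting \<open>\<tau>\<close> in the flux term splits the residual of \<open>\<eta>\<close> into the two computable
  parts \<open>R\<^sub>1\<close> and \<open>R\<^sub>2\<close>.\<close>

lemma primal_residual:
  assumes \<eta>: "\<eta> \<in> H_1_1 \<Omega> T" and \<tau>: "\<tau> \<in> H_div \<Omega> T" and v: "v \<in> L2 Q" and q: "q \<in> H_1_half \<Omega> T"
  shows "\<bar>ipQ v q - st_form \<eta> q\<bar>
    \<le> (C * L2_norm Q (R1 \<Omega> T \<sigma> \<eta> \<tau> v) + L2_norm Q (R2 \<Omega> T \<nu> \<eta> \<tau>)) * L2_norm Q (grad_x \<Omega> T q)"
proof -
  note qL = H_1_half_L2[OF q]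
  have "ipQ (R1 \<Omega> T \<sigma> \<eta> \<tau> v) q = (LINT z|lebesgue_on Q.
      \<sigma> (fst z) * dt \<Omega> T \<eta> z * q z - div_x \<Omega> T \<tau> z * q z - v z * q z)"
    by (simp add: R1_def left_diff_distrib)
  also have "\<dots> = time_form \<eta> q - ipQ (div_x \<Omega> T \<tau>) q - ipQ v q"
    using L2_integrable_mult[OF sigma_mult_L2[OF dt_L2[OF \<eta>]] qL] L2_integrable_mult[OF H_div_L2(2)[OF \<tau>] qL]
      L2_integrable_mult[OF v qL]
    by (simp add: time_form_dt[OF \<eta> qL])
  finally have "ipQ v q - st_form \<eta> q = - ipQ (R1 \<Omega> T \<sigma> \<eta> \<tau> v) q + (LINT z|lebesgue_on Q. R2 \<Omega> T \<nu> \<eta> \<tau> z \<bullet> grad_x \<Omega> T q z)"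
    unfolding flux_pairing[OF \<eta> \<tau> q] by simp
  then show ?thesis
    using residual_functional_bound[OF R1_L2[OF \<eta> \<tau> v] R2_L2[OF \<eta> \<tau>] q] by linarith
qed

text \<open>Antisymmetry of the half form moves the time derivative from \<open>q\<close> to \<open>\<zeta>\<close>, with the sign of the
  backward equation.\<close>

lemma adjoint_residual:
  assumes \<zeta>: "\<zeta> \<in> H_1_1 \<Omega> T" and \<rho>: "\<rho> \<in> H_div \<Omega> T" and \<eta>: "\<eta> \<in> L2 Q" and yd: "yd \<in> L2 Q" and q: "q \<in> H_1_half \<Omega> T"
  shows "\<bar>ipQ (\<lambda>z. \<eta> z - yd z) q - st_form q \<zeta>\<bar>
    \<le> (C * L2_norm Q (R3 \<Omega> T \<sigma> yd \<zeta> \<rho> \<eta>) + L2_norm Q (R4 \<Omega> T \<nu> \<zeta> \<rho>)) * L2_norm Q (grad_x \<Omega> T q)"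
proof -
  note qL = H_1_half_L2[OF q]
  have "ipQ (R3 \<Omega> T \<sigma> yd \<zeta> \<rho> \<eta>) q = (LINT z|lebesgue_on Q.
      (\<eta> z - yd z) * q z + div_x \<Omega> T \<rho> z * q z + \<sigma> (fst z) * dt \<Omega> T \<zeta> z * q z)"
    by (simp add: R3_def algebra_simps)
  also have "\<dots> = ipQ (\<lambda>z. \<eta> z - yd z) q + ipQ (div_x \<Omega> T \<rho>) q + time_form \<zeta> q"
    using L2_integrable_mult[OF sigma_mult_L2[OF dt_L2[OF \<zeta>]] qL] L2_integrable_mult[OF H_div_L2(2)[OF \<rho>] qL]
      L2_integrable_mult[OF L2_diff[OF \<eta> yd] qL]
    by (simp add: time_form_dt[OF \<zeta> qL])
  finally have "ipQ (\<lambda>z. \<eta> z - yd z) q - st_form q \<zeta>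
      = ipQ (R3 \<Omega> T \<sigma> yd \<zeta> \<rho> \<eta>) q + (LINT z|lebesgue_on Q. R4 \<Omega> T \<nu> \<zeta> \<rho> z \<bullet> grad_x \<Omega> T q z)"
    unfolding R4_eq_R2 flux_pairing[OF \<zeta> \<rho> q] diffusion_form_sym[of q \<zeta>]
      time_form_antisym[OF q H_1_1_H_1_half[OF \<zeta>]] by simp
  then show ?thesis
    using residual_functional_bound[OF R3_L2[OF \<zeta> \<rho> \<eta> yd] R2_L2[OF \<zeta> \<rho>] q] unfolding R4_eq_R2 by linarith
qed

text \<open>Test the equation for \<open>y - \<eta>\<close> with \<open>y - \<eta>\<close> itself: the half form vanishes on the diagonal by
  antisymmetry, and only the coercive diffusion part remains.\<close>

lemma state_error_bound:
  assumes y: "is_state \<Omega> T \<sigma> \<nu> v y" and v: "v \<in> L2 Q" and \<eta>: "\<eta> \<in> H_1_1 \<Omega> T" and \<tau>: "\<tau> \<in> H_div \<Omega> T"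
  shows "n0 * L2_norm Q (grad_x \<Omega> T (\<lambda>z. y z - \<eta> z)) \<le> C * L2_norm Q (R1 \<Omega> T \<sigma> \<eta> \<tau> v) + L2_norm Q (R2 \<Omega> T \<nu> \<eta> \<tau>)"
proof -
  let ?e = "\<lambda>z. y z - \<eta> z"
  let ?G = "L2_norm Q (grad_x \<Omega> T ?e)" and ?A = "C * L2_norm Q (R1 \<Omega> T \<sigma> \<eta> \<tau> v) + L2_norm Q (R2 \<Omega> T \<nu> \<eta> \<tau>)"
  have yH: "y \<in> H_1_half \<Omega> T" and st: "\<And>q. q \<in> H_1_half \<Omega> T \<Longrightarrow> st_form y q = ipQ v q"
    using y by (auto simp: is_state_eq)
  have eH: "?e \<in> H_1_half \<Omega> T" by (rule H_1_half_diff[OF yH H_1_1_H_1_half[OF \<eta>]])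
  have "time_form ?e ?e = 0" using time_form_antisym[OF eH eH] by simp
  then have "diffusion_form ?e ?e = ipQ v ?e - st_form \<eta> ?e"
    using st_form_diff[OF yH H_1_1_H_1_half[OF \<eta>] eH] st[OF eH] by simp
  then have "n0 * ?G\<^sup>2 \<le> ?A * ?G"
    using diffusion_coercive[OF eH] primal_residual[OF \<eta> \<tau> v eH] by linarith
  then have "(n0 * ?G) * ?G \<le> ?A * ?G" by (simp add: power2_eq_square mult.assoc)
  moreover have "0 \<le> ?A"
    using C by (auto simp: friedrichs_constant_def L2_norm_nonneg intro!: add_nonneg_nonneg mult_nonneg_nonneg)
  ultimately show ?thesis
    using L2_norm_nonneg[of Q "grad_x \<Omega> T ?e"] n0 by (cases "?G = 0") (auto simp: mult_le_cancel_right)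
qed

text \<open>Optimality speaks of one state belonging to \<open>u\<close>; uniqueness transfers it to every other one.\<close>

lemma state_unique:
  assumes y: "is_state \<Omega> T \<sigma> \<nu> v y" and y': "is_state \<Omega> T \<sigma> \<nu> v y'"
  shows "L2_norm Q (\<lambda>z. y z - y' z) = 0"
proof -
  let ?e = "\<lambda>z. y z - y' z"
  have yH: "y \<in> H_1_half \<Omega> T" "y' \<in> H_1_half \<Omega> T"
    and st: "\<And>q. q \<in> H_1_half \<Omega> T \<Longrightarrow> st_form y q = ipQ v q" "\<And>q. q \<in> H_1_half \<Omega> T \<Longrightarrow> st_form y' q = ipQ v q"
    using y y' by (auto simp: is_state_eq)
  have eH: "?e \<in> H_1_half \<Omega> T" by (rule H_1_half_diff[OF yH])
  have "time_form ?e ?e = 0" using time_form_antisym[OF eH eH] by simp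
  then have "diffusion_form ?e ?e = 0" using st_form_diff[OF yH eH] st[OF eH] by simp
  then have "n0 * (L2_norm Q (grad_x \<Omega> T ?e))\<^sup>2 \<le> 0" using diffusion_coercive[OF eH] by simp
  then have "L2_norm Q (grad_x \<Omega> T ?e) = 0" using n0 by (simp add: mult_le_0_iff)
  then show ?thesis using Friedrichs_cyl[OF C eH] L2_norm_nonneg[of Q ?e] by simp
qed

lemma is_state_lincomb:
  assumes 1: "is_state \<Omega> T \<sigma> \<nu> v y" and 2: "is_state \<Omega> T \<sigma> \<nu> v' y'"
    and v: "v \<in> L2 Q" "v' \<in> L2 Q"
  shows "is_state \<Omega> T \<sigma> \<nu> (\<lambda>z. v z + c * v' z) (\<lambda>z. y z + c * y' z)"
proof -
  have yH: "y \<in> H_1_half \<Omega> T" "y' \<in> H_1_half \<Omega> T" using 1 2 by (auto simp: is_state_eq)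
  have "st_form (\<lambda>z. y z + c * y' z) q = ipQ (\<lambda>z. v z + c * v' z) q" if q: "q \<in> H_1_half \<Omega> T" for q
  proof -
    have "st_form (\<lambda>z. y z + c * y' z) q = st_form y q + c * st_form y' q"
      using diffusion_form_lincomb[OF yH q] time_form_lincomb[OF yH q] by (simp add: algebra_simps)
    also have "\<dots> = ipQ v q + c * ipQ v' q" using 1 2 q by (simp add: is_state_eq)
    also have "\<dots> = ipQ (\<lambda>z. v z + c * v' z) q"
      using L2_integrable_mult[OF v(1) H_1_half_L2[OF q]] L2_integrable_mult[OF v(2) H_1_half_L2[OF q]]
      by (simp add: distrib_right mult.assoc)
    finally show ?thesis .
  qed
  then show ?thesis using H_1_half_lincomb[OF yH] by (simp add: is_state_eq)
qed

section \<open>Bounds for the cost functional\<close>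

lemma norm_add_scaled_sq:
  fixes f g :: "'a \<times> real \<Rightarrow> real"
  assumes "f \<in> L2 Q" "g \<in> L2 Q"
  shows "(L2_norm Q (\<lambda>z. f z + c * g z))\<^sup>2 = (L2_norm Q f)\<^sup>2 + 2 * c * ipQ f g + c\<^sup>2 * (L2_norm Q g)\<^sup>2"
  using L2_norm_add_sq[OF assms(1) L2_mult_left[OF assms(2), of c]]
  by (simp add: L2_norm_mult_left power_mult_distrib mult.left_commute)

lemma cost_expansion:
  assumes y: "y \<in> L2 Q" and yd: "yd \<in> L2 Q" and u: "u \<in> L2 Q" and d: "d \<in> L2 Q" and k: "k \<in> L2 Q"
  shows "cost \<Omega> T lam yd (\<lambda>z. y z + c * d z) (\<lambda>z. u z + c * k z)
    = cost \<Omega> T lam yd y u + c * (ipQ (\<lambda>z. y z - yd z) d + lam * ipQ u k)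
      + c\<^sup>2 * (1/2 * (L2_norm Q d)\<^sup>2 + lam/2 * (L2_norm Q k)\<^sup>2)"
proof -
  have "(\<lambda>z. y z + c * d z - yd z) = (\<lambda>z. (y z - yd z) + c * d z)" by auto
  then show ?thesis
    unfolding cost_def using norm_add_scaled_sq[OF L2_diff[OF y yd] d, of c] norm_add_scaled_sq[OF u k, of c]
    by (simp add: algebra_simps)
qed

lemma linear_part_nonneg:
  fixes a b :: real
  assumes "\<And>c. c > 0 \<Longrightarrow> 0 \<le> c * a + c\<^sup>2 * b"
  shows "0 \<le> a"
proof (rule ccontr)
  assume "\<not> 0 \<le> a"
  then have a: "a < 0" by simp
  \<comment> \<open>small enough for the linear term to dominate: \<open>c \<bar>b\<bar> < - a / 2\<close>\<close>
  define c where "c = - a / (2 * (\<bar>b\<bar> + 1))"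
  have c: "c > 0" unfolding c_def by (rule divide_pos_pos) (use a in auto)
  have "0 \<le> c * (a + c * b)" using assms[OF c] by (simp add: algebra_simps power2_eq_square)
  then have "0 \<le> a + c * b" using c by (simp add: zero_le_mult_iff)
  also have "c * b \<le> c * (\<bar>b\<bar> + 1)" using c by (intro mult_left_mono) auto
  also have "c * (\<bar>b\<bar> + 1) = - a / 2" by (simp add: c_def field_simps)
  finally show False using a by simp
qed

text \<open>The cost is quadratic along the segment of admissible pairs from the optimal pair to
  \<open>(y\<^sub>v, v)\<close>, its derivative at the optimum is not negative, and its quadratic part is the error.\<close>

lemma error_le_cost_difference:
  assumes opt: "optimal_control \<Omega> T \<sigma> \<nu> lam yd u" and yu: "is_state \<Omega> T \<sigma> \<nu> u yu"
    and v: "v \<in> L2 Q" and yv: "is_state \<Omega> T \<sigma> \<nu> v yv" and yd: "yd \<in> L2 Q"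
  shows "error_sq \<Omega> T lam yu yv u v \<le> cost \<Omega> T lam yd yv v - cost \<Omega> T lam yd yu u"
proof -
  have u: "u \<in> L2 Q" using opt by (simp add: optimal_control_def)
  obtain y where y: "is_state \<Omega> T \<sigma> \<nu> u y"
    and min: "\<And>v y'. v \<in> L2 Q \<Longrightarrow> is_state \<Omega> T \<sigma> \<nu> v y' \<Longrightarrow> cost \<Omega> T lam yd y u \<le> cost \<Omega> T lam yd y' v"
    using opt by (auto simp: optimal_control_def)
  have L: "y \<in> L2 Q" "yu \<in> L2 Q" "yv \<in> L2 Q"
    using y yu yv by (auto simp: is_state_eq H_1_half_L2)
  let ?d = "\<lambda>z. yv z - yu z" and ?k = "\<lambda>z. v z - u z"
  have dL: "?d \<in> L2 Q" and kL: "?k \<in> L2 Q" by (intro L2_diff L u v)+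
  have dk: "is_state \<Omega> T \<sigma> \<nu> ?k ?d" using is_state_lincomb[OF yv yu v u, of "-1"] by simp
  let ?l = "ipQ (\<lambda>z. y z - yd z) ?d + lam * ipQ u ?k"
  let ?q = "1/2 * (L2_norm Q ?d)\<^sup>2 + lam/2 * (L2_norm Q ?k)\<^sup>2"
  have l: "0 \<le> ?l"
  proof (rule linear_part_nonneg)
    fix c :: real
    have "cost \<Omega> T lam yd y u \<le> cost \<Omega> T lam yd (\<lambda>z. y z + c * ?d z) (\<lambda>z. u z + c * ?k z)"
      by (intro min is_state_lincomb[OF y dk u kL] L2_add L2_mult_left u kL)
    then show "0 \<le> c * ?l + c\<^sup>2 * ?q"
      unfolding cost_expansion[OF L(1) yd u dL kL] by simp
  qed
  have "ipQ (\<lambda>z. yu z - yd z) ?d - ipQ (\<lambda>z. y z - yd z) ?d = ipQ (\<lambda>z. yu z - y z) ?d"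
    using L2_integrable_mult[OF L2_diff[OF L(2) yd] dL] L2_integrable_mult[OF L2_diff[OF L(1) yd] dL]
    by (simp flip: Bochner_Integration.integral_diff add: left_diff_distrib)
  moreover have "ipQ (\<lambda>z. yu z - y z) ?d = 0"
    using L2_Cauchy_Schwarz_mult[OF L2_diff[OF L(2,1)] dL] state_unique[OF yu y] by simp
  ultimately have "0 \<le> ipQ (\<lambda>z. yu z - yd z) ?d + lam * ipQ u ?k" using l by simp
  moreover have "cost \<Omega> T lam yd yv v = cost \<Omega> T lam yd yu u + (ipQ (\<lambda>z. yu z - yd z) ?d + lam * ipQ u ?k) + ?q"
    using cost_expansion[OF L(2) yd u dL kL, of lam 1] by simp
  moreover have "error_sq \<Omega> T lam yu yv u v = ?q"
    unfolding error_sq_def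
    using L2_norm_uminus[of Q ?d] L2_norm_uminus[of Q ?k] by simp
  ultimately show ?thesis by simp
qed

lemma weighted_square_sum:
  fixes a b c :: real
  assumes "c > 0"
  shows "(a + b)\<^sup>2 \<le> (1 + c) * a\<^sup>2 + (1 + 1 / c) * b\<^sup>2"
proof -
  have "0 \<le> (c * a - b)\<^sup>2 / c" using assms by simp
  also have "\<dots> = (1 + c) * a\<^sup>2 + (1 + 1 / c) * b\<^sup>2 - (a + b)\<^sup>2"
    using assms by (simp add: power2_eq_square field_simps)
  finally show ?thesis by simp
qed

lemma cost_le_J_plus:
  assumes y: "is_state \<Omega> T \<sigma> \<nu> v y" and v: "v \<in> L2 Q" and yd: "yd \<in> L2 Q"
    and \<eta>: "\<eta> \<in> H_1_1 \<Omega> T" and \<tau>: "\<tau> \<in> H_div \<Omega> T"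
    and \<alpha>: "\<alpha> > 0" and \<beta>: "\<beta> > 0" and m: "0 < m" "m \<le> n0"
  shows "cost \<Omega> T lam yd y v \<le> J_plus \<Omega> T \<sigma> \<nu> lam yd C m \<alpha> \<beta> \<eta> \<tau> v"
proof -
  let ?e = "\<lambda>z. y z - \<eta> z"
  let ?r1 = "L2_norm Q (R1 \<Omega> T \<sigma> \<eta> \<tau> v)" and ?r2 = "L2_norm Q (R2 \<Omega> T \<nu> \<eta> \<tau>)"
  let ?p = "L2_norm Q (\<lambda>z. \<eta> z - yd z)" and ?E = "L2_norm Q ?e" and ?G = "L2_norm Q (grad_x \<Omega> T ?e)"
  have Cpos: "C > 0" using C by (simp add: friedrichs_constant_def)
  have yH: "y \<in> H_1_half \<Omega> T" using y by (simp add: is_state_eq)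
  have L: "y \<in> L2 Q" "\<eta> \<in> L2 Q" by (rule H_1_half_L2[OF yH], rule H_1_half_L2[OF H_1_1_H_1_half[OF \<eta>]])
  have eH: "?e \<in> H_1_half \<Omega> T" by (rule H_1_half_diff[OF yH H_1_1_H_1_half[OF \<eta>]])
  have "m * ?G \<le> n0 * ?G" by (intro mult_right_mono m L2_norm_nonneg)
  also have "\<dots> \<le> C * ?r1 + ?r2" by (rule state_error_bound[OF y v \<eta> \<tau>])
  finally have G: "?G \<le> (?r2 + C * ?r1) / m" using m by (simp add: field_simps)
  have "?E \<le> C * ?G" by (rule Friedrichs_cyl[OF C eH])
  also have "\<dots> \<le> C * ((?r2 + C * ?r1) / m)" using Cpos by (intro mult_left_mono G) simp
  finally have "?E\<^sup>2 \<le> (C * ((?r2 + C * ?r1) / m))\<^sup>2" by (intro power_mono L2_norm_nonneg)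
  also have "\<dots> = C\<^sup>2 / m\<^sup>2 * (?r2 + C * ?r1)\<^sup>2" by (simp add: power_mult_distrib power_divide)
  also have "\<dots> \<le> C\<^sup>2 / m\<^sup>2 * ((1 + \<beta>) * ?r2\<^sup>2 + (1 + 1 / \<beta>) * (C * ?r1)\<^sup>2)"
    by (intro mult_left_mono weighted_square_sum[OF \<beta>]) simp
  also have "\<dots> = C\<^sup>2 / m\<^sup>2 * ((1 + \<beta>) * (?r2\<^sup>2 + C\<^sup>2 / \<beta> * ?r1\<^sup>2))"
    using \<beta> by (simp add: field_simps power_mult_distrib)
  finally have E: "?E\<^sup>2 \<le> C\<^sup>2 / m\<^sup>2 * ((1 + \<beta>) * (?r2\<^sup>2 + C\<^sup>2 / \<beta> * ?r1\<^sup>2))" .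
  have "L2_norm Q (\<lambda>z. y z - yd z) \<le> ?p + ?E"
    using L2_norm_diff_triangle[OF L yd] by simp
  then have "(L2_norm Q (\<lambda>z. y z - yd z))\<^sup>2 \<le> (?p + ?E)\<^sup>2" by (intro power_mono L2_norm_nonneg)
  also have "\<dots> \<le> (1 + \<alpha>) * ?p\<^sup>2 + (1 + 1 / \<alpha>) * ?E\<^sup>2" by (rule weighted_square_sum[OF \<alpha>])
  also have "\<dots> \<le> (1 + \<alpha>) * ?p\<^sup>2 + (1 + 1 / \<alpha>) * (C\<^sup>2 / m\<^sup>2 * ((1 + \<beta>) * (?r2\<^sup>2 + C\<^sup>2 / \<beta> * ?r1\<^sup>2)))"
    using \<alpha> by (intro add_left_mono mult_left_mono E) simp
  also have "(1 + 1 / \<alpha>) * (C\<^sup>2 / m\<^sup>2 * ((1 + \<beta>) * (?r2\<^sup>2 + C\<^sup>2 / \<beta> * ?r1\<^sup>2)))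
      = 2 * (gamma_const \<alpha> \<beta> C m * (?r2\<^sup>2 + C\<^sup>2 / \<beta> * ?r1\<^sup>2))"
  proof -
    have "(1 + 1 / \<alpha>) * (C\<^sup>2 / m\<^sup>2 * (1 + \<beta>)) = 2 * gamma_const \<alpha> \<beta> C m"
      using \<alpha> m by (simp add: gamma_const_def field_simps)
    then show ?thesis by (metis mult.assoc)
  qed
  finally show ?thesis unfolding cost_def J_plus_def by linarith
qed

text \<open>Expanding the cost at \<open>(\<eta>, - \<zeta> / \<lambda>)\<close> leaves two nonnegative squares and the adjoint residual
  tested with \<open>y - \<eta>\<close>.  The state error contains the control defect \<open>u + \<zeta> / \<lambda>\<close>, which the second
  square absorbs by Young's inequality.\<close>

lemma J_minus_le_cost:
  assumes y: "is_state \<Omega> T \<sigma> \<nu> u y" and u: "u \<in> L2 Q" and yd: "yd \<in> L2 Q"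
    and \<eta>: "\<eta> \<in> H_1_1 \<Omega> T" and \<zeta>: "\<zeta> \<in> H_1_1 \<Omega> T" and \<tau>: "\<tau> \<in> H_div \<Omega> T" and \<rho>: "\<rho> \<in> H_div \<Omega> T"
    and lam: "lam > 0" and m: "0 < m" "m \<le> n0"
  shows "J_minus \<Omega> T \<sigma> \<nu> lam yd C m \<eta> \<zeta> \<tau> \<rho> \<le> cost \<Omega> T lam yd y u"
proof -
  let ?e = "\<lambda>z. y z - \<eta> z" and ?v = "\<lambda>z. - (1 / lam) * \<zeta> z"
  let ?k = "\<lambda>z. u z - ?v z"
  define a where "a = C * L2_norm Q (R1 \<Omega> T \<sigma> \<eta> \<tau> ?v) + L2_norm Q (R2 \<Omega> T \<nu> \<eta> \<tau>)"
  define b where "b = C * L2_norm Q (R3 \<Omega> T \<sigma> yd \<zeta> \<rho> \<eta>) + L2_norm Q (R4 \<Omega> T \<nu> \<zeta> \<rho>)"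
  define G where "G = L2_norm Q (grad_x \<Omega> T ?e)"
  define K where "K = L2_norm Q ?k"
  have Cpos: "C > 0" using C by (simp add: friedrichs_constant_def)
  have yH: "y \<in> H_1_half \<Omega> T" and \<eta>H: "\<eta> \<in> H_1_half \<Omega> T" and \<zeta>H: "\<zeta> \<in> H_1_half \<Omega> T"
    using y \<eta> \<zeta> by (auto simp: is_state_eq H_1_1_H_1_half)
  note yL = H_1_half_L2[OF yH] and \<eta>L = H_1_half_L2[OF \<eta>H] and \<zeta>L = H_1_half_L2[OF \<zeta>H]
  have eH: "?e \<in> H_1_half \<Omega> T" by (rule H_1_half_diff[OF yH \<eta>H])
  note eL = H_1_half_L2[OF eH]
  have vL: "?v \<in> L2 Q" by (rule L2_mult_left[OF \<zeta>L])
  have kL: "?k \<in> L2 Q" by (rule L2_diff[OF u vL])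
  have G0: "0 \<le> G" and K0: "0 \<le> K" by (simp_all add: G_def K_def L2_norm_nonneg)
  have b0: "0 \<le> b" unfolding b_def using Cpos by (simp add: L2_norm_nonneg)
  \<comment> \<open>the residuals at the two controls differ by the control defect\<close>
  have "L2_norm Q (R1 \<Omega> T \<sigma> \<eta> \<tau> u) \<le> L2_norm Q (R1 \<Omega> T \<sigma> \<eta> \<tau> ?v) + K"
  proof -
    have "R1 \<Omega> T \<sigma> \<eta> \<tau> u = (\<lambda>z. R1 \<Omega> T \<sigma> \<eta> \<tau> ?v z - ?k z)" by (auto simp: R1_def)
    then show ?thesis unfolding K_def using L2_norm_triangle_diff[OF R1_L2[OF \<eta> \<tau> vL] kL] by simp
  qed
  then have "C * L2_norm Q (R1 \<Omega> T \<sigma> \<eta> \<tau> u) \<le> C * L2_norm Q (R1 \<Omega> T \<sigma> \<eta> \<tau> ?v) + C * K"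
    using Cpos by (simp flip: distrib_left)
  then have "n0 * G \<le> a + C * K"
    using state_error_bound[OF y u \<eta> \<tau>] unfolding G_def a_def by linarith
  moreover have "m * G \<le> n0 * G" by (intro mult_right_mono m G0)
  ultimately have "G \<le> (a + C * K) / m" using m by (simp add: field_simps)
  then have "b * G \<le> b * ((a + C * K) / m)" by (intro mult_left_mono b0)
  also have "\<dots> = 1 / m * a * b + K * (C * b / m)"
    by (simp add: distrib_left add_divide_distrib mult_ac)
  also have "K * (C * b / m) \<le> lam / 2 * K\<^sup>2 + (C * b / m)\<^sup>2 / (2 * lam)"
  proof -
    have "0 \<le> (lam * K - C * b / m)\<^sup>2 / (2 * lam)" using lam by simp
    also have "\<dots> = lam / 2 * K\<^sup>2 + (C * b / m)\<^sup>2 / (2 * lam) - K * (C * b / m)"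
      using lam m by (simp add: power2_diff power2_eq_square field_simps)
    finally show ?thesis by simp
  qed
  also have "(C * b / m)\<^sup>2 / (2 * lam) \<le> (C * b / m)\<^sup>2 / lam"
    using lam by (intro divide_left_mono) auto
  also have "(C * b / m)\<^sup>2 / lam = C\<^sup>2 / (m\<^sup>2 * lam) * b\<^sup>2" by (simp add: power_divide power_mult_distrib)
  finally have bG: "b * G \<le> 1 / m * a * b + (lam / 2 * K\<^sup>2 + C\<^sup>2 / (m\<^sup>2 * lam) * b\<^sup>2)" by simp
  have res: "- (b * G) \<le> ipQ (\<lambda>z. \<eta> z - yd z) ?e - st_form ?e \<zeta>"
    using adjoint_residual[OF \<zeta> \<rho> \<eta>L yd eH] unfolding b_def G_def by linarith
  have mixed: "mixed_integral \<Omega> T \<sigma> \<nu> lam \<eta> \<zeta> = st_form \<eta> \<zeta> + 1 / lam * (L2_norm Q \<zeta>)\<^sup>2"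
  proof -
    have "integrable (lebesgue_on Q) (\<lambda>z. \<nu> (fst z) * (grad_x \<Omega> T \<eta> z \<bullet> grad_x \<Omega> T \<zeta> z))"
      by (intro diffusion_integrable grad_x_L2 \<eta>H \<zeta>H)
    moreover have "integrable (lebesgue_on Q) (\<lambda>z. \<sigma> (fst z) * dt \<Omega> T \<eta> z * \<zeta> z)"
      by (rule L2_integrable_mult[OF sigma_mult_L2[OF dt_L2[OF \<eta>]] \<zeta>L])
    moreover have "integrable (lebesgue_on Q) (\<lambda>z. (\<zeta> z)\<^sup>2)"
      using L2_integrable_sq[OF \<zeta>L] by simp
    ultimately show ?thesis
      unfolding mixed_integral_def diffusion_form_def time_form_dt[OF \<eta> \<zeta>L] L2_norm_sq by simp
  qed
  have "ipQ u \<zeta> = st_form y \<zeta>" using y \<zeta>H by (simp add: is_state_eq)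
  also have "\<dots> = st_form \<eta> \<zeta> + st_form ?e \<zeta>" using st_form_diff[OF yH \<eta>H \<zeta>H] by simp
  finally have u\<zeta>: "ipQ u \<zeta> = st_form \<eta> \<zeta> + st_form ?e \<zeta>" .
  have K2: "lam / 2 * K\<^sup>2 = lam / 2 * (L2_norm Q u)\<^sup>2 + ipQ u \<zeta> + 1 / (2 * lam) * (L2_norm Q \<zeta>)\<^sup>2"
  proof -
    have "K\<^sup>2 = (L2_norm Q u)\<^sup>2 + 2 * (1 / lam) * ipQ u \<zeta> + (1 / lam)\<^sup>2 * (L2_norm Q \<zeta>)\<^sup>2"
      unfolding K_def using norm_add_scaled_sq[OF u \<zeta>L, of "1 / lam"] by simp
    then show ?thesis using lam by (simp add: field_simps power2_eq_square)
  qed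
  have y2: "(L2_norm Q (\<lambda>z. y z - yd z))\<^sup>2 = (L2_norm Q (\<lambda>z. \<eta> z - yd z))\<^sup>2 + 2 * ipQ (\<lambda>z. \<eta> z - yd z) ?e + (L2_norm Q ?e)\<^sup>2"
    using norm_add_scaled_sq[OF L2_diff[OF \<eta>L yd] eL, of 1] by simp
  have "0 \<le> (L2_norm Q ?e)\<^sup>2" by simp
  moreover have "1 / lam * (L2_norm Q \<zeta>)\<^sup>2 = 2 * (1 / (2 * lam) * (L2_norm Q \<zeta>)\<^sup>2)" using lam by simp
  ultimately have "1/2 * (L2_norm Q (\<lambda>z. \<eta> z - yd z))\<^sup>2 + 1 / (2 * lam) * (L2_norm Q \<zeta>)\<^sup>2
      - mixed_integral \<Omega> T \<sigma> \<nu> lam \<eta> \<zeta> - C\<^sup>2 / (m\<^sup>2 * lam) * b\<^sup>2 - 1 / m * a * b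
    \<le> 1/2 * (L2_norm Q (\<lambda>z. y z - yd z))\<^sup>2 + lam / 2 * (L2_norm Q u)\<^sup>2"
    using bG res mixed u\<zeta> K2 y2 by argo
  then show ?thesis unfolding J_minus_def cost_def Let_def a_def b_def .
qed

end

end

lemma M_plus_eq_J_difference:
  "M_plus \<Omega> T \<sigma> \<nu> lam yd C m \<alpha> \<beta> \<eta> \<zeta> \<tau> \<rho> v
    = J_plus \<Omega> T \<sigma> \<nu> lam yd C m \<alpha> \<beta> \<eta> \<tau> v - J_minus \<Omega> T \<sigma> \<nu> lam yd C m \<eta> \<zeta> \<tau> \<rho>"
  unfolding M_plus_def J_plus_def J_minus_def Let_def by (simp add: field_simps)

theorem theorem4:
  fixes \<Omega> :: "'a::euclidean_space set"
    and T lam C\<^sub>F \<sigma>\<^sub>l \<sigma>\<^sub>u \<nu>\<^sub>l \<nu>\<^sub>u \<alpha> \<beta> :: real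
    and \<sigma> \<nu> :: "'a \<Rightarrow> real"
    and y\<^sub>d u v y\<^sub>u y\<^sub>v \<eta> \<zeta> :: "'a \<times> real \<Rightarrow> real"
    and \<tau> \<rho> :: "'a \<times> real \<Rightarrow> 'a"
  assumes "DIM('a) \<in> {1, 2, 3}"
    and "bounded \<Omega>" and "lipschitz_domain \<Omega>"
    and "T > 0" and "lam > 0"
    and "\<sigma> \<in> borel_measurable (lebesgue_on \<Omega>)" and "\<nu> \<in> borel_measurable (lebesgue_on \<Omega>)"
    and "0 < \<sigma>\<^sub>l" and "\<And>x. x \<in> \<Omega> \<Longrightarrow> \<sigma>\<^sub>l \<le> \<sigma> x \<and> \<sigma> x \<le> \<sigma>\<^sub>u"
    and "0 < \<nu>\<^sub>l" and "\<And>x. x \<in> \<Omega> \<Longrightarrow> \<nu>\<^sub>l \<le> \<nu> x \<and> \<nu> x \<le> \<nu>\<^sub>u"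
    and "friedrichs_constant \<Omega> C\<^sub>F"
    and "y\<^sub>d \<in> L2 (cyl \<Omega> T)"
    and "optimal_control \<Omega> T \<sigma> \<nu> lam y\<^sub>d u" and "is_state \<Omega> T \<sigma> \<nu> u y\<^sub>u"
    and "v \<in> L2 (cyl \<Omega> T)" and "is_state \<Omega> T \<sigma> \<nu> v y\<^sub>v"
    and "\<eta> \<in> H_1_1 \<Omega> T" and "\<zeta> \<in> H_1_1 \<Omega> T"
    and "\<tau> \<in> H_div \<Omega> T" and "\<rho> \<in> H_div \<Omega> T"
    and "\<alpha> > 0" and "\<beta> > 0"
  shows "error_sq \<Omega> T lam y\<^sub>u y\<^sub>v u v
           \<le> M_plus \<Omega> T \<sigma> \<nu> lam y\<^sub>d C\<^sub>F (mu1 \<nu>\<^sub>l \<sigma>\<^sub>l) \<alpha> \<beta> \<eta> \<zeta> \<tau> \<rho> v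
         \<and> M_plus \<Omega> T \<sigma> \<nu> lam y\<^sub>d C\<^sub>F (mu1 \<nu>\<^sub>l \<sigma>\<^sub>l) \<alpha> \<beta> \<eta> \<zeta> \<tau> \<rho> v
           = J_plus \<Omega> T \<sigma> \<nu> lam y\<^sub>d C\<^sub>F (mu1 \<nu>\<^sub>l \<sigma>\<^sub>l) \<alpha> \<beta> \<eta> \<tau> v
             - J_minus \<Omega> T \<sigma> \<nu> lam y\<^sub>d C\<^sub>F (mu1 \<nu>\<^sub>l \<sigma>\<^sub>l) \<eta> \<zeta> \<tau> \<rho>"
proof -
  let ?m = "mu1 \<nu>\<^sub>l \<sigma>\<^sub>l"
  have O: "open \<Omega>" using assms(3) by (simp add: lipschitz_domain_def)
  have \<sigma>b: "\<bar>\<sigma> x\<bar> \<le> \<sigma>\<^sub>u" and \<nu>b: "\<bar>\<nu> x\<bar> \<le> \<nu>\<^sub>u" and \<nu>l: "\<nu>\<^sub>l \<le> \<nu> x" if "x \<in> \<Omega>" for x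
    using assms(9)[OF that] assms(11)[OF that] assms(8,10) by auto
  have m: "0 < ?m" "?m \<le> \<nu>\<^sub>l"
  proof -
    show "0 < ?m" using assms(8,10) by (simp add: mu1_def)
    have "1 / sqrt 2 * min \<nu>\<^sub>l \<sigma>\<^sub>l \<le> 1 * \<nu>\<^sub>l" using assms(8,10) by (intro mult_mono) auto
    then show "?m \<le> \<nu>\<^sub>l" by (simp add: mu1_def)
  qed
  note ctx = O assms(2,4,6) \<sigma>b assms(7) \<nu>b assms(10) \<nu>l assms(12)
  have u: "u \<in> L2 (cyl \<Omega> T)" using assms(14) by (simp add: optimal_control_def)
  have "error_sq \<Omega> T lam y\<^sub>u y\<^sub>v u v \<le> cost \<Omega> T lam y\<^sub>d y\<^sub>v v - cost \<Omega> T lam y\<^sub>d y\<^sub>u u"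
    by (rule error_le_cost_difference[OF ctx assms(14-17,13)])
  moreover have "cost \<Omega> T lam y\<^sub>d y\<^sub>v v \<le> J_plus \<Omega> T \<sigma> \<nu> lam y\<^sub>d C\<^sub>F ?m \<alpha> \<beta> \<eta> \<tau> v"
    by (rule cost_le_J_plus[OF ctx assms(17,16,13,18,20,22,23) m])
  moreover have "J_minus \<Omega> T \<sigma> \<nu> lam y\<^sub>d C\<^sub>F ?m \<eta> \<zeta> \<tau> \<rho> \<le> cost \<Omega> T lam y\<^sub>d y\<^sub>u u"
    by (rule J_minus_le_cost[OF ctx assms(15) u assms(13,18-21,5) m])
  ultimately show ?thesis unfolding M_plus_eq_J_difference by linarith
qed

end
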